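(* Fix $\beta,\gamma>0$. There is an absolute constant $C>0$ such that for all sufficiently large $n$ and every $\epsilon$ with $1/n^{0.99}<\epsilon<1$ the following holds. Every $D$-regular (unweighted) graph $G$ on $n$ nodes with $D\geq\beta n$ and $\phi(G)\geq\gamma D$ contains, as a subgraph with reweighted edges, a $(1+\epsilon)$-resistance sparsifier of $G$ with at most $\epsilon^{-1}n(\log n)^{C/(\beta\gamma^2)}$ edges. Moreover, such a sparsifier can be found in randomized polynomial time.
   Context: Graphs are undirected. For a weighted graph $G(V,E,w)$ with nonnegative weights, let $D_G$ be the diagonal matrix of weighted degrees, $A$ the weighted adjacency matrix, and $L=D_G-A$ the Laplacian. The effective resistance between $u,v\in V$ is $R_G(u,v)=(e_u-e_v)^TP(e_u-e_v)$, where $P$ is the Moore–Penrose pseudo-inverse of $L$ and $e_u,e_v$ are standard basis vectors. For $\epsilon\in(0,1)$, a $(1+\epsilon)$-resistance sparsifier of $G$ is a subgraph $H(V,E',w')$ with reweighted (nonnegative) edges such that $(1-\epsilon)R_H(u,v)\leq R_G(u,v)\leq(1+\epsilon)R_H(u,v)$ for all $u,v\in V$. The edge-expansion of a weighted graph is $\phi(G)=\min\{w(S,\bar S)/|S| : S\subset V,\ 0<|S|\leq|V|/2\}$, where $w(S,\bar S)$ is the total weight of edges with exactly one endpoint in $S$. *)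

theory Defs
  imports
    "HOL-Probability.Probability"
    "HOL-Library.Log_Nat"
    "Jordan_Normal_Form.Matrix"
begin

section \<open>Weighted graphs, expansion and effective resistance\<close>

text \<open>The vertex set is \<open>{0..<n}\<close>, where \<open>n\<close> is the number of vertices; an edge is a
  two-element set of vertices. Weights are only meaningful on edges.\<close>

record weighted_graph =
  num_verts :: nat
  edges :: "nat set set"
  weight :: "nat set \<Rightarrow> real"

definition wf_weighted_graph :: "weighted_graph \<Rightarrow> bool" where
  "wf_weighted_graph G \<longleftrightarrow>
     (\<forall>e\<in>edges G. e \<subseteq> {0..<num_verts G} \<and> card e = 2 \<and> weight G e \<ge> 0)"

definition unweighted :: "weighted_graph \<Rightarrow> bool" where
  "unweighted G \<longleftrightarrow> (\<forall>e\<in>edges G. weight G e = 1)"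

definition weighted_degree :: "weighted_graph \<Rightarrow> nat \<Rightarrow> real" where
  "weighted_degree G v = (\<Sum>e\<in>{e\<in>edges G. v \<in> e}. weight G e)"

definition regular_graph :: "nat \<Rightarrow> weighted_graph \<Rightarrow> bool" where
  "regular_graph D G \<longleftrightarrow> wf_weighted_graph G \<and> unweighted G \<and>
     (\<forall>v<num_verts G. card {e\<in>edges G. v \<in> e} = D)"

definition cut_weight :: "weighted_graph \<Rightarrow> nat set \<Rightarrow> real" where
  "cut_weight G S = (\<Sum>e\<in>{e\<in>edges G. card (e \<inter> S) = 1}. weight G e)"

text \<open>The minimum ranges over a nonempty set as soon as there are at least two vertices.\<close>

definition edge_expansion :: "weighted_graph \<Rightarrow> real" where
  "edge_expansion G =
     Min ((\<lambda>S. cut_weight G S / real (card S)) `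
       {S. S \<subseteq> {0..<num_verts G} \<and> 0 < card S \<and> real (card S) \<le> real (num_verts G) / 2})"

definition degree_matrix :: "weighted_graph \<Rightarrow> real mat" where
  "degree_matrix G = Matrix.mat (num_verts G) (num_verts G)
     (\<lambda>(u, v). if u = v then weighted_degree G u else 0)"

definition adjacency_matrix :: "weighted_graph \<Rightarrow> real mat" where
  "adjacency_matrix G = Matrix.mat (num_verts G) (num_verts G)
     (\<lambda>(u, v). if {u, v} \<in> edges G then weight G {u, v} else 0)"

definition laplacian :: "weighted_graph \<Rightarrow> real mat" where
  "laplacian G = degree_matrix G - adjacency_matrix G"

text \<open>The four Penrose conditions for real matrices.\<close>

definition is_pseudo_inverse :: "real mat \<Rightarrow> real mat \<Rightarrow> bool" where
  "is_pseudo_inverse A P \<longleftrightarrow>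
     P \<in> carrier_mat (dim_col A) (dim_row A) \<and>
     A * P * A = A \<and> P * A * P = P \<and>
     transpose_mat (A * P) = A * P \<and> transpose_mat (P * A) = P * A"

lemma is_pseudo_inverse_unique:
  assumes P: "is_pseudo_inverse A P" and Q: "is_pseudo_inverse A Q"
  shows "P = Q"
proof -
  define m n where "m = dim_row A" and "n = dim_col A"
  have A: "A \<in> carrier_mat m n" by (auto simp: m_def n_def)
  have cP: "P \<in> carrier_mat n m" and cQ: "Q \<in> carrier_mat n m"
    using P Q by (auto simp: is_pseudo_inverse_def m_def n_def)
  note c = A cP cQ
  have P': "A * P * A = A" "P * A * P = P"
      "transpose_mat (A * P) = A * P" "transpose_mat (P * A) = P * A"
    and Q': "A * Q * A = A" "Q * A * Q = Q"
      "transpose_mat (A * Q) = A * Q" "transpose_mat (Q * A) = Q * A"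
    using P Q by (auto simp: is_pseudo_inverse_def)
  have AP: "A * P \<in> carrier_mat m m" and AQ: "A * Q \<in> carrier_mat m m"
    and PA: "P * A \<in> carrier_mat n n" and QA: "Q * A \<in> carrier_mat n n"
    using c by auto
  have "A * P = (A * Q * A) * P" by (simp add: Q')
  also have "\<dots> = (A * Q) * (A * P)" by (rule assoc_mult_mat[OF AQ A cP])
  finally have 1: "A * P = (A * Q) * (A * P)" .
  have "A * P = transpose_mat ((A * Q) * (A * P))" using P'(3) 1 by simp
  also have "\<dots> = (A * P) * (A * Q)"
    using transpose_mult[OF AQ AP] P'(3) Q'(3) by simp
  also have "\<dots> = (A * P * A) * Q" by (rule assoc_mult_mat[OF AP A cQ, symmetric])
  finally have 2: "A * P = A * Q" using P'(1) by simp
  have "P * A = P * (A * Q * A)" by (simp add: Q')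
  also have "\<dots> = P * (A * (Q * A))" using assoc_mult_mat[OF A cQ A] by simp
  also have "\<dots> = (P * A) * (Q * A)" by (rule assoc_mult_mat[OF cP A QA, symmetric])
  finally have 3: "P * A = (P * A) * (Q * A)" .
  have "P * A = transpose_mat ((P * A) * (Q * A))" using P'(4) 3 by simp
  also have "\<dots> = (Q * A) * (P * A)"
    using transpose_mult[OF PA QA] P'(4) Q'(4) by simp
  also have "\<dots> = Q * (A * (P * A))" by (rule assoc_mult_mat[OF cQ A PA])
  also have "A * (P * A) = A" using assoc_mult_mat[OF A cP A] P'(1) by simp
  finally have 4: "P * A = Q * A" .
  have "P = (Q * A) * P" using P'(2) 4 by simp
  also have "\<dots> = Q * (A * P)" by (rule assoc_mult_mat[OF cQ A cP])
  also have "\<dots> = Q * (A * Q)" by (simp add: 2)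
  also have "\<dots> = Q * A * Q" by (rule assoc_mult_mat[OF cQ A cQ, symmetric])
  finally show ?thesis using Q'(2) by simp
qed

definition pseudo_inverse :: "real mat \<Rightarrow> real mat" where
  "pseudo_inverse A = (THE P. is_pseudo_inverse A P)"

definition effective_resistance :: "weighted_graph \<Rightarrow> nat \<Rightarrow> nat \<Rightarrow> real" where
  "effective_resistance G u v =
     (let x = unit_vec (num_verts G) u - unit_vec (num_verts G) v
      in scalar_prod x (pseudo_inverse (laplacian G) *\<^sub>v x))"

definition reweighted_subgraph :: "weighted_graph \<Rightarrow> weighted_graph \<Rightarrow> bool" where
  "reweighted_subgraph H G \<longleftrightarrow>
     wf_weighted_graph H \<and> num_verts H = num_verts G \<and> edges H \<subseteq> edges G"

definition resistance_sparsifier :: "real \<Rightarrow> weighted_graph \<Rightarrow> weighted_graph \<Rightarrow> bool" where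
  "resistance_sparsifier \<epsilon> G H \<longleftrightarrow> reweighted_subgraph H G \<and>
     (\<forall>u<num_verts G. \<forall>v<num_verts G.
        (1 - \<epsilon>) * effective_resistance H u v \<le> effective_resistance G u v \<and>
        effective_resistance G u v \<le> (1 + \<epsilon>) * effective_resistance H u v)"


section \<open>Randomized polynomial time\<close>

text \<open>The machine model is a random access machine with logarithmic cost, programmed by
  structured programs. The memory consists of named arrays of natural numbers (a program
  mentions only finitely many names); scalar variables are arrays used at index 0. The cost of
  an expression is the total bit length of all values, addresses included, occurring in its
  evaluation, plus one for each operation. Hence running times agree with those of Turing
  machines up to polynomials.\<close>

type_synonym store = "string \<Rightarrow> nat \<Rightarrow> nat"

datatype expr =
    Const nat
  | Read string expr
  | Add expr expr
  | Sub expr expr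
  | Mul expr expr
  | Div expr expr

fun expr_val :: "expr \<Rightarrow> store \<Rightarrow> nat" where
  "expr_val (Const k) s = k"
| "expr_val (Read a i) s = s a (expr_val i s)"
| "expr_val (Add x y) s = expr_val x s + expr_val y s"
| "expr_val (Sub x y) s = expr_val x s - expr_val y s"
| "expr_val (Mul x y) s = expr_val x s * expr_val y s"
| "expr_val (Div x y) s = expr_val x s div expr_val y s"

text \<open>\<open>floorlog 2 k\<close> is the number of binary digits of \<open>k\<close>, and is 0 for \<open>k = 0\<close>.\<close>

fun expr_cost :: "expr \<Rightarrow> store \<Rightarrow> nat" where
  "expr_cost (Const k) s = 1 + floorlog 2 k"
| "expr_cost (Read a i) s = expr_cost i s + 1 + floorlog 2 (expr_val (Read a i) s)"
| "expr_cost (Add x y) s =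
     expr_cost x s + expr_cost y s + 1 + floorlog 2 (expr_val (Add x y) s)"
| "expr_cost (Sub x y) s =
     expr_cost x s + expr_cost y s + 1 + floorlog 2 (expr_val (Sub x y) s)"
| "expr_cost (Mul x y) s =
     expr_cost x s + expr_cost y s + 1 + floorlog 2 (expr_val (Mul x y) s)"
| "expr_cost (Div x y) s =
     expr_cost x s + expr_cost y s + 1 + floorlog 2 (expr_val (Div x y) s)"

datatype prog =
    Skip
  | Assign string expr expr \<comment> \<open>array name, index, new value\<close>
  | Flip string expr \<comment> \<open>stores a fresh random bit in the given array cell\<close>
  | Seq prog prog
  | If expr prog prog
  | While expr prog

definition store_upd :: "store \<Rightarrow> string \<Rightarrow> nat \<Rightarrow> nat \<Rightarrow> store" where
  "store_upd s a i x = s(a := (s a)(i := x))"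

text \<open>\<open>exec c s r t s' r'\<close>: started in store \<open>s\<close> with the supply \<open>r\<close> of random bits, \<open>c\<close> halts
  after \<open>t\<close> steps in store \<open>s'\<close>, leaving the bits \<open>r'\<close> unused. A nonzero guard counts as true.
  A \<open>Flip\<close> with an exhausted supply has no execution.\<close>

inductive exec :: "prog \<Rightarrow> store \<Rightarrow> bool list \<Rightarrow> nat \<Rightarrow> store \<Rightarrow> bool list \<Rightarrow> bool" where
  exec_Skip: "exec Skip s r 1 s r"
| exec_Assign: "exec (Assign a i x) s r (1 + expr_cost i s + expr_cost x s)
     (store_upd s a (expr_val i s) (expr_val x s)) r"
| exec_Flip: "exec (Flip a i) s (b # r) (1 + expr_cost i s)
     (store_upd s a (expr_val i s) (of_bool b)) r"
| exec_Seq: "exec c1 s r t1 s1 r1 \<Longrightarrow> exec c2 s1 r1 t2 s2 r2 \<Longrightarrow>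
     exec (Seq c1 c2) s r (1 + t1 + t2) s2 r2"
| exec_IfTrue: "expr_val x s \<noteq> 0 \<Longrightarrow> exec c1 s r t s' r' \<Longrightarrow>
     exec (If x c1 c2) s r (1 + expr_cost x s + t) s' r'"
| exec_IfFalse: "expr_val x s = 0 \<Longrightarrow> exec c2 s r t s' r' \<Longrightarrow>
     exec (If x c1 c2) s r (1 + expr_cost x s + t) s' r'"
| exec_WhileFalse: "expr_val x s = 0 \<Longrightarrow> exec (While x c) s r (1 + expr_cost x s) s r"
| exec_WhileTrue: "expr_val x s \<noteq> 0 \<Longrightarrow> exec c s r t1 s1 r1 \<Longrightarrow>
     exec (While x c) s1 r1 t2 s2 r2 \<Longrightarrow>
     exec (While x c) s r (1 + expr_cost x s + t1 + t2) s2 r2"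

text \<open>A search problem (with a promise) is given by its set of instances, their size, their
  encoding as an initial store, and the condition under which a final store represents a correct
  answer. It is solvable in randomized polynomial time if one program halts within polynomially
  many steps on every instance, whatever the coin tosses, and answers correctly with probability
  at least 2/3. Since every coin toss takes a step, providing as many random bits as the time
  bound never restricts the program.\<close>

definition randomized_poly_time ::
    "'i set \<Rightarrow> ('i \<Rightarrow> nat) \<Rightarrow> ('i \<Rightarrow> store) \<Rightarrow> ('i \<Rightarrow> store \<Rightarrow> bool) \<Rightarrow> bool" where
  "randomized_poly_time instances isize encode correct \<longleftrightarrow>
     (\<exists>c k. \<forall>x\<in>instances. let T = isize x ^ k + k; R = {r :: bool list. length r = T} in
        (\<forall>r\<in>R. \<exists>t s' r'. exec c (encode x) r t s' r' \<and> t \<le> T) \<and>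
        measure_pmf.prob (pmf_of_set R)
          {r. \<exists>t s' r'. exec c (encode x) r t s' r' \<and> correct x s'} \<ge> 2 / 3)"

text \<open>An instance is a graph together with the numerator and denominator of a rational accuracy
  parameter. The graph is given by its adjacency matrix in row-major order.\<close>

type_synonym sparsifier_instance = "weighted_graph \<times> nat \<times> nat"

fun instance_size :: "sparsifier_instance \<Rightarrow> nat" where
  "instance_size (G, p, q) = (num_verts G)\<^sup>2 + floorlog 2 p + floorlog 2 q"

fun encode_instance :: "sparsifier_instance \<Rightarrow> store" where
  "encode_instance (G, p, q) = (\<lambda>a i.
     if a = ''n'' \<and> i = 0 then num_verts G
     else if a = ''p'' \<and> i = 0 then p
     else if a = ''q'' \<and> i = 0 then q
     else if a = ''adj'' then
       of_bool (\<exists>u<num_verts G. \<exists>v<num_verts G. i = u * num_verts G + v \<and> {u, v} \<in> edges G)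
     else 0)"

text \<open>The answer is read off the upper triangular parts of three matrices, holding edge
  indicators and the numerators and denominators of the rational edge weights.\<close>

definition decode_graph :: "nat \<Rightarrow> store \<Rightarrow> weighted_graph" where
  "decode_graph n s =
     \<lparr> num_verts = n,
       edges = {{u, v} | u v. u < v \<and> v < n \<and> s ''edge'' (u * n + v) \<noteq> 0},
       weight = (\<lambda>e. let i = Min e * n + Max e in real (s ''num'' i) / real (s ''den'' i)) \<rparr>"

end

theory Submission
  imports Defs "Jordan_Normal_Form.Determinant" "HOL-Real_Asymp.Real_Asymp"
begin

text \<open>In a weighted graph with degrees \<open>d\<close>, maximal weight \<open>w\<close> and spectral gap \<open>l\<close> of the Laplacian, the
  effective resistance of \<open>u\<close> and \<open>v\<close> is \<open>1 / d u + 1 / d v\<close> up to a relative error \<open>O(w / l)\<close>. By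
  Cheeger's inequality it therefore suffices to find a reweighted subgraph with bounded weight ratios,
  constant expansion and degrees in \<open>D * (1 \<plusminus> O(\<epsilon>))\<close>.

  Sample every edge with probability \<open>pr = 1 / 2 ^ k\<close> such that \<open>pr * D\<close> is polylogarithmic times \<open>1 / \<epsilon>\<close>.
  The cuts are preserved up to a constant, but the degrees fluctuate by the square root of \<open>pr * D\<close>,
  which would only allow \<open>n / \<epsilon>\<^sup>2\<close> edges. The fluctuations are removed by integer weights in \<open>[M, 32 M]\<close>,
  chosen by a local search that minimizes the sum of the squared deviations of the degrees from
  \<open>t = 8 * M * pr * D\<close>. In a local optimum, edges between vertices of too large degree have the smallest
  weight and edges between vertices of too small degree the largest one. Testing this against the sign
  vector of the vertices that deviate by more than a given level, and using a Chernoff bound for all sign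
  vectors of the sample, shows that the degrees deviate from \<open>t\<close> by \<open>O(M * ln n)\<close> only.\<close>

section \<open>Poincare inequality and potentials\<close>

text \<open>The weight range is tuned to the losses of the sampling bounds, which are affordable for
  all sign vectors at once only up to constant factors. The upper tail loses a factor 8, the lower
  tail a factor 4. The smallest weight M times 8 and the largest weight 32 M divided by 4 give the
  same coefficient 8 M * pr on both signs, and the two parts recombine to exactly t times the sum of
  the signs. The additive loss is a multiple of ln n per vertex of the support, which just pays for
  the number of vectors with that support. Local optimality speaks about an edge only if the
  deviations of its ends add up to at least 2 in absolute value, so the level must be bordered by a
  gap. Finding one costs up to n units of weight, and M = 2 ^ k * n makes the unit fine enough for
  this to be negligible. Dividing by 8 n at the end turns t into D. The search decreases an integer
  of polynomial size, so unit steps suffice; every tape halts, and only the sample decides about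
  success. Two logarithms in the edge count come from the sampling rate, a third one absorbs
  constants.\<close>

definition energy :: "nat \<Rightarrow> (nat \<Rightarrow> nat \<Rightarrow> real) \<Rightarrow> (nat \<Rightarrow> real) \<Rightarrow> real" where
  "energy n W f = (\<Sum>i<n. \<Sum>j<n. W i j * (f i - f j)\<^sup>2) / 2"

definition lap :: "nat \<Rightarrow> (nat \<Rightarrow> nat \<Rightarrow> real) \<Rightarrow> (nat \<Rightarrow> real) \<Rightarrow> nat \<Rightarrow> real" where
  "lap n W f i = (\<Sum>j<n. W i j * (f i - f j))"

lemma sum_lap_symmetric:
  fixes W :: "nat \<Rightarrow> nat \<Rightarrow> real"
  assumes sym: "\<And>i j. W i j = W j i"
  shows "(\<Sum>i<n. g i * lap n W f i) = (\<Sum>i<n. \<Sum>j<n. W i j * (f i - f j) * (g i - g j)) / 2"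
proof -
  define T where "T = (\<Sum>i<n. \<Sum>j<n. W i j * (f i - f j) * g i)"
  have "T = (\<Sum>j<n. \<Sum>i<n. W j i * (f j - f i) * g j)" by (simp add: T_def)
  also have "\<dots> = (\<Sum>i<n. \<Sum>j<n. W j i * (f j - f i) * g j)" by (rule sum.swap)
  also have "\<dots> = - (\<Sum>i<n. \<Sum>j<n. W i j * (f i - f j) * g j)"
    by (simp add: sum_negf[symmetric] sym algebra_simps)
  finally have T2: "T = - (\<Sum>i<n. \<Sum>j<n. W i j * (f i - f j) * g j)" .
  have "(\<Sum>i<n. \<Sum>j<n. W i j * (f i - f j) * (g i - g j)) =
      T - (\<Sum>i<n. \<Sum>j<n. W i j * (f i - f j) * g j)"
    by (simp add: T_def sum_subtractf right_diff_distrib)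
  also have "\<dots> = 2 * T" using T2 by simp
  finally have "(\<Sum>i<n. \<Sum>j<n. W i j * (f i - f j) * (g i - g j)) / 2 = T" by simp
  moreover have "(\<Sum>i<n. g i * lap n W f i) = T"
    by (simp add: T_def lap_def sum_distrib_left algebra_simps)
  ultimately show ?thesis by simp
qed

lemma lap_self_adjoint:
  assumes "\<And>i j. W i j = W j i"
  shows "(\<Sum>i<n. g i * lap n W f i) = (\<Sum>i<n. f i * lap n W g i)"
  unfolding sum_lap_symmetric[of W, OF assms] by (simp add: algebra_simps)

lemma energy_eq_lap:
  assumes "\<And>i j. W i j = W j i"
  shows "energy n W f = (\<Sum>i<n. f i * lap n W f i)"
  unfolding sum_lap_symmetric[of W, OF assms] energy_def
  by (simp add: power2_eq_square mult.assoc)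

lemma sum_lap_zero:
  assumes "\<And>i j. W i j = W j i"
  shows "(\<Sum>i<n. lap n W f i) = 0"
  using sum_lap_symmetric[of W "\<lambda>_. 1" n f, OF assms] by simp

lemma energy_nonneg:
  assumes "\<And>i j. W i j \<ge> 0"
  shows "energy n W f \<ge> 0"
  unfolding energy_def using assms by (auto intro!: sum_nonneg divide_nonneg_nonneg)

text \<open>The variational form of the statement that the second smallest eigenvalue of the
  Laplacian is at least \<open>l\<close>.\<close>

definition poincare :: "nat \<Rightarrow> (nat \<Rightarrow> nat \<Rightarrow> real) \<Rightarrow> real \<Rightarrow> bool" where
  "poincare n W l \<longleftrightarrow> (\<forall>f. (\<Sum>i<n. f i) = 0 \<longrightarrow> l * (\<Sum>i<n. (f i)\<^sup>2) \<le> energy n W f)"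

text \<open>The pairing is the quadratic form of the pseudo-inverse at \<open>b\<close>. For the
  centred potential \<open>k\<close> it equals the energy E, and Cauchy-Schwarz with the Poincare
  inequality gives E^2 <= |b|^2 |k|^2 <= |b|^2 E / l.\<close>

lemma dual_energy_le:
  fixes n W h b l
  assumes sym: "\<And>i j. W i j = W j i" and nn: "\<And>i j. W i j \<ge> 0"
    and gap: "poincare n W l" and l: "l > 0"
    and b: "\<And>i. i < n \<Longrightarrow> lap n W h i = b i"
  shows "(\<Sum>i<n. b i * h i) \<ge> 0" "(\<Sum>i<n. b i * h i) \<le> (\<Sum>i<n. (b i)\<^sup>2) / l"
proof -
  \<comment> \<open>Centring makes the Poincare inequality applicable. It changes neither
    \<open>lap\<close> nor, because \<open>b\<close> sums to 0, the pairing with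
    \<open>b\<close>.\<close>
  define c where "c = (\<Sum>i<n. h i) / n"
  define k where "k = (\<lambda>i. h i - c)"
  have sk: "(\<Sum>i<n. k i) = 0"
    by (cases "n = 0") (simp_all add: k_def c_def sum_subtractf)
  have "lap n W k = lap n W h" by (auto simp: lap_def k_def)
  then have bk: "lap n W k i = b i" if "i < n" for i using b that by simp
  have sb: "(\<Sum>i<n. b i) = 0" using sum_lap_zero[of W n h, OF sym] b by simp
  have e1: "(\<Sum>i<n. b i * h i) = (\<Sum>i<n. b i * k i)"
    using sb by (simp add: k_def right_diff_distrib sum_subtractf flip: sum_distrib_right)
  have e2: "(\<Sum>i<n. b i * k i) = energy n W k"
    unfolding energy_eq_lap[of W, OF sym] by (rule sum.cong) (auto simp: bk)
  show nonneg: "(\<Sum>i<n. b i * h i) \<ge> 0"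
    using e1 e2 energy_nonneg[of W n k, OF nn] by simp
  define E where "E = energy n W k"
  define K where "K = (\<Sum>i<n. (k i)\<^sup>2)"
  define Q where "Q = (\<Sum>i<n. (b i)\<^sup>2)"
  have lK: "l * K \<le> E" using gap sk unfolding poincare_def E_def K_def by blast
  have cs: "E\<^sup>2 \<le> Q * K"
    using Cauchy_Schwarz_ineq_sum[of b k "{..<n}"] e2 by (simp add: E_def Q_def K_def)
  have E0: "E \<ge> 0" using e1 e2 nonneg E_def by simp
  have Q0: "Q \<ge> 0" by (simp add: Q_def sum_nonneg)
  have "l * E\<^sup>2 \<le> Q * E"
  proof -
    have "l * E\<^sup>2 \<le> l * (Q * K)" using cs l by (intro mult_left_mono) auto
    also have "\<dots> = Q * (l * K)" by simp
    also have "\<dots> \<le> Q * E" using lK Q0 by (intro mult_left_mono)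
    finally show ?thesis .
  qed
  then have "l * E \<le> Q"
    using E0 Q0 by (cases "E = 0") (auto simp: power2_eq_square)
  then have "E \<le> Q / l" using l by (simp add: field_simps)
  then show "(\<Sum>i<n. b i * h i) \<le> (\<Sum>i<n. (b i)\<^sup>2) / l"
    using e1 e2 by (simp add: E_def Q_def)
qed

text \<open>Here \<open>f = g + h\<close> with \<open>g = (e\<^sub>u - e\<^sub>v) / deg\<close>, which contributes \<open>1 / du + 1 / dv\<close>;
  the correction \<open>h\<close> is a potential for the short vector \<open>b\<close>, so the spectral gap controls its energy.\<close>

lemma potential_difference_bounds:
  fixes n W f u v l wmax
  assumes sym: "\<And>i j. W i j = W j i" and nn: "\<And>i j. W i j \<ge> 0"
    and diag: "\<And>i. W i i = 0"
    and gap: "poincare n W l" and l: "l > 0"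
    and uv: "u < n" "v < n" "u \<noteq> v"
    and f: "\<And>i. i < n \<Longrightarrow> lap n W f i = of_bool (i = u) - of_bool (i = v)"
    and du: "du = (\<Sum>j<n. W u j)" "du > 0" and dv: "dv = (\<Sum>j<n. W v j)" "dv > 0"
    and wmax: "\<And>i j. W i j \<le> wmax"
  shows "f u - f v \<ge> 1 / du + 1 / dv - 2 * wmax / (du * dv)"
    and "f u - f v \<le> (1 / du + 1 / dv) * (1 + 2 * wmax / l)"
proof -
  define x where "x = (\<lambda>i. of_bool (i = u) - of_bool (i = v) :: real)"
  define g where "g = (\<lambda>i. of_bool (i = u) / du - of_bool (i = v) / dv)"
  define h where "h = (\<lambda>i. f i - g i)"
  define b where "b = (\<lambda>i. W i u / du - W i v / dv)"
  have pick: "(\<Sum>i<n. of_bool (i = w) * F i) = F w" "(\<Sum>i<n. F i * of_bool (i = w)) = F w"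
    if "w < n" for w and F :: "nat \<Rightarrow> real"
    using that by (simp_all add: of_bool_def if_distrib[of "\<lambda>z. z * _"] if_distrib[of "\<lambda>z. _ * z"] sum.delta' cong: if_cong)
  have lg: "lap n W g i = x i - b i" if "i < n" for i
  proof -
    have "lap n W g i = (\<Sum>j<n. W i j) * g i - (\<Sum>j<n. W i j * g j)"
      by (simp add: lap_def right_diff_distrib sum_subtractf sum_distrib_right)
    also have "(\<Sum>j<n. W i j) * g i = x i"
      using uv du dv by (auto simp: g_def x_def)
    also have "(\<Sum>j<n. W i j * g j) = b i"
    proof -
      have "(\<Sum>j<n. W i j * g j) = (\<Sum>j<n. (W i j / du) * of_bool (j = u)) - (\<Sum>j<n. (W i j / dv) * of_bool (j = v))"
        by (simp add: g_def right_diff_distrib sum_subtractf)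
      also have "\<dots> = b i" using uv by (simp only: pick b_def)
      finally show ?thesis .
    qed
    finally show ?thesis .
  qed
  have lh: "lap n W h i = b i" if "i < n" for i
  proof -
    have "lap n W h i = lap n W f i - lap n W g i"
      by (simp add: lap_def h_def sum_subtractf[symmetric] algebra_simps)
    then show ?thesis using f lg that by (simp add: x_def)
  qed
  define Q where "Q = (\<Sum>i<n. b i * h i)"
  have dot_x: "(\<Sum>i<n. x i * F i) = F u - F v" for F :: "nat \<Rightarrow> real"
    using uv by (simp add: x_def left_diff_distrib sum_subtractf pick)
  have "f u - f v = (\<Sum>i<n. x i * g i) + (\<Sum>i<n. x i * h i)"
    by (simp add: dot_x h_def)
  also have "(\<Sum>i<n. x i * g i) = 1 / du + 1 / dv"
    using uv by (simp add: dot_x g_def)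
  \<comment> \<open>Substituting \<open>x = lap g + b\<close> and moving \<open>lap\<close> from
    \<open>g\<close> to \<open>h\<close> leaves the explicit pairing of \<open>g\<close> with
    \<open>b\<close>; only \<open>Q\<close>, a nonnegative energy, has to be estimated.\<close>
  also have "(\<Sum>i<n. x i * h i) = (\<Sum>i<n. h i * lap n W g i) + Q"
    by (simp add: lg Q_def sum.distrib[symmetric] algebra_simps)
  also have "(\<Sum>i<n. h i * lap n W g i) = (\<Sum>i<n. g i * lap n W h i)"
    by (rule lap_self_adjoint[OF sym])
  also have "\<dots> = (\<Sum>i<n. g i * b i)" by (simp add: lh)
  also have "\<dots> = - 2 * W u v / (du * dv)"
  proof -
    have "(\<Sum>i<n. g i * b i) = (\<Sum>i<n. of_bool (i = u) * (b i / du)) - (\<Sum>i<n. of_bool (i = v) * (b i / dv))"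
      by (simp add: g_def left_diff_distrib sum_subtractf)
    also have "\<dots> = b u / du - b v / dv" using uv by (simp only: pick)
    finally show ?thesis by (simp add: b_def diag sym[of v u] field_simps)
  qed
  finally have R: "f u - f v = 1 / du + 1 / dv - 2 * W u v / (du * dv) + Q" by simp
  have Q: "0 \<le> Q" "Q \<le> (\<Sum>i<n. (b i)\<^sup>2) / l"
    unfolding Q_def using dual_energy_le[OF sym nn gap l lh] by auto
  have "2 * W u v / (du * dv) \<le> 2 * wmax / (du * dv)"
    using wmax[of u v] du dv by (intro divide_right_mono) auto
  then show "f u - f v \<ge> 1 / du + 1 / dv - 2 * wmax / (du * dv)"
    using R Q by linarith
  \<comment> \<open>One factor of each square is replaced by the maximal weight. The squared norm of
    \<open>b\<close> is then at most \<open>2 * wmax * (1 / du + 1 / dv)\<close>, proportional to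
    the leading term, so the upper error is a relative one.\<close>
  have sq: "(\<Sum>i<n. (W i w)\<^sup>2) \<le> wmax * (\<Sum>j<n. W w j)" for w
    unfolding sum_distrib_left
  proof (rule sum_mono)
    fix i
    show "(W i w)\<^sup>2 \<le> wmax * W w i"
      using wmax[of i w] nn[of i w] sym[of i w] by (simp add: power2_eq_square mult_right_mono)
  qed
  have "(\<Sum>i<n. (b i)\<^sup>2) \<le> (\<Sum>i<n. 2 * (W i u)\<^sup>2 / du\<^sup>2 + 2 * (W i v)\<^sup>2 / dv\<^sup>2)"
  proof (rule sum_mono)
    fix i
    have "(a - c)\<^sup>2 \<le> 2 * a\<^sup>2 + 2 * c\<^sup>2" for a c :: real
      using zero_le_power2[of "a + c"] by (simp add: power2_sum power2_diff)
    from this[of "W i u / du" "W i v / dv"]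
    show "(b i)\<^sup>2 \<le> 2 * (W i u)\<^sup>2 / du\<^sup>2 + 2 * (W i v)\<^sup>2 / dv\<^sup>2"
      by (simp add: b_def power_divide)
  qed
  also have "\<dots> = 2 / du\<^sup>2 * (\<Sum>i<n. (W i u)\<^sup>2) + 2 / dv\<^sup>2 * (\<Sum>i<n. (W i v)\<^sup>2)"
    by (simp add: sum.distrib sum_distrib_left)
  also have "\<dots> \<le> 2 / du\<^sup>2 * (wmax * du) + 2 / dv\<^sup>2 * (wmax * dv)"
    using sq[of u] sq[of v] du dv by (intro add_mono mult_left_mono) auto
  also have "\<dots> = 2 * wmax * (1 / du + 1 / dv)"
    using du dv by (simp add: field_simps power2_eq_square)
  finally have "Q \<le> 2 * wmax * (1 / du + 1 / dv) / l"
    using Q l by (meson divide_right_mono less_imp_le order_trans)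
  moreover have "W u v / (du * dv) \<ge> 0" using nn du dv by simp
  ultimately have "f u - f v \<le> 1 / du + 1 / dv + 2 * wmax * (1 / du + 1 / dv) / l"
    using R by (simp add: field_simps)
  also have "\<dots> = (1 / du + 1 / dv) * (1 + 2 * wmax / l)"
    by (simp add: algebra_simps)
  finally show "f u - f v \<le> (1 / du + 1 / dv) * (1 + 2 * wmax / l)" .
qed

section \<open>Cheeger's inequality for weighted graphs\<close>

text \<open>A discrete co-area inequality, by peeling off levels. Lowering \<open>g\<close> by its
  smallest positive value \<open>m\<close> on its support \<open>S\<close> decreases the left side
  by \<open>2 * \<phi> * m * card S\<close> and the right side by exactly \<open>2 * m\<close> times
  the cut of \<open>S\<close> (ordered pairs count an edge twice), and it shrinks the
  support.\<close>

lemma cut_layer_cake: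
  fixes g :: "nat \<Rightarrow> real" and W :: "nat \<Rightarrow> nat \<Rightarrow> real" and \<phi> :: real
  assumes sym: "\<And>i j. W i j = W j i" and nn: "\<And>i j. W i j \<ge> 0"
    and cut: "\<And>S. S \<subseteq> {..<n} \<Longrightarrow> 2 * card S \<le> n \<Longrightarrow> \<phi> * card S \<le> (\<Sum>i\<in>S. \<Sum>j\<in>{..<n}-S. W i j)"
    and g: "\<And>i. g i \<ge> 0" and supp: "2 * card {i\<in>{..<n}. g i > 0} \<le> n"
  shows "2 * \<phi> * (\<Sum>i<n. g i) \<le> (\<Sum>i<n. \<Sum>j<n. W i j * \<bar>g i - g j\<bar>)"
  using g supp
proof (induction "card {i\<in>{..<n}. g i > 0}" arbitrary: g rule: less_induct)
  case less
  define S where "S = {i\<in>{..<n}. g i > 0}"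
  have fS: "finite S" and Sn: "S \<subseteq> {..<n}" by (auto simp: S_def)
  show ?case
  proof (cases "S = {}")
    case True
    then have "g i = 0" if "i < n" for i using that less.prems(1)[of i] by (force simp: S_def)
    then show ?thesis by simp
  next
    case False
    define m where "m = Min (g ` S)"
    have mle: "m \<le> g i" if "i \<in> S" for i using that fS by (simp add: m_def)
    have "m \<in> g ` S" using False fS by (simp add: m_def)
    then obtain i0 where i0: "i0 \<in> S" "g i0 = m" by auto
    have m: "m > 0" using i0 by (auto simp: S_def)
    define g' where "g' = (\<lambda>i. if i \<in> S then g i - m else g i)"
    have out: "g i = 0" if "i < n" "i \<notin> S" for i
      using that less.prems(1)[of i] by (force simp: S_def)
    have g'0: "g' i \<ge> 0" for i using mle less.prems(1) by (auto simp: g'_def)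
    have sub: "{i\<in>{..<n}. g' i > 0} \<subset> S"
      using i0 Sn m by (auto simp: g'_def S_def)
    then have lt: "card {i\<in>{..<n}. g' i > 0} < card S" using fS by (rule psubset_card_mono[rotated])
    have ih: "2 * \<phi> * (\<Sum>i<n. g' i) \<le> (\<Sum>i<n. \<Sum>j<n. W i j * \<bar>g' i - g' j\<bar>)"
      using lt less.prems(2) g'0 by (intro less.hyps) (auto simp: S_def)
    define C where "C = (\<Sum>i\<in>S. \<Sum>j\<in>{..<n}-S. W i j)"
    have C: "\<phi> * card S \<le> C" unfolding C_def using Sn less.prems(2) by (intro cut) (auto simp: S_def)
    have sg: "(\<Sum>i<n. g i) = (\<Sum>i<n. g' i) + m * card S"
    proof -
      have "(\<Sum>i<n. g i) = (\<Sum>i<n. g' i + (if i \<in> S then m else 0))"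
        by (intro sum.cong) (auto simp: g'_def)
      also have "\<dots> = (\<Sum>i<n. g' i) + (\<Sum>i\<in>{..<n} \<inter> S. m)"
        by (subst sum.inter_restrict) (simp_all add: sum.distrib)
      finally show ?thesis using Sn by (simp add: Int_absorb1 mult.commute)
    qed
    have abs_eq: "\<bar>g i - g j\<bar> = \<bar>g' i - g' j\<bar> + m * of_bool (i \<in> S \<and> j \<notin> S) + m * of_bool (j \<in> S \<and> i \<notin> S)"
      if "i < n" "j < n" for i j
      using that mle[of i] mle[of j] out[of i] out[of j] m by (auto simp: g'_def)
    have c1: "(\<Sum>i<n. \<Sum>j<n. W i j * of_bool (i \<in> S \<and> j \<notin> S)) = C"
    proof -
      have "(\<Sum>j<n. W i j * of_bool (i \<in> S \<and> j \<notin> S)) =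
          (if i \<in> S then \<Sum>j\<in>{..<n}-S. W i j else 0)" for i
        by (auto intro!: sum.mono_neutral_cong_right)
      then have "(\<Sum>i<n. \<Sum>j<n. W i j * of_bool (i \<in> S \<and> j \<notin> S)) =
          (\<Sum>i<n. if i \<in> S then \<Sum>j\<in>{..<n}-S. W i j else 0)"
        by simp
      also have "\<dots> = C" unfolding C_def
        using Sn by (intro sum.mono_neutral_cong_right) auto
      finally show ?thesis .
    qed
    have c2: "(\<Sum>i<n. \<Sum>j<n. W i j * of_bool (j \<in> S \<and> i \<notin> S)) = C"
      by (subst sum.swap, subst sym, rule c1)
    have "(\<Sum>i<n. \<Sum>j<n. W i j * \<bar>g i - g j\<bar>) = (\<Sum>i<n. \<Sum>j<n. W i j * \<bar>g' i - g' j\<bar> +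
        (m * (W i j * of_bool (i \<in> S \<and> j \<notin> S)) + m * (W i j * of_bool (j \<in> S \<and> i \<notin> S))))"
      by (intro sum.cong refl) (simp add: abs_eq algebra_simps del: of_bool_conj)
    also have "\<dots> = (\<Sum>i<n. \<Sum>j<n. W i j * \<bar>g' i - g' j\<bar>) + (m * C + m * C)"
      unfolding sum.distrib sum_distrib_left[symmetric] c1 c2 ..
    finally have "(\<Sum>i<n. \<Sum>j<n. W i j * \<bar>g i - g j\<bar>) =
        (\<Sum>i<n. \<Sum>j<n. W i j * \<bar>g' i - g' j\<bar>) + 2 * m * C" by simp
    moreover have "m * (\<phi> * card S) \<le> m * C" using C m by (intro mult_left_mono) auto
    ultimately show ?thesis using ih sg by (simp add: algebra_simps)
  qed
qed

text \<open>The co-area inequality is applied to the squares, which have the same support. Factoring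
  \<open>(g i)\<^sup>2 - (g j)\<^sup>2\<close> and Cauchy-Schwarz separate the energy from a sum
  over \<open>(g i + g j)\<^sup>2\<close>, which the degrees bound by \<open>4 * dmax\<close> times
  the sum of squares.\<close>

lemma cheeger_nonneg:
  fixes g :: "nat \<Rightarrow> real" and W :: "nat \<Rightarrow> nat \<Rightarrow> real" and \<phi> :: real
  assumes sym: "\<And>i j. W i j = W j i" and nn: "\<And>i j. W i j \<ge> 0"
    and cut: "\<And>S. S \<subseteq> {..<n} \<Longrightarrow> 2 * card S \<le> n \<Longrightarrow> \<phi> * card S \<le> (\<Sum>i\<in>S. \<Sum>j\<in>{..<n}-S. W i j)"
    and phi: "\<phi> \<ge> 0" and dmax: "\<And>i. i < n \<Longrightarrow> (\<Sum>j<n. W i j) \<le> dmax" "dmax > 0"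
    and g: "\<And>i. g i \<ge> 0" and supp: "2 * card {i\<in>{..<n}. g i > 0} \<le> n"
  shows "\<phi>\<^sup>2 / (2 * dmax) * (\<Sum>i<n. (g i)\<^sup>2) \<le> energy n W g"
proof -
  define s where "s = (\<Sum>i<n. (g i)\<^sup>2)"
  define A where "A = (\<Sum>i<n. \<Sum>j<n. W i j * \<bar>(g i)\<^sup>2 - (g j)\<^sup>2\<bar>)"
  define P where "P = (\<Sum>i<n. \<Sum>j<n. W i j * (g i + g j)\<^sup>2)"
  define E where "E = energy n W g"
  have s0: "s \<ge> 0" by (simp add: s_def sum_nonneg)
  have E0: "E \<ge> 0" unfolding E_def by (rule energy_nonneg[OF nn])
  have gpos: "(0 < (g i)\<^sup>2) = (g i > 0)" for i using g[of i] by (auto simp: less_le)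
  have A: "2 * \<phi> * s \<le> A" unfolding s_def A_def
    by (rule cut_layer_cake[OF sym nn cut]) (use supp in \<open>simp_all only: gpos zero_le_power2\<close>)
  have P: "P \<le> 4 * dmax * s"
  proof -
    have "P \<le> (\<Sum>i<n. \<Sum>j<n. 2 * (W i j * (g i)\<^sup>2) + 2 * (W i j * (g j)\<^sup>2))"
      unfolding P_def
    proof (intro sum_mono)
      fix i j
      have "(g i + g j)\<^sup>2 \<le> 2 * (g i)\<^sup>2 + 2 * (g j)\<^sup>2"
        using zero_le_power2[of "g i - g j"] by (simp add: power2_sum power2_diff)
      from mult_left_mono[OF this nn[of i j]]
      show "W i j * (g i + g j)\<^sup>2 \<le> 2 * (W i j * (g i)\<^sup>2) + 2 * (W i j * (g j)\<^sup>2)"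
        by (simp add: algebra_simps)
    qed
    also have "\<dots> = 2 * (\<Sum>i<n. \<Sum>j<n. W i j * (g i)\<^sup>2) + 2 * (\<Sum>i<n. \<Sum>j<n. W i j * (g j)\<^sup>2)"
      by (simp add: sum.distrib sum_distrib_left)
    also have "(\<Sum>i<n. \<Sum>j<n. W i j * (g j)\<^sup>2) = (\<Sum>i<n. \<Sum>j<n. W i j * (g i)\<^sup>2)"
      by (subst sum.swap, subst sym, rule refl)
    also have "(\<Sum>i<n. \<Sum>j<n. W i j * (g i)\<^sup>2) \<le> (\<Sum>i<n. dmax * (g i)\<^sup>2)"
      unfolding sum_distrib_right[symmetric]
      by (intro sum_mono mult_right_mono dmax) auto
    finally show ?thesis by (simp add: s_def sum_distrib_left algebra_simps)
  qed
  have cs: "A\<^sup>2 \<le> (2 * E) * P"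
  proof -
    have A': "A = (\<Sum>(i,j)\<in>{..<n}\<times>{..<n}. (sqrt (W i j) * \<bar>g i - g j\<bar>) * (sqrt (W i j) * (g i + g j)))"
      unfolding A_def sum.cartesian_product[symmetric]
    proof (intro sum.cong refl)
      fix i j
      have "\<bar>(g i)\<^sup>2 - (g j)\<^sup>2\<bar> = \<bar>g i - g j\<bar> * (g i + g j)"
        using g[of i] g[of j] by (simp add: power2_eq_square square_diff_square_factored abs_mult)
      moreover have "W i j = sqrt (W i j) * sqrt (W i j)" using nn by simp
      ultimately show "W i j * \<bar>(g i)\<^sup>2 - (g j)\<^sup>2\<bar> = (sqrt (W i j) * \<bar>g i - g j\<bar>) * (sqrt (W i j) * (g i + g j))"
        by (metis mult.assoc mult.left_commute)
    qed
    have P': "P = (\<Sum>(i,j)\<in>{..<n}\<times>{..<n}. (sqrt (W i j) * (g i + g j))\<^sup>2)"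
      unfolding P_def sum.cartesian_product[symmetric] using nn by (simp add: power_mult_distrib)
    have E': "2 * E = (\<Sum>(i,j)\<in>{..<n}\<times>{..<n}. (sqrt (W i j) * \<bar>g i - g j\<bar>)\<^sup>2)"
      unfolding E_def energy_def sum.cartesian_product[symmetric] using nn by (simp add: power_mult_distrib)
    show ?thesis unfolding A' P' E' case_prod_beta by (rule Cauchy_Schwarz_ineq_sum)
  qed
  have "4 * \<phi>\<^sup>2 * s\<^sup>2 = (2 * \<phi> * s)\<^sup>2" by (simp add: power_mult_distrib)
  also have "\<dots> \<le> A\<^sup>2" using A phi s0 by (intro power_mono) auto
  also have "\<dots> \<le> (2 * E) * P" by (rule cs)
  also have "\<dots> \<le> (2 * E) * (4 * dmax * s)" using P E0 by (intro mult_left_mono) auto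
  finally have "\<phi>\<^sup>2 * s\<^sup>2 \<le> 2 * dmax * E * s" by (simp add: mult_ac)
  then have "\<phi>\<^sup>2 * s \<le> 2 * dmax * E"
    using s0 E0 dmax by (cases "s = 0") (auto simp: power2_eq_square mult.assoc[symmetric])
  then show ?thesis using dmax by (simp add: s_def[symmetric] E_def[symmetric] field_simps)
qed

text \<open>A median splits a function into two parts of support at most n / 2, the size up to which
  the cut hypothesis of Cheeger's inequality speaks. The least value with at most half of the points
  above it qualifies.\<close>

lemma finite_median:
  fixes f :: "nat \<Rightarrow> real"
  obtains c where "2 * card {i\<in>{..<n}. f i > c} \<le> n" "2 * card {i\<in>{..<n}. f i < c} \<le> n"
proof (cases "n = 0")
  case True
  then show ?thesis using that[of 0] by simp
next
  case False
  define V where "V = f ` {..<n}"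
  have fV: "finite V" "V \<noteq> {}" using False by (auto simp: V_def)
  define A where "A = {c\<in>V. 2 * card {i\<in>{..<n}. f i > c} \<le> n}"
  have "{i\<in>{..<n}. f i > Max V} = {}"
    using fV by (auto simp: V_def not_less)
  then have "2 * card {i\<in>{..<n}. f i > Max V} \<le> n" by (simp only: card.empty)
  then have "Max V \<in> A" using Max_in[OF fV] by (simp only: A_def mem_Collect_eq simp_thms)
  then have "A \<noteq> {}" by blast
  moreover have "finite A" using fV by (simp add: A_def)
  ultimately have A: "finite A" "A \<noteq> {}" by auto
  define c where "c = Min A"
  have cA: "c \<in> A" using A by (simp add: c_def)
  have "2 * card {i\<in>{..<n}. f i < c} \<le> n"
  proof (rule ccontr)
    assume neg: "\<not> ?thesis"
    define B where "B = {x\<in>V. x < c}"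
    have "{i\<in>{..<n}. f i < c} \<noteq> {}" using neg by (auto simp del: Collect_empty_eq)
    then have B: "finite B" "B \<noteq> {}" using fV by (auto simp: B_def V_def)
    \<comment> \<open>The next smaller value. The points above \<open>c'\<close> are those not below
      \<open>c\<close>, fewer than half of all points, so \<open>c'\<close> would lie in
      \<open>A\<close> as well.\<close>
    define c' where "c' = Max B"
    have c'B: "c' \<in> B" using B by (simp add: c'_def)
    have le: "x \<le> c'" if "x \<in> V" "x < c" for x using that B by (simp add: c'_def B_def)
    have eq: "{i\<in>{..<n}. f i > c'} = {..<n} - {i\<in>{..<n}. f i < c}"
      using le c'B by (force simp: B_def V_def)
    have "card {i\<in>{..<n}. f i > c'} = n - card {i\<in>{..<n}. f i < c}"
      unfolding eq by (subst card_Diff_subset) auto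
    then have "c' \<in> A" using neg c'B by (auto simp: A_def B_def)
    then have "c \<le> c'" using A by (simp add: c_def)
    then show False using c'B by (simp add: B_def)
  qed
  with cA that[of c] show ?thesis by (simp add: A_def)
qed

text \<open>Shifting by a median \<open>c\<close> and splitting into positive and negative part
  reduces this to \<open>cheeger_nonneg\<close>. The shift can only increase the sum of squares
  because \<open>f\<close> has mean 0, and the energies of the parts add up to at most that of
  \<open>f\<close> because \<open>(p i - p j) * (m i - m j) \<le> 0\<close>.\<close>

lemma cheeger:
  fixes W :: "nat \<Rightarrow> nat \<Rightarrow> real" and \<phi> :: real
  assumes sym: "\<And>i j. W i j = W j i" and nn: "\<And>i j. W i j \<ge> 0"
    and cut: "\<And>S. S \<subseteq> {..<n} \<Longrightarrow> 2 * card S \<le> n \<Longrightarrow> \<phi> * card S \<le> (\<Sum>i\<in>S. \<Sum>j\<in>{..<n}-S. W i j)"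
    and phi: "\<phi> \<ge> 0" and dmax: "\<And>i. i < n \<Longrightarrow> (\<Sum>j<n. W i j) \<le> dmax" "dmax > 0"
  shows "poincare n W (\<phi>\<^sup>2 / (2 * dmax))"
  unfolding poincare_def
proof (intro allI impI)
  fix f :: "nat \<Rightarrow> real"
  assume f0: "(\<Sum>i<n. f i) = 0"
  obtain c where c: "2 * card {i\<in>{..<n}. f i > c} \<le> n" "2 * card {i\<in>{..<n}. f i < c} \<le> n"
    by (rule finite_median)
  define p where "p = (\<lambda>i. max 0 (f i - c))"
  define m where "m = (\<lambda>i. max 0 (c - f i))"
  define l where "l = \<phi>\<^sup>2 / (2 * dmax)"
  have l0: "l \<ge> 0" using dmax by (simp add: l_def)
  have "{i\<in>{..<n}. p i > 0} = {i\<in>{..<n}. f i > c}" "{i\<in>{..<n}. m i > 0} = {i\<in>{..<n}. f i < c}"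
    by (auto simp: p_def m_def)
  then have pm: "l * (\<Sum>i<n. (p i)\<^sup>2) \<le> energy n W p" "l * (\<Sum>i<n. (m i)\<^sup>2) \<le> energy n W m"
    unfolding l_def using c
    by (intro cheeger_nonneg[OF sym nn cut phi dmax]; simp add: p_def m_def)+
  have "(\<Sum>i<n. (f i - c)\<^sup>2) = (\<Sum>i<n. (f i)\<^sup>2) - 2 * c * (\<Sum>i<n. f i) + n * c\<^sup>2"
    by (simp add: power2_diff sum.distrib sum_subtractf sum_distrib_left algebra_simps)
  then have "(\<Sum>i<n. (f i)\<^sup>2) \<le> (\<Sum>i<n. (f i - c)\<^sup>2)" using f0 by simp
  also have "\<dots> = (\<Sum>i<n. (p i)\<^sup>2 + (m i)\<^sup>2)"
    by (intro sum.cong) (auto simp: p_def m_def max_def power2_commute)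
  finally have "l * (\<Sum>i<n. (f i)\<^sup>2) \<le> l * (\<Sum>i<n. (p i)\<^sup>2) + l * (\<Sum>i<n. (m i)\<^sup>2)"
    using l0 by (metis distrib_left mult_left_mono sum.distrib)
  also have "\<dots> \<le> energy n W p + energy n W m" using pm by simp
  also have "\<dots> = (\<Sum>i<n. \<Sum>j<n. W i j * ((p i - p j)\<^sup>2 + (m i - m j)\<^sup>2)) / 2"
    by (simp add: energy_def sum.distrib algebra_simps add_divide_distrib)
  also have "\<dots> \<le> energy n W f"
    unfolding energy_def
  proof (intro divide_right_mono sum_mono mult_left_mono nn)
    fix i j
    have d: "f i - f j = (p i - p j) - (m i - m j)" by (auto simp: p_def m_def max_def)
    have "(p i - p j) * (m i - m j) \<le> 0"
      by (auto simp: p_def m_def max_def mult_le_0_iff)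
    then show "(p i - p j)\<^sup>2 + (m i - m j)\<^sup>2 \<le> (f i - f j)\<^sup>2"
      unfolding d power2_diff[of "p i - p j" "m i - m j"] mult.assoc by linarith
  qed auto
  finally show "\<phi>\<^sup>2 / (2 * dmax) * (\<Sum>i<n. (f i)\<^sup>2) \<le> energy n W f" by (simp add: l_def)
qed

section \<open>Weighted graphs as symmetric weight functions\<close>

definition edge_weight :: "weighted_graph \<Rightarrow> nat \<Rightarrow> nat \<Rightarrow> real" where
  "edge_weight G u v = (if {u, v} \<in> edges G then weight G {u, v} else 0)"

lemma edge_weight_sym: "edge_weight G u v = edge_weight G v u"
  by (simp add: edge_weight_def insert_commute)

lemma edge_weight_nonneg: "wf_weighted_graph G \<Longrightarrow> edge_weight G u v \<ge> 0"
  by (auto simp: edge_weight_def wf_weighted_graph_def)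

lemma edge_weight_diag: "wf_weighted_graph G \<Longrightarrow> edge_weight G u u = 0"
  by (auto simp: edge_weight_def wf_weighted_graph_def)

lemma finite_edges: "wf_weighted_graph G \<Longrightarrow> finite (edges G)"
  by (rule finite_subset[of _ "Pow {0..<num_verts G}"]) (auto simp: wf_weighted_graph_def)

lemma edge_cases:
  assumes "wf_weighted_graph G" "e \<in> edges G"
  obtains u v where "e = {u, v}" "u < v" "v < num_verts G"
proof -
  have "card e = 2" "e \<subseteq> {0..<num_verts G}" using assms by (auto simp: wf_weighted_graph_def)
  then obtain a b where ab: "e = {a, b}" "a \<noteq> b" by (auto simp: card_2_iff)
  then have "a < num_verts G" "b < num_verts G" using \<open>e \<subseteq> _\<close> by auto
  then show ?thesis using that[of a b] that[of b a] ab by (cases "a < b") (auto simp: insert_commute)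
qed

lemma weighted_degree_eq:
  assumes wf: "wf_weighted_graph G"
  shows "weighted_degree G u = (\<Sum>v<num_verts G. edge_weight G u v)"
proof -
  let ?N = "{v\<in>{..<num_verts G}. {u, v} \<in> edges G}"
  have "(\<Sum>v<num_verts G. edge_weight G u v) = (\<Sum>v\<in>?N. weight G {u, v})"
    unfolding edge_weight_def by (rule sum.inter_filter[symmetric]) simp
  also have "\<dots> = (\<Sum>e\<in>(\<lambda>v. {u, v}) ` ?N. weight G e)"
    by (rule sum.reindex_cong[symmetric, of "\<lambda>v. {u, v}"]) (auto simp: inj_on_def doubleton_eq_iff)
  also have "(\<lambda>v. {u, v}) ` ?N = {e\<in>edges G. u \<in> e}"
  proof (intro equalityI subsetI)
    fix e assume "e \<in> {e\<in>edges G. u \<in> e}"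
    then have e: "e \<in> edges G" "u \<in> e" by auto
    obtain a b where ab: "e = {a, b}" "a < b" "b < num_verts G" using edge_cases[OF wf e(1)] .
    then have "u = a \<or> u = b" using e by auto
    then show "e \<in> (\<lambda>v. {u, v}) ` ?N"
    proof
      assume "u = a" then show ?thesis using ab e by auto
    next
      assume "u = b" then show ?thesis using ab e by (intro image_eqI[of _ _ a]) (auto simp: insert_commute)
    qed
  qed auto
  finally show ?thesis by (simp add: weighted_degree_def)
qed

lemma cut_weight_eq:
  assumes wf: "wf_weighted_graph G" and S: "S \<subseteq> {..<num_verts G}"
  shows "cut_weight G S = (\<Sum>u\<in>S. \<Sum>v\<in>{..<num_verts G}-S. edge_weight G u v)"
proof -
  let ?R = "{..<num_verts G} - S"
  have fin: "finite S" using S finite_subset by blast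
  let ?P = "{x\<in>S \<times> ?R. {fst x, snd x} \<in> edges G}"
  have "(\<Sum>u\<in>S. \<Sum>v\<in>?R. edge_weight G u v) = (\<Sum>x\<in>S \<times> ?R. edge_weight G (fst x) (snd x))"
    by (simp add: sum.cartesian_product case_prod_beta)
  also have "\<dots> = (\<Sum>x\<in>?P. weight G {fst x, snd x})"
    unfolding edge_weight_def by (rule sum.inter_filter[symmetric]) (use fin in simp)
  also have "\<dots> = (\<Sum>e\<in>(\<lambda>x. {fst x, snd x}) ` ?P. weight G e)"
    by (rule sum.reindex_cong[symmetric, of "\<lambda>x. {fst x, snd x}"]) (auto simp: inj_on_def doubleton_eq_iff)
  also have "(\<lambda>x. {fst x, snd x}) ` ?P = {e\<in>edges G. card (e \<inter> S) = 1}"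
  proof (intro equalityI subsetI)
    fix e assume "e \<in> (\<lambda>x. {fst x, snd x}) ` ?P"
    then obtain u v where "e = {u, v}" "u \<in> S" "v \<notin> S" "{u, v} \<in> edges G" by auto
    moreover from this have "e \<inter> S = {u}" by auto
    ultimately show "e \<in> {e\<in>edges G. card (e \<inter> S) = 1}" by simp
  next
    fix e assume "e \<in> {e\<in>edges G. card (e \<inter> S) = 1}"
    then have e: "e \<in> edges G" "card (e \<inter> S) = 1" by auto
    obtain a b where ab: "e = {a, b}" "a < b" "b < num_verts G" using edge_cases[OF wf e(1)] .
    have one: "(a \<in> S) \<noteq> (b \<in> S)"
      using e(2) ab by (cases "a \<in> S"; cases "b \<in> S") (auto simp: Int_insert_left)
    show "e \<in> (\<lambda>x. {fst x, snd x}) ` ?P"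
    proof (cases "a \<in> S")
      case True
      then have "(a, b) \<in> ?P" using ab e(1) one by auto
      then show ?thesis using ab by (intro image_eqI[of _ _ "(a, b)"]) auto
    next
      case False
      then have "(b, a) \<in> ?P" using ab e(1) one by (auto simp: insert_commute)
      then show ?thesis using ab by (intro image_eqI[of _ _ "(b, a)"]) (auto simp: insert_commute)
    qed
  qed
  finally show ?thesis by (simp add: cut_weight_def)
qed

section \<open>The pseudo-inverse of the Laplacian and effective resistances\<close>

lemma laplacian_carrier: "laplacian G \<in> carrier_mat (num_verts G) (num_verts G)"
  unfolding laplacian_def by (intro minus_carrier_mat) (simp add: adjacency_matrix_def)

lemma laplacian_index:
  assumes "i < num_verts G" "j < num_verts G"
  shows "laplacian G $$ (i, j) = (if i = j then weighted_degree G i else 0) - edge_weight G i j"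
  using assms by (simp add: laplacian_def degree_matrix_def adjacency_matrix_def edge_weight_def)

lemma laplacian_mult_vec:
  assumes wf: "wf_weighted_graph G" and i: "i < num_verts G" and x: "x \<in> carrier_vec (num_verts G)"
  shows "(laplacian G *\<^sub>v x) $ i = lap (num_verts G) (edge_weight G) (\<lambda>j. x $ j) i"
proof -
  let ?n = "num_verts G"
  have "(laplacian G *\<^sub>v x) $ i = (\<Sum>j<?n. laplacian G $$ (i, j) * x $ j)"
    using i x laplacian_carrier[of G] by (simp add: scalar_prod_def atLeast0LessThan)
  also have "\<dots> = (\<Sum>j<?n. (if i = j then weighted_degree G i * x $ i else 0) - edge_weight G i j * x $ j)"
    using i by (intro sum.cong refl) (simp add: laplacian_index left_diff_distrib)
  also have "\<dots> = weighted_degree G i * x $ i - (\<Sum>j<?n. edge_weight G i j * x $ j)"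
    using i by (simp add: sum_subtractf)
  finally show ?thesis
    by (simp add: lap_def weighted_degree_eq[OF wf] right_diff_distrib sum_subtractf sum_distrib_right)
qed

text \<open>The spectral gap makes the constants the whole kernel of \<open>L\<close>. With
  \<open>Pi\<close> the projection onto them, \<open>B = L + Pi\<close> is invertible, and its
  inverse minus \<open>Pi\<close> satisfies the Penrose conditions, since multiplication by
  \<open>B\<close> or by its inverse leaves \<open>Pi\<close> unchanged.\<close>

lemma pseudo_inverse_laplacian:
  assumes wf: "wf_weighted_graph G" and n: "num_verts G = n" "n > 0"
    and gap: "poincare n (edge_weight G) l" and l: "l > 0"
  obtains P where "is_pseudo_inverse (laplacian G) P" "P \<in> carrier_mat n n"
    "laplacian G * P = 1\<^sub>m n - Matrix.mat n n (\<lambda>_. 1 / n)"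
proof -
  let ?W = "edge_weight G"
  define L where "L = laplacian G"
  define Pi where "Pi = Matrix.mat n n (\<lambda>_. 1 / real n)"
  define B where "B = L + Pi"
  have cL: "L \<in> carrier_mat n n" using laplacian_carrier[of G] n by (simp add: L_def)
  have cPi: "Pi \<in> carrier_mat n n" by (simp add: Pi_def)
  have cB: "B \<in> carrier_mat n n" using cL cPi by (simp add: B_def)
  have Pi_mult: "(Pi *\<^sub>v x) $ i = (\<Sum>j<n. x $ j) / n" if "i < n" "x \<in> carrier_vec n" for x i
    using that by (simp add: Pi_def scalar_prod_def atLeast0LessThan sum_divide_distrib)
  have symL: "L $$ (i, j) = L $$ (j, i)" if "i < n" "j < n" for i j
    using that n by (auto simp: L_def laplacian_index edge_weight_sym)
  have rowL: "(\<Sum>j<n. L $$ (i, j)) = 0" if "i < n" for i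
  proof -
    have "(\<Sum>j<n. L $$ (i, j)) = (\<Sum>j<n. (if i = j then weighted_degree G i else 0) - ?W i j)"
      using that n by (intro sum.cong refl) (simp add: L_def laplacian_index)
    also have "\<dots> = 0" using that n by (simp add: sum_subtractf weighted_degree_eq[OF wf])
    finally show ?thesis .
  qed
  have LPi: "L * Pi = 0\<^sub>m n n"
  proof (rule eq_matI)
    fix i j assume "i < dim_row (0\<^sub>m n n :: real mat)" "j < dim_col (0\<^sub>m n n :: real mat)"
    then have ij: "i < n" "j < n" by auto
    have "(L * Pi) $$ (i, j) = (\<Sum>k<n. L $$ (i, k)) / n"
      using ij cL by (simp add: Pi_def scalar_prod_def atLeast0LessThan sum_divide_distrib)
    then show "(L * Pi) $$ (i, j) = 0\<^sub>m n n $$ (i, j)" using ij rowL by simp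
  qed (use cL cPi in auto)
  have tL: "transpose_mat L = L"
    using cL symL by (intro eq_matI) auto
  have tPi: "transpose_mat Pi = Pi"
    by (intro eq_matI) (auto simp: Pi_def)
  have PiL: "Pi * L = 0\<^sub>m n n"
    using transpose_mult[OF cL cPi] LPi tL tPi by simp
  have PiPi: "Pi * Pi = Pi"
    using n by (intro eq_matI) (auto simp: Pi_def scalar_prod_def)
  \<comment> \<open>A kernel vector of \<open>B\<close> has coordinate sum 0, because the
    \<open>lap\<close> terms cancel in the sum of all equations. Its energy then vanishes and the
    gap forces it to be 0.\<close>
  have det: "det B \<noteq> 0"
  proof
    assume "det B = 0"
    then obtain y where y: "y \<in> carrier_vec n" "y \<noteq> 0\<^sub>v n" "B *\<^sub>v y = 0\<^sub>v n"
      using det_0_iff_vec_prod_zero[OF cB] by auto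
    define f where "f = (\<lambda>j. y $ j)"
    define s where "s = (\<Sum>j<n. f j)"
    have z: "lap n ?W f i + s / n = 0" if "i < n" for i
    proof -
      have "(B *\<^sub>v y) $ i = (L *\<^sub>v y) $ i + (Pi *\<^sub>v y) $ i"
        unfolding B_def using add_mult_distrib_mat_vec[OF cL cPi y(1)] that cL cPi by simp
      then show ?thesis
        using y that Pi_mult[OF that y(1)] laplacian_mult_vec[OF wf, of i y] n
        by (simp add: L_def f_def s_def)
    qed
    have "(\<Sum>i<n. lap n ?W f i + s / n) = 0" using z by simp
    then have "s = 0"
      using sum_lap_zero[of ?W n f, OF edge_weight_sym] n by (simp add: sum.distrib)
    then have "energy n ?W f = 0"
      unfolding energy_eq_lap[of ?W, OF edge_weight_sym] using z by simp
    then have "l * (\<Sum>i<n. (f i)\<^sup>2) \<le> 0"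
      using gap \<open>s = 0\<close> unfolding poincare_def s_def by metis
    then have "(\<Sum>i<n. (f i)\<^sup>2) \<le> 0" using l by (simp add: mult_le_0_iff)
    then have "(\<Sum>i<n. (f i)\<^sup>2) = 0" using sum_nonneg[of "{..<n}" "\<lambda>i. (f i)\<^sup>2"] by simp
    then have "f i = 0" if "i < n" for i using that by (simp add: sum_nonneg_eq_0_iff)
    then have "y = 0\<^sub>v n" using y(1) by (intro eq_vecI) (auto simp: f_def)
    then show False using y(2) by simp
  qed
  obtain Q where Q: "Q \<in> carrier_mat n n" "B * Q = 1\<^sub>m n" "Q * B = 1\<^sub>m n"
    using det_non_zero_imp_unit[OF cB det, of "()"]
    by (auto simp: Units_def ring_mat_def)
  note cQ = Q(1)
  have PiB: "Pi * B = Pi" unfolding B_def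
    using mult_add_distrib_mat[OF cPi cL cPi] PiL PiPi cPi by simp
  have BPi: "B * Pi = Pi" unfolding B_def
    using add_mult_distrib_mat[OF cL cPi cPi] LPi PiPi cPi by simp
  have PiQ: "Pi * Q = Pi"
    using assoc_mult_mat[OF cPi cB cQ] PiB Q cPi by simp
  have QPi: "Q * Pi = Pi"
    using assoc_mult_mat[OF cQ cB cPi] BPi Q cPi by simp
  have LQ: "L * Q + Pi = 1\<^sub>m n"
    using add_mult_distrib_mat[OF cL cPi cQ] PiQ Q by (simp add: B_def)
  have QL: "Q * L + Pi = 1\<^sub>m n"
    using mult_add_distrib_mat[OF cQ cL cPi] QPi Q by (simp add: B_def)
  define P where "P = Q - Pi"
  define I where "I = (1\<^sub>m n - Pi :: real mat)"
  have cP: "P \<in> carrier_mat n n" and cI: "I \<in> carrier_mat n n" using cQ cPi by (auto simp: P_def I_def)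
  have sub: "X = 1\<^sub>m n - Y" if "X + Y = 1\<^sub>m n" "X \<in> carrier_mat n n" "Y \<in> carrier_mat n n" for X Y :: "real mat"
  proof -
    have "X = (X + Y) - Y" using that(2,3) by (intro eq_matI) auto
    then show ?thesis using that(1) by simp
  qed
  have LP: "L * P = I"
  proof -
    have "L * P = L * Q - L * Pi" unfolding P_def by (rule mult_minus_distrib_mat[OF cL cQ cPi])
    also have "\<dots> = L * Q" using LPi cL cQ by (intro eq_matI) auto
    also have "\<dots> = I" unfolding I_def using sub[OF LQ] cL cQ cPi by simp
    finally show ?thesis .
  qed
  have PL: "P * L = I"
  proof -
    have "P * L = Q * L - Pi * L" unfolding P_def by (rule minus_mult_distrib_mat[OF cQ cPi cL])
    also have "\<dots> = Q * L" using PiL cL cQ by (intro eq_matI) auto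
    also have "\<dots> = I" unfolding I_def using sub[OF QL] cL cQ cPi by simp
    finally show ?thesis .
  qed
  have PiP: "Pi * P = 0\<^sub>m n n"
    unfolding P_def using mult_minus_distrib_mat[OF cPi cQ cPi] PiQ PiPi cPi
    by (simp add: minus_r_inv_mat)
  have IL: "I * L = L"
    unfolding I_def using minus_mult_distrib_mat[OF one_carrier_mat cPi cL] PiL cL
    by (auto intro!: eq_matI)
  have IP: "I * P = P"
    unfolding I_def using minus_mult_distrib_mat[OF one_carrier_mat cPi cP] PiP cP
    by (auto intro!: eq_matI)
  have tI: "transpose_mat I = I"
    by (intro eq_matI) (auto simp: I_def Pi_def)
  have "is_pseudo_inverse L P"
    unfolding is_pseudo_inverse_def using cL cP LP PL IL IP tI by auto
  then show ?thesis using that cP LP by (simp add: L_def I_def Pi_def)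
qed

text \<open>\<open>f\<close> is the electrical potential of a unit current from \<open>u\<close> to
  \<open>v\<close>. The image of \<open>e\<^sub>u - e\<^sub>v\<close> under the pseudo-inverse is
  such a potential because that vector is orthogonal to the constants, and its pairing with the
  vector is the resistance.\<close>

lemma effective_resistance_potential:
  assumes wf: "wf_weighted_graph G" and n: "num_verts G = n"
    and gap: "poincare n (edge_weight G) l" and l: "l > 0" and uv: "u < n" "v < n"
  shows "\<exists>f. (\<forall>i<n. lap n (edge_weight G) f i = of_bool (i = u) - of_bool (i = v)) \<and>
    effective_resistance G u v = f u - f v"
proof -
  obtain P where P: "is_pseudo_inverse (laplacian G) P" "P \<in> carrier_mat n n"
    "laplacian G * P = 1\<^sub>m n - Matrix.mat n n (\<lambda>_. 1 / n)"
    using pseudo_inverse_laplacian[OF wf n _ gap l] uv by auto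
  have cL: "laplacian G \<in> carrier_mat n n" using laplacian_carrier[of G] n by simp
  have eqP: "pseudo_inverse (laplacian G) = P"
    unfolding pseudo_inverse_def using P(1) is_pseudo_inverse_unique by blast
  define x :: "real Matrix.vec" where "x = unit_vec n u - unit_vec n v"
  have cx: "x \<in> carrier_vec n" by (simp add: x_def)
  have xi: "x $ i = of_bool (i = u) - of_bool (i = v)" if "i < n" for i
    using that uv by (simp add: x_def)
  have sx: "(\<Sum>j<n. x $ j) = 0"
    using uv by (simp add: xi sum_subtractf of_bool_def)
  define y where "y = P *\<^sub>v x"
  have cy: "y \<in> carrier_vec n" using P(2) cx by (simp add: y_def)
  have "laplacian G *\<^sub>v y = (laplacian G * P) *\<^sub>v x"
    unfolding y_def using assoc_mult_mat_vec[OF cL P(2) cx] by simp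
  also have "\<dots> = 1\<^sub>m n *\<^sub>v x - Matrix.mat n n (\<lambda>_. 1 / n) *\<^sub>v x"
    unfolding P(3) by (rule minus_mult_distrib_mat_vec[OF _ _ cx]) auto
  also have "Matrix.mat n n (\<lambda>_. 1 / real n) *\<^sub>v x = 0\<^sub>v n"
    using cx sx by (intro eq_vecI) (auto simp: scalar_prod_def atLeast0LessThan sum_divide_distrib[symmetric])
  finally have Ly: "laplacian G *\<^sub>v y = x" using cx by auto
  show ?thesis
  proof (intro exI[of _ "\<lambda>i. y $ i"] conjI allI impI)
    show "lap n (edge_weight G) (($) y) i = of_bool (i = u) - of_bool (i = v)" if "i < n" for i
      using laplacian_mult_vec[OF wf, of i y] Ly cy that xi n by simp
    have "effective_resistance G u v = x \<bullet> y"
      by (simp add: effective_resistance_def n eqP x_def y_def Let_def)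
    also have "\<dots> = (\<Sum>i<n. (of_bool (i = u) - of_bool (i = v)) * y $ i)"
      using cy by (simp add: scalar_prod_def atLeast0LessThan xi)
    also have "\<dots> = y $ u - y $ v"
      using uv by (simp add: left_diff_distrib sum_subtractf of_bool_def if_distrib[of "\<lambda>z. z * _"] cong: if_cong)
    finally show "effective_resistance G u v = y $ u - y $ v" .
  qed
qed

lemma effective_resistance_self:
  assumes "u < num_verts G"
  shows "effective_resistance G u u = 0"
proof -
  have "unit_vec (num_verts G) u - unit_vec (num_verts G) u = (0\<^sub>v (num_verts G) :: real Matrix.vec)"
    by (intro eq_vecI) auto
  then show ?thesis by (simp add: effective_resistance_def Let_def scalar_prod_def)
qed

text \<open>The Cheeger gap \<open>\<phi>\<^sup>2 / (2 * dmax)\<close> is inserted into the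
  potential bounds, and the two degrees are replaced by the extremal ones.\<close>

lemma effective_resistance_expander:
  fixes \<phi> :: real
  assumes wf: "wf_weighted_graph G" and n: "num_verts G = n" and uv: "u < n" "v < n" "u \<noteq> v"
    and deg: "\<And>i. i < n \<Longrightarrow> dmin \<le> weighted_degree G i" "dmin > 0"
      "\<And>i. i < n \<Longrightarrow> weighted_degree G i \<le> dmax"
    and phi: "\<phi> > 0"
    and cut: "\<And>S. S \<subseteq> {..<n} \<Longrightarrow> 2 * card S \<le> n \<Longrightarrow> \<phi> * card S \<le> cut_weight G S"
    and wmax: "\<And>e. e \<in> edges G \<Longrightarrow> weight G e \<le> wmax" "wmax \<ge> 0"
  shows "effective_resistance G u v \<ge> 2 / dmax - 2 * wmax / dmin\<^sup>2"
    and "effective_resistance G u v \<le> 2 / dmin * (1 + 4 * dmax * wmax / \<phi>\<^sup>2)"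
proof -
  let ?W = "edge_weight G"
  let ?l = "\<phi>\<^sup>2 / (2 * dmax)"
  have dmm: "dmin \<le> dmax" using deg(1)[OF uv(1)] deg(3)[OF uv(1)] by simp
  have l: "?l > 0" using phi dmm deg(2) by simp
  have sums: "weighted_degree G i = (\<Sum>j<n. ?W i j)" for i
    using weighted_degree_eq[OF wf] n by simp
  have gap: "poincare n ?W ?l"
  proof (rule cheeger)
    show "?W i j = ?W j i" for i j by (rule edge_weight_sym)
    show "0 \<le> ?W i j" for i j by (rule edge_weight_nonneg[OF wf])
    show "\<phi> * card S \<le> (\<Sum>i\<in>S. sum (?W i) ({..<n} - S))" if "S \<subseteq> {..<n}" "2 * card S \<le> n" for S
      using cut[OF that] cut_weight_eq[OF wf] that n by simp
  qed (use phi deg dmm in \<open>auto simp: sums\<close>)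
  obtain f where f: "\<And>i. i < n \<Longrightarrow> lap n ?W f i = of_bool (i = u) - of_bool (i = v)"
    "effective_resistance G u v = f u - f v"
    using effective_resistance_potential[OF wf n gap l uv(1,2)] by blast
  define du where "du = weighted_degree G u"
  define dv where "dv = weighted_degree G v"
  have d: "dmin \<le> du" "du \<le> dmax" "dmin \<le> dv" "dv \<le> dmax" "du > 0" "dv > 0"
    using deg uv by (force simp: du_def dv_def)+
  have Wmax: "?W i j \<le> wmax" for i j using wmax by (simp add: edge_weight_def)
  note b = potential_difference_bounds[of ?W n ?l u v f du dv wmax, OF edge_weight_sym
      edge_weight_nonneg[OF wf] edge_weight_diag[OF wf] gap l uv f(1) _ d(5) _ d(6) Wmax]
  have b1: "f u - f v \<ge> 1 / du + 1 / dv - 2 * wmax / (du * dv)"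
    and b2: "f u - f v \<le> (1 / du + 1 / dv) * (1 + 2 * wmax / ?l)"
    using b by (simp_all add: du_def dv_def sums)
  have "1 / dmax \<le> 1 / du" "1 / dmax \<le> 1 / dv" using d by (auto simp: frac_le)
  moreover have "2 * wmax / (du * dv) \<le> 2 * wmax / dmin\<^sup>2"
    using d deg(2) wmax(2) by (intro divide_left_mono) (auto simp: power2_eq_square intro: mult_mono)
  ultimately show "effective_resistance G u v \<ge> 2 / dmax - 2 * wmax / dmin\<^sup>2"
    using b1 f(2) by linarith
  have "1 / du + 1 / dv \<le> 2 / dmin"
    using frac_le[of 1 1 dmin du] frac_le[of 1 1 dmin dv] d deg(2) by simp
  moreover have "1 + 2 * wmax / ?l = 1 + 4 * dmax * wmax / \<phi>\<^sup>2" by simp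
  moreover have "1 + 4 * dmax * wmax / \<phi>\<^sup>2 \<ge> 0" using d deg(2) wmax(2) by simp
  ultimately have "(1 / du + 1 / dv) * (1 + 2 * wmax / ?l) \<le> 2 / dmin * (1 + 4 * dmax * wmax / \<phi>\<^sup>2)"
    by (metis mult_right_mono)
  then show "effective_resistance G u v \<le> 2 / dmin * (1 + 4 * dmax * wmax / \<phi>\<^sup>2)"
    using b2 f(2) by simp
qed

section \<open>Random samples with all cuts and signed degrees controlled\<close>

definition bitlists :: "nat \<Rightarrow> bool list set" where
  "bitlists T = {r. length r = T}"

lemma bitlists_eq: "bitlists T = {r. set r \<subseteq> UNIV \<and> length r = T}"
  by (auto simp: bitlists_def)

lemma finite_bitlists [simp]: "finite (bitlists T)"
  unfolding bitlists_eq by (rule finite_lists_length_eq) simp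

lemma card_bitlists [simp]: "card (bitlists T) = 2 ^ T"
  unfolding bitlists_eq by (subst card_lists_length_eq) auto

lemma sum_bitlists_append:
  fixes f g :: "bool list \<Rightarrow> real"
  shows "(\<Sum>r\<in>bitlists (a + b). f (take a r) * g (drop a r)) =
    (\<Sum>r\<in>bitlists a. f r) * (\<Sum>r\<in>bitlists b. g r)"
proof -
  have "(\<Sum>r\<in>bitlists a. f r) * (\<Sum>r\<in>bitlists b. g r) =
      (\<Sum>(x, y)\<in>bitlists a \<times> bitlists b. f x * g y)"
    by (simp add: sum_product sum.cartesian_product)
  also have "\<dots> = (\<Sum>r\<in>bitlists (a + b). f (take a r) * g (drop a r))"
    by (rule sum.reindex_bij_witness[of _ "\<lambda>r. (take a r, drop a r)" "\<lambda>(x, y). x @ y"])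
      (auto simp: bitlists_def)
  finally show ?thesis ..
qed

text \<open>Fair coins simulate probability \<open>1 / 2 ^ k\<close>: item \<open>j\<close> owns the
  \<open>k\<close> bits from \<open>j * k\<close> on and is selected if all of them are heads.
  Disjoint blocks make the selections independent.\<close>

definition block_true :: "nat \<Rightarrow> bool list \<Rightarrow> nat \<Rightarrow> bool" where
  "block_true k r j \<longleftrightarrow> (\<forall>l<k. r ! (j * k + l))"

lemma sum_first_block:
  fixes h :: "bool \<Rightarrow> real"
  shows "(\<Sum>r\<in>bitlists (k + b). h (\<forall>l<k. r ! l)) = 2 ^ b * (h True + (2 ^ k - 1) * h False)"
proof -
  have all: "(\<forall>l<k. r ! l) \<longleftrightarrow> r = replicate k True" if "r \<in> bitlists k" for r
    using that by (auto simp: bitlists_def list_eq_iff_nth_eq)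
  have "(\<Sum>r\<in>bitlists (k + b). h (\<forall>l<k. r ! l)) =
      (\<Sum>r\<in>bitlists (k + b). h (\<forall>l<k. take k r ! l) * 1)"
    by simp
  also have "\<dots> = (\<Sum>r\<in>bitlists k. h (\<forall>l<k. r ! l)) * (\<Sum>r\<in>bitlists b. 1)"
    by (rule sum_bitlists_append)
  also have "(\<Sum>r\<in>bitlists k. h (\<forall>l<k. r ! l)) =
      (\<Sum>r\<in>bitlists k. h False + (if r = replicate k True then h True - h False else 0))"
    by (intro sum.cong refl) (simp add: all)
  also have "\<dots> = 2 ^ k * h False + (h True - h False)"
    by (simp add: sum.distrib) (simp add: bitlists_def)
  finally show ?thesis by (simp add: algebra_simps)
qed

text \<open>Independence in counting form. The number \<open>b\<close> of trailing bits is arbitrary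
  so that the induction can hand the last block over to the tail and split the list in front of
  it.\<close>

lemma sum_prod_blocks:
  fixes h :: "nat \<Rightarrow> bool \<Rightarrow> real" and k :: nat
  defines "p \<equiv> 1 / 2 ^ k"
  shows "(\<Sum>r\<in>bitlists (m * k + b). \<Prod>j<m. h j (block_true k r j)) =
    2 ^ (m * k + b) * (\<Prod>j<m. p * h j True + (1 - p) * h j False)"
proof (induction m arbitrary: b)
  case 0
  show ?case by simp
next
  case (Suc m)
  have eq: "(\<Prod>j<Suc m. h j (block_true k r j)) =
      (\<Prod>j<m. h j (block_true k (take (m * k) r) j)) * h m (\<forall>l<k. drop (m * k) r ! l)"
    if "r \<in> bitlists (m * k + (k + b))" for r
  proof -
    have "block_true k (take (m * k) r) j = block_true k r j" if "j < m" for j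
    proof -
      have "j * k + l < m * k" if "l < k" for l
      proof -
        have "j * k + l < Suc j * k" using that by simp
        also have "\<dots> \<le> m * k" using \<open>j < m\<close> by (intro mult_right_mono) auto
        finally show ?thesis .
      qed
      then show ?thesis by (simp add: block_true_def)
    qed
    moreover have "(\<forall>l<k. drop (m * k) r ! l) = block_true k r m"
      using that by (auto simp: block_true_def bitlists_def)
    ultimately show ?thesis by simp
  qed
  have "(\<Sum>r\<in>bitlists (Suc m * k + b). \<Prod>j<Suc m. h j (block_true k r j)) =
      (\<Sum>r\<in>bitlists (m * k + (k + b)). \<Prod>j<Suc m. h j (block_true k r j))"
    by (simp add: add_ac)
  also have "\<dots> = (\<Sum>r\<in>bitlists (m * k + (k + b)).
      (\<Prod>j<m. h j (block_true k (take (m * k) r) j)) * h m (\<forall>l<k. drop (m * k) r ! l))"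
    by (rule sum.cong[OF refl eq])
  also have "\<dots> = (\<Sum>r\<in>bitlists (m * k). \<Prod>j<m. h j (block_true k r j)) *
      (\<Sum>r\<in>bitlists (k + b). h m (\<forall>l<k. r ! l))"
    by (rule sum_bitlists_append)
  also have "(\<Sum>r\<in>bitlists (m * k). \<Prod>j<m. h j (block_true k r j)) =
      2 ^ (m * k) * (\<Prod>j<m. p * h j True + (1 - p) * h j False)"
    using Suc.IH[of 0] by simp
  also have "(\<Sum>r\<in>bitlists (k + b). h m (\<forall>l<k. r ! l)) =
      2 ^ (k + b) * (p * h m True + (1 - p) * h m False)"
    unfolding sum_first_block by (simp add: p_def power_add field_simps)
  finally show ?case by (simp add: power_add algebra_simps)
qed

text \<open>The moment generating function of the sampled sum. \<open>idx\<close> places the items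
  into the \<open>m\<close> blocks; a block without an item contributes the factor 1, and the other
  factors are bounded by \<open>1 + x \<le> exp x\<close>.\<close>

lemma sum_exp_sample_le:
  fixes a :: "'e \<Rightarrow> real" and k :: nat
  assumes E: "finite E" and idx: "inj_on idx E" "idx ` E \<subseteq> {..<m}" and T: "m * k \<le> T"
  shows "(\<Sum>r\<in>bitlists T. exp (\<Sum>e\<in>{e\<in>E. block_true k r (idx e)}. a e)) \<le>
    2 ^ T * exp (1 / 2 ^ k * (\<Sum>e\<in>E. exp (a e) - 1))"
proof -
  define p :: real where "p = 1 / 2 ^ k"
  define h where "h = (\<lambda>j c. if c \<and> j \<in> idx ` E then exp (a (the_inv_into E idx j)) else 1)"
  have hidx: "h (idx e) c = (if c then exp (a e) else 1)" if "e \<in> E" for e c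
    using that idx by (simp add: h_def the_inv_into_f_f)
  have over: "(\<Prod>j<m. F j) = (\<Prod>e\<in>E. F (idx e))"
    if "\<And>j. j \<notin> idx ` E \<Longrightarrow> F j = 1" for F :: "nat \<Rightarrow> real"
  proof -
    have "(\<Prod>j<m. F j) = (\<Prod>j\<in>idx ` E. F j)"
      using that idx by (intro prod.mono_neutral_right) auto
    then show ?thesis using idx by (simp add: prod.reindex)
  qed
  have "exp (\<Sum>e\<in>{e\<in>E. block_true k r (idx e)}. a e) = (\<Prod>j<m. h j (block_true k r j))" for r
  proof -
    have "exp (\<Sum>e\<in>{e\<in>E. block_true k r (idx e)}. a e) =
        (\<Prod>e\<in>{e\<in>E. block_true k r (idx e)}. exp (a e))" using E by (simp add: exp_sum)
    also have "\<dots> = (\<Prod>e\<in>E. if block_true k r (idx e) then exp (a e) else 1)"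
      using E by (simp add: prod.inter_filter)
    also have "\<dots> = (\<Prod>e\<in>E. h (idx e) (block_true k r (idx e)))"
      by (intro prod.cong refl) (simp add: hidx)
    also have "\<dots> = (\<Prod>j<m. h j (block_true k r j))"
      by (rule over[symmetric]) (simp add: h_def)
    finally show ?thesis .
  qed
  then have "(\<Sum>r\<in>bitlists T. exp (\<Sum>e\<in>{e\<in>E. block_true k r (idx e)}. a e)) =
      2 ^ T * (\<Prod>j<m. p * h j True + (1 - p) * h j False)"
    using sum_prod_blocks[of h k m "T - m * k"] T by (simp add: p_def)
  also have "(\<Prod>j<m. p * h j True + (1 - p) * h j False) =
      (\<Prod>e\<in>E. p * h (idx e) True + (1 - p) * h (idx e) False)"
    by (rule over) (simp add: h_def)
  also have "\<dots> = (\<Prod>e\<in>E. 1 + p * (exp (a e) - 1))"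
    by (intro prod.cong refl) (simp add: hidx algebra_simps)
  also have "\<dots> \<le> (\<Prod>e\<in>E. exp (p * (exp (a e) - 1)))"
  proof (intro prod_mono conjI)
    fix e
    have "p * (exp (a e) - 1) \<ge> p * (- 1)" by (intro mult_left_mono) (simp_all add: p_def)
    moreover have "p \<le> 1" by (simp add: p_def)
    ultimately show "0 \<le> 1 + p * (exp (a e) - 1)" by linarith
    show "1 + p * (exp (a e) - 1) \<le> exp (p * (exp (a e) - 1))" by (rule exp_ge_add_one_self)
  qed
  also have "\<dots> = exp (p * (\<Sum>e\<in>E. exp (a e) - 1))"
    using E by (simp add: exp_sum sum_distrib_left)
  finally show ?thesis by (simp add: p_def)
qed

lemma markov_exp_count:
  fixes X :: "'r \<Rightarrow> real"
  assumes "finite R" and sum: "(\<Sum>r\<in>R. exp (X r)) \<le> N * exp c"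
  shows "real (card {r\<in>R. X r > c + t}) \<le> N * exp (- t)"
proof -
  have "real (card {r\<in>R. X r > c + t}) * exp (c + t) = (\<Sum>r\<in>{r\<in>R. X r > c + t}. exp (c + t))" by simp
  also have "\<dots> \<le> (\<Sum>r\<in>{r\<in>R. X r > c + t}. exp (X r))" by (intro sum_mono) auto
  also have "\<dots> \<le> (\<Sum>r\<in>R. exp (X r))" using assms(1) by (intro sum_mono2) auto
  also have "\<dots> \<le> N * exp c" by (rule sum)
  finally show ?thesis by (simp add: exp_add exp_minus field_simps)
qed

text \<open>Chernoff's method with the parameter fixed at 1 and at -1: on {0, 1, 2} one has
  \<open>exp a - 1 \<le> 8 * a\<close> and \<open>exp (- a) - 1 \<le> - a / 4\<close>. Giving up
  constant factors of the mean makes the probability of an additive error \<open>t\<close> at most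
  \<open>exp (- t)\<close>, whatever the mean is.\<close>

lemma sample_tails:
  fixes a :: "'e \<Rightarrow> real" and k :: nat
  assumes E: "finite E" and idx: "inj_on idx E" "idx ` E \<subseteq> {..<m}" and T: "m * k \<le> T"
    and a: "\<And>e. e \<in> E \<Longrightarrow> a e \<in> {0, 1, 2}"
  defines "F \<equiv> \<lambda>r. {e\<in>E. block_true k r (idx e)}" and "\<mu> \<equiv> 1 / 2 ^ k * (\<Sum>e\<in>E. a e)"
  shows "real (card {r\<in>bitlists T. (\<Sum>e\<in>F r. a e) > 8 * \<mu> + t}) \<le> 2 ^ T * exp (- t)"
    and "real (card {r\<in>bitlists T. (\<Sum>e\<in>F r. a e) < \<mu> / 4 - t}) \<le> 2 ^ T * exp (- t)"
proof -
  have e1: "exp 1 \<le> (3::real)" by (rule exp_le)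
  have e2: "exp 2 \<le> (9::real)"
    using mult_mono[OF e1 e1] by (simp add: exp_add[symmetric])
  have "(\<Sum>r\<in>bitlists T. exp (\<Sum>e\<in>F r. a e)) \<le> 2 ^ T * exp (1 / 2 ^ k * (\<Sum>e\<in>E. exp (a e) - 1))"
    unfolding F_def by (rule sum_exp_sample_le[OF E idx T])
  also have "(\<Sum>e\<in>E. exp (a e) - 1) \<le> (\<Sum>e\<in>E. 8 * a e)"
    by (intro sum_mono) (use a e1 e2 in fastforce)
  then have "2 ^ T * exp (1 / 2 ^ k * (\<Sum>e\<in>E. exp (a e) - 1)) \<le> (2 ^ T * exp (8 * \<mu>) :: real)"
    by (simp add: \<mu>_def sum_distrib_left[symmetric] divide_right_mono)
  finally show "real (card {r\<in>bitlists T. (\<Sum>e\<in>F r. a e) > 8 * \<mu> + t}) \<le> 2 ^ T * exp (- t)"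
    by (intro markov_exp_count) auto
  have f1: "exp (- 1) \<le> (3 / 4 :: real)"
    using exp_ge_add_one_self[of "1::real"] by (simp add: exp_minus field_simps)
  have f2: "exp (- 2) \<le> (1 / 2 :: real)"
    using exp_ge_add_one_self[of "2::real"] by (simp add: exp_minus field_simps)
  have "(\<Sum>r\<in>bitlists T. exp (\<Sum>e\<in>F r. - a e)) \<le> 2 ^ T * exp (1 / 2 ^ k * (\<Sum>e\<in>E. exp (- a e) - 1))"
    unfolding F_def by (rule sum_exp_sample_le[OF E idx T])
  also have "(\<Sum>e\<in>E. exp (- a e) - 1) \<le> (\<Sum>e\<in>E. - 1 / 4 * a e)"
    by (intro sum_mono) (use a f1 f2 in fastforce)
  then have "2 ^ T * exp (1 / 2 ^ k * (\<Sum>e\<in>E. exp (- a e) - 1)) \<le> (2 ^ T * exp (- \<mu> / 4) :: real)"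
    unfolding \<mu>_def sum_distrib_left[symmetric] by (simp add: divide_right_mono field_simps)
  finally have "real (card {r\<in>bitlists T. (\<Sum>e\<in>F r. - a e) > - \<mu> / 4 + t}) \<le> 2 ^ T * exp (- t)"
    by (intro markov_exp_count) auto
  moreover have "{r\<in>bitlists T. (\<Sum>e\<in>F r. - a e) > - \<mu> / 4 + t} = {r\<in>bitlists T. (\<Sum>e\<in>F r. a e) < \<mu> / 4 - t}"
    by (auto simp: sum_negf)
  ultimately show "real (card {r\<in>bitlists T. (\<Sum>e\<in>F r. a e) < \<mu> / 4 - t}) \<le> 2 ^ T * exp (- t)" by simp
qed

text \<open>For a sign vector \<open>s\<close>, the difference of the positive masses of \<open>s\<close> and \<open>-s\<close> is \<open>\<Sum>u. s u * deg u\<close>.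
  Degrees alone deviate too much in a sample, whereas each of the two masses is preserved up to constant
  factors, and the factors are compensated by the freedom to choose the weights.\<close>

definition pos_mass :: "(nat \<Rightarrow> real) \<Rightarrow> nat set set \<Rightarrow> real" where
  "pos_mass s E = (\<Sum>e\<in>E. max 0 (\<Sum>u\<in>e. s u))"

definition cut_mass :: "nat set \<Rightarrow> nat set set \<Rightarrow> real" where
  "cut_mass S E = (\<Sum>e\<in>E. of_bool (card (e \<inter> S) = 1))"

text \<open>The slack is proportional to the support of \<open>s\<close>. A vector supported on w
  vertices then fails with probability at most \<open>3 * exp (- \<kappa> * w)\<close>, which beats
  the number of such vectors once \<kappa> is a suitable multiple of ln n. For the cut test only the
  support of \<open>s\<close> matters.\<close>

definition good_sample :: "nat \<Rightarrow> nat set set \<Rightarrow> real \<Rightarrow> real \<Rightarrow> nat set set \<Rightarrow> bool" where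
  "good_sample n E p \<kappa> F \<longleftrightarrow> (\<forall>s. (\<forall>u<n. s u \<in> {-1, 0, 1}) \<longrightarrow>
     pos_mass s F \<le> 8 * (p * pos_mass s E) + \<kappa> * (\<Sum>u<n. \<bar>s u\<bar>) \<and>
     pos_mass s F \<ge> p * pos_mass s E / 4 - \<kappa> * (\<Sum>u<n. \<bar>s u\<bar>) \<and>
     cut_mass {u\<in>{..<n}. s u \<noteq> 0} F \<ge> p * cut_mass {u\<in>{..<n}. s u \<noteq> 0} E / 4 - \<kappa> * (\<Sum>u<n. \<bar>s u\<bar>))"

text \<open>Extensional functions, so that vectors which agree below \<open>n\<close> are identified
  and the union bound ranges over a finite set.\<close>

definition sign_vectors :: "nat \<Rightarrow> (nat \<Rightarrow> real) set" where
  "sign_vectors n = PiE {..<n} (\<lambda>_. {-1, 0, 1})"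

lemma finite_sign_vectors: "finite (sign_vectors n)"
  unfolding sign_vectors_def by (rule finite_PiE) auto

text \<open>The failure bound factors over the coordinates; each contributes 1 for the value 0 and
  \<open>exp (- \<kappa>)\<close> for each of the two signs.\<close>

lemma sum_sign_vectors:
  "(\<Sum>s\<in>sign_vectors n. exp (- \<kappa> * (\<Sum>u<n. \<bar>s u\<bar>))) = (1 + 2 * exp (- \<kappa>)) ^ n"
proof -
  have "(\<Sum>s\<in>sign_vectors n. exp (- \<kappa> * (\<Sum>u<n. \<bar>s u\<bar>))) =
      (\<Sum>s\<in>sign_vectors n. \<Prod>u<n. exp (- \<kappa> * \<bar>s u\<bar>))"
    by (simp add: exp_sum sum_distrib_left sum_negf[symmetric])
  also have "\<dots> = (\<Prod>u<n. \<Sum>x\<in>{-1, 0, 1}. exp (- \<kappa> * \<bar>x\<bar>))"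
    unfolding sign_vectors_def by (rule prod_sum_PiE[symmetric]) auto
  also have "\<dots> = (1 + 2 * exp (- \<kappa>)) ^ n" by (simp add: add.commute)
  finally show ?thesis .
qed

text \<open>Union bound over three tests and all nonzero sign vectors. The zero vector passes its
  tests with equality, which accounts for the \<open>- 1\<close>.\<close>

lemma card_not_good_sample:
  assumes E: "finite E" "\<And>e. e \<in> E \<Longrightarrow> e \<subseteq> {..<n} \<and> card e = 2"
    and idx: "inj_on idx E" "idx ` E \<subseteq> {..<m}" and T: "m * k \<le> T"
  shows "real (card {r\<in>bitlists T. \<not> good_sample n E (1 / 2 ^ k) \<kappa> {e\<in>E. block_true k r (idx e)}})
    \<le> 2 ^ T * (3 * ((1 + 2 * exp (- \<kappa>)) ^ n - 1))"
proof -
  define F where "F = (\<lambda>r. {e\<in>E. block_true k r (idx e)})"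
  define p :: real where "p = 1 / 2 ^ k"
  define w where "w = (\<lambda>s::nat\<Rightarrow>real. \<Sum>u<n. \<bar>s u\<bar>)"
  define Z where "Z = (\<lambda>s. {u\<in>{..<n}. s u \<noteq> (0::real)})"
  define B where "B = (\<lambda>s.
    {r\<in>bitlists T. pos_mass s (F r) > 8 * (p * pos_mass s E) + \<kappa> * w s} \<union>
    {r\<in>bitlists T. pos_mass s (F r) < p * pos_mass s E / 4 - \<kappa> * w s} \<union>
    {r\<in>bitlists T. cut_mass (Z s) (F r) < p * cut_mass (Z s) E / 4 - \<kappa> * w s})"
  define z where "z = (\<lambda>u\<in>{..<n}. 0 :: real)"
  let ?S = "sign_vectors n"
  have zS: "z \<in> ?S" by (auto simp: sign_vectors_def z_def)
  have B_card: "real (card (B s)) \<le> 2 ^ T * (3 * exp (- \<kappa> * w s))" if s: "s \<in> ?S" for s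
  proof -
    have a1: "max 0 (\<Sum>u\<in>e. s u) \<in> {0, 1, 2}" if e: "e \<in> E" for e
    proof -
      obtain x y where xy: "e = {x, y}" "x \<noteq> y" using E(2)[OF e] by (auto simp: card_2_iff)
      have "x < n" "y < n" using E(2)[OF e] xy by auto
      then have "s x \<in> {-1, 0, 1}" "s y \<in> {-1, 0, 1}" using s by (auto simp: sign_vectors_def PiE_def Pi_def)
      then show ?thesis using xy by auto
    qed
    have a2: "of_bool (card (e \<inter> Z s) = 1) \<in> {0, 1, 2::real}" for e by auto
    note t1 = sample_tails[OF E(1) idx T, of "\<lambda>e. max 0 (\<Sum>u\<in>e. s u)" "\<kappa> * w s", OF a1]
    note t2 = sample_tails(2)[OF E(1) idx T, of "\<lambda>e. of_bool (card (e \<inter> Z s) = 1)" "\<kappa> * w s", OF a2]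
    have "card (B s) \<le> card {r\<in>bitlists T. pos_mass s (F r) > 8 * (p * pos_mass s E) + \<kappa> * w s}
        + card {r\<in>bitlists T. pos_mass s (F r) < p * pos_mass s E / 4 - \<kappa> * w s}
        + card {r\<in>bitlists T. cut_mass (Z s) (F r) < p * cut_mass (Z s) E / 4 - \<kappa> * w s}"
      unfolding B_def by (intro order_trans[OF card_Un_le] add_right_mono card_Un_le)
    then have "real (card (B s)) \<le> 2 ^ T * exp (- (\<kappa> * w s)) + 2 ^ T * exp (- (\<kappa> * w s)) + 2 ^ T * exp (- (\<kappa> * w s))"
      using t1 t2 unfolding pos_mass_def cut_mass_def F_def p_def by linarith
    then show ?thesis by simp
  qed
  have sub: "{r\<in>bitlists T. \<not> good_sample n E p \<kappa> (F r)} \<subseteq> (\<Union>s\<in>?S - {z}. B s)"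
  proof
    fix r assume "r \<in> {r\<in>bitlists T. \<not> good_sample n E p \<kappa> (F r)}"
    then obtain s0 where r: "r \<in> bitlists T" and s0: "\<forall>u<n. s0 u \<in> {-1, 0, 1}" and
      bad: "\<not> (pos_mass s0 (F r) \<le> 8 * (p * pos_mass s0 E) + \<kappa> * w s0 \<and>
        pos_mass s0 (F r) \<ge> p * pos_mass s0 E / 4 - \<kappa> * w s0 \<and>
        cut_mass (Z s0) (F r) \<ge> p * cut_mass (Z s0) E / 4 - \<kappa> * w s0)"
      unfolding good_sample_def w_def Z_def by blast
    define s where "s = restrict s0 {..<n}"
    have sS: "s \<in> ?S" using s0 by (auto simp: sign_vectors_def s_def)
    have eqs: "(\<Sum>u\<in>e. s u) = (\<Sum>u\<in>e. s0 u)" if "e \<in> E" for e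
      using E(2)[OF that] by (intro sum.cong) (auto simp: s_def)
    have "pos_mass s D = pos_mass s0 D" if "D \<subseteq> E" for D
      unfolding pos_mass_def using that eqs by (intro sum.cong refl) (metis subsetD)
    then have pm: "pos_mass s E = pos_mass s0 E" "pos_mass s (F r) = pos_mass s0 (F r)"
      by (auto simp: F_def)
    have wz: "w s = w s0" "Z s = Z s0" by (auto simp: w_def Z_def s_def)
    have rB: "r \<in> B s" using bad r by (auto simp: B_def pm wz not_le)
    have "s \<noteq> z"
    proof
      assume "s = z"
      then have "w s = 0" "Z s = {}" by (auto simp: w_def Z_def z_def)
      moreover have "pos_mass s D = 0" if "D \<subseteq> E" for D
      proof -
        have "(\<Sum>u\<in>e. s u) = 0" if "e \<in> E" for e
          using \<open>s = z\<close> E(2)[OF that] by (intro sum.neutral) (auto simp: z_def)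
        then show ?thesis unfolding pos_mass_def using that by (intro sum.neutral) auto
      qed
      then have "pos_mass s E = 0" "pos_mass s (F r) = 0" by (auto simp: F_def)
      ultimately show False using rB by (simp add: B_def cut_mass_def)
    qed
    then show "r \<in> (\<Union>s\<in>?S - {z}. B s)" using sS rB by blast
  qed
  have "real (card {r\<in>bitlists T. \<not> good_sample n E p \<kappa> (F r)}) \<le> real (card (\<Union>s\<in>?S - {z}. B s))"
    using sub by (intro of_nat_mono card_mono) (auto simp: finite_sign_vectors B_def)
  also have "\<dots> \<le> real (\<Sum>s\<in>?S - {z}. card (B s))"
    by (intro of_nat_mono card_UN_le) (simp add: finite_sign_vectors)
  also have "\<dots> \<le> (\<Sum>s\<in>?S - {z}. 2 ^ T * (3 * exp (- \<kappa> * w s)))"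
    unfolding of_nat_sum by (intro sum_mono B_card) auto
  also have "\<dots> = 2 ^ T * (3 * (\<Sum>s\<in>?S - {z}. exp (- \<kappa> * w s)))"
    by (simp add: sum_distrib_left)
  also have "(\<Sum>s\<in>?S - {z}. exp (- \<kappa> * w s)) = (1 + 2 * exp (- \<kappa>)) ^ n - 1"
    using sum.remove[OF finite_sign_vectors zS, of "\<lambda>s. exp (- \<kappa> * w s)"] sum_sign_vectors[of \<kappa> n]
    by (simp add: w_def z_def)
  finally show ?thesis by (simp add: F_def p_def)
qed

section \<open>Locally optimal weights give a sparsifier\<close>

lemma sum_edges_vertices:
  fixes w :: "nat set \<Rightarrow> real"
  assumes "finite F" "\<And>e. e \<in> F \<Longrightarrow> e \<subseteq> {..<n}"
  shows "(\<Sum>e\<in>F. w e * (\<Sum>u\<in>e. s u)) = (\<Sum>u<n. s u * (\<Sum>e\<in>{e\<in>F. u \<in> e}. w e))"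
proof -
  have "(\<Sum>e\<in>F. w e * (\<Sum>u\<in>e. s u)) = (\<Sum>e\<in>F. \<Sum>u\<in>{u\<in>{..<n}. u \<in> e}. w e * s u)"
  proof (intro sum.cong refl)
    fix e assume "e \<in> F"
    then have "{u\<in>{..<n}. u \<in> e} = e" using assms(2) by auto
    then show "w e * (\<Sum>u\<in>e. s u) = (\<Sum>u\<in>{u\<in>{..<n}. u \<in> e}. w e * s u)"
      by (simp add: sum_distrib_left)
  qed
  also have "\<dots> = (\<Sum>u<n. \<Sum>e\<in>{e\<in>F. u \<in> e}. w e * s u)"
    using assms(1) by (intro sum.swap_restrict) auto
  finally show ?thesis by (simp add: sum_distrib_left mult.commute)
qed

lemma pos_mass_diff:
  "pos_mass s E - pos_mass (\<lambda>u. - s u) E = (\<Sum>e\<in>E. \<Sum>u\<in>e. s u)"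
  unfolding pos_mass_def sum_subtractf[symmetric] by (intro sum.cong refl) (auto simp: sum_negf max_def)

definition weight_sum :: "nat set set \<Rightarrow> (nat set \<Rightarrow> nat) \<Rightarrow> nat \<Rightarrow> nat" where
  "weight_sum F w u = (\<Sum>e\<in>{e\<in>F. u \<in> e}. w e)"

text \<open>No edge weight in \<open>[M, 32 M]\<close> can be changed by one unit such that the sum of the
  squared deviations of the degrees from \<open>t\<close> decreases.\<close>

definition locally_optimal :: "nat set set \<Rightarrow> nat \<Rightarrow> nat \<Rightarrow> (nat set \<Rightarrow> nat) \<Rightarrow> bool" where
  "locally_optimal F M t w \<longleftrightarrow> (\<forall>e\<in>F. M \<le> w e \<and> w e \<le> 32 * M) \<and>
     (\<forall>u v. u \<noteq> v \<and> {u, v} \<in> F \<longrightarrow>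
       (2 * t + 2 \<le> weight_sum F w u + weight_sum F w v \<longrightarrow> w {u, v} = M) \<and>
       (weight_sum F w u + weight_sum F w v + 2 \<le> 2 * t \<longrightarrow> w {u, v} = 32 * M))"

text \<open>For the sign vector \<open>s\<close> of the deviating vertices, local optimality bounds
  the signed sum of the weighted degrees by \<open>M\<close> times the positive mass of
  \<open>s\<close> minus \<open>32 * M\<close> times that of \<open>- s\<close>. The sample turns
  both coefficients into \<open>8 * M * p\<close>, which leaves \<open>t * (\<Sum>u<n. s u)\<close>
  plus an error \<open>33 * M * \<kappa>\<close> per vertex of the support. Every vertex of the
  support deviates by more than that, so the support is empty.\<close>

lemma locally_optimal_near_regular:
  assumes E: "finite E" "\<And>e. e \<in> E \<Longrightarrow> e \<subseteq> {..<n} \<and> card e = 2" and F: "F \<subseteq> E"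
    and reg: "\<And>u. u < n \<Longrightarrow> card {e\<in>E. u \<in> e} = D"
    and good: "good_sample n E p \<kappa> F" and opt: "locally_optimal F M t w"
    and t: "real t = 8 * real M * p * real D" and M: "M > 0" and kappa: "\<kappa> \<ge> 0" and u: "u < n"
  shows "\<bar>real (weight_sum F w u) - real t\<bar> \<le> 33 * M * \<kappa> + n + 1"
proof -
  define r where "r = (\<lambda>u. int (weight_sum F w u) - int t)"
  \<comment> \<open>33 = 1 + 32: the slack \<kappa> is multiplied by the smallest weight on the
    positive side and by the largest one on the negative side.\<close>
  define l0 where "l0 = nat \<lceil>33 * M * \<kappa>\<rceil>"
  have l0: "33 * M * \<kappa> \<le> l0" "l0 \<le> 33 * M * \<kappa> + 1" using kappa of_int_ceiling_le_add_one[of "33 * M * \<kappa>"]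
    unfolding l0_def by (auto simp: real_nat_ceiling_ge)
  have finF: "finite F" using E F finite_subset by blast
  \<comment> \<open>The \<open>n\<close> vertices cannot occupy \<open>n + 1\<close> consecutive
    values.\<close>
  have "card ((\<lambda>u. nat \<bar>r u\<bar>) ` {..<n}) < card {l0+1..l0+n+1}"
    using card_image_le[of "{..<n}" "\<lambda>u. nat \<bar>r u\<bar>"] by simp
  then have "\<not> {l0+1..l0+n+1} \<subseteq> (\<lambda>u. nat \<bar>r u\<bar>) ` {..<n}"
    by (metis card_mono finite_imageI finite_lessThan not_le)
  (* an empty level: an edge between |r| <= l and |r| > l then has r u + r v far enough from 0 for local optimality to apply *)
  then obtain l' where l': "l' \<in> {l0+1..l0+n+1}" "l' \<notin> (\<lambda>u. nat \<bar>r u\<bar>) ` {..<n}" by blast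
  \<comment> \<open>The missing value is \<open>l + 1\<close>, so \<open>\<bar>r u\<bar>\<close>
    jumps from at most \<open>l\<close> to at least \<open>l + 2\<close>. An edge between a vertex
    of sign 0 and one of sign 1 or -1 thus has total deviation at least 2 in absolute value, the
    threshold of \<open>locally_optimal\<close>.\<close>
  define l where "l = int l' - 1"
  have l: "l \<ge> l0" "l \<le> l0 + n" using l' by (auto simp: l_def)
  have gap: "\<bar>r u\<bar> \<noteq> l + 1" if "u < n" for u 
  proof
    assume "\<bar>r u\<bar> = l + 1"
    then have "nat \<bar>r u\<bar> = l'" by (simp add: l_def)
    then show False using l' that by (metis imageI lessThan_iff)
  qed
  define s :: "nat \<Rightarrow> real" where "s = (\<lambda>u. if r u > l then 1 else if r u < - l then - 1 else 0)"
  define m where "m = (\<Sum>u<n. \<bar>s u\<bar>)"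
  have l_nonneg: "l \<ge> 0" using l by simp
  \<comment> \<open>Local optimality fixes the weight of an edge with nonzero sign sum. The weight
    of an edge with sign sum 0 is unknown, but both sides vanish for it.\<close>
  have edge_bound: "real (w e) * (\<Sum>u\<in>e. s u) \<le>
      M * max 0 (\<Sum>u\<in>e. s u) - 32 * M * max 0 (\<Sum>u\<in>e. - s u)" if e: "e \<in> F" for e
  proof -
    obtain u v where uv: "e = {u, v}" "u \<noteq> v" using E(2)[of e] e F by (auto simp: card_2_iff)
    have lt: "u < n" "v < n" using E(2)[of e] e F uv by auto
    note g = gap[OF lt(1)] gap[OF lt(2)]
    have se: "(\<Sum>u\<in>e. s u) = s u + s v" "(\<Sum>u\<in>e. - s u) = - (s u + s v)" using uv by auto
    consider "s u + s v > 0" | "s u + s v < 0" | "s u + s v = 0" by linarith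
    then show ?thesis
    proof cases
      case 1
      then have "r u + r v \<ge> 2" using g l_nonneg by (auto simp: s_def split: if_splits)
      then have "2 * t + 2 \<le> weight_sum F w u + weight_sum F w v" by (simp add: r_def)
      then have "w e = M" using opt uv e unfolding locally_optimal_def by blast
      then show ?thesis using 1 by (simp add: se)
    next
      case 2
      then have "r u + r v \<le> - 2" using g l_nonneg by (auto simp: s_def split: if_splits)
      then have "weight_sum F w u + weight_sum F w v + 2 \<le> 2 * t" by (simp add: r_def)
      then have "w e = 32 * M" using opt uv e unfolding locally_optimal_def by blast
      then show ?thesis using 2 by (simp add: se algebra_simps)
    next
      case 3
      then show ?thesis by (simp add: se)
    qed
  qed
  have sx: "(\<Sum>u<n. s u * real (weight_sum F w u)) \<le> M * pos_mass s F - 32 * M * pos_mass (\<lambda>u. - s u) F"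
  proof -
    have "(\<Sum>u<n. s u * real (weight_sum F w u)) = (\<Sum>e\<in>F. real (w e) * (\<Sum>u\<in>e. s u))"
      unfolding weight_sum_def of_nat_sum
      by (rule sum_edges_vertices[symmetric, OF finF]) (use E F in auto)
    also have "\<dots> \<le> (\<Sum>e\<in>F. M * max 0 (\<Sum>u\<in>e. s u) - 32 * M * max 0 (\<Sum>u\<in>e. - s u))"
      by (rule sum_mono[OF edge_bound])
    finally show ?thesis by (simp add: pos_mass_def sum_subtractf sum_distrib_left)
  qed
  have sD: "real D * (\<Sum>u<n. s u) = pos_mass s E - pos_mass (\<lambda>u. - s u) E"
  proof -
    have "pos_mass s E - pos_mass (\<lambda>u. - s u) E = (\<Sum>e\<in>E. 1 * (\<Sum>u\<in>e. s u))"
      by (simp add: pos_mass_diff)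
    also have "\<dots> = (\<Sum>u<n. s u * (\<Sum>e\<in>{e\<in>E. u \<in> e}. 1))"
      by (rule sum_edges_vertices) (use E in auto)
    also have "\<dots> = (\<Sum>u<n. s u * D)" by (intro sum.cong refl) (simp add: reg)
    finally show ?thesis by (simp add: sum_distrib_left mult.commute)
  qed
  have g1: "pos_mass s F \<le> 8 * (p * pos_mass s E) + \<kappa> * m"
    using good by (auto simp: good_sample_def m_def s_def)
  have g2: "pos_mass (\<lambda>u. - s u) F \<ge> p * pos_mass (\<lambda>u. - s u) E / 4 - \<kappa> * m"
    using good[unfolded good_sample_def, rule_format, of "\<lambda>u. - s u"] by (auto simp: m_def s_def)
  have "(\<Sum>u<n. s u * r u) = (\<Sum>u<n. s u * real (weight_sum F w u)) - t * (\<Sum>u<n. s u)"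
    by (simp add: r_def right_diff_distrib sum_subtractf sum_distrib_left mult.commute)
  also have "t * (\<Sum>u<n. s u) = 8 * M * p * (pos_mass s E - pos_mass (\<lambda>u. - s u) E)"
    unfolding t sD[symmetric] by simp
  finally have "(\<Sum>u<n. s u * r u) \<le> M * (pos_mass s F - 8 * (p * pos_mass s E))
      - 32 * M * (pos_mass (\<lambda>u. - s u) F - p * pos_mass (\<lambda>u. - s u) E / 4)"
    using sx by (simp add: algebra_simps)
  also have "\<dots> \<le> M * (\<kappa> * m) - 32 * M * (- (\<kappa> * m))"
    using g1 g2 by (intro diff_mono mult_left_mono) auto
  finally have up: "(\<Sum>u<n. s u * r u) \<le> 33 * M * \<kappa> * m" by (simp add: mult_ac)
  have "(l + 1) * m \<le> (\<Sum>u<n. s u * r u)"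
    unfolding m_def sum_distrib_left
  proof (intro sum_mono)
    fix u
    have "real_of_int (l + 1) \<le> real_of_int (r u)" if "r u > l" using that by linarith
    moreover have "real_of_int (l + 1) \<le> real_of_int (- r u)" if "r u < - l" using that by linarith
    ultimately show "real_of_int (l + 1) * \<bar>s u\<bar> \<le> s u * real_of_int (r u)"
      by (auto simp: s_def)
  qed
  then have "real_of_int (l + 1) * m \<le> real_of_int l * m"
  proof -
    assume "real_of_int (l + 1) * m \<le> (\<Sum>u<n. s u * r u)"
    also note up
    also have "33 * M * \<kappa> * m \<le> real_of_int l * m"
      using l l0 by (intro mult_right_mono) (auto simp: m_def intro: sum_nonneg)
    finally show ?thesis .
  qed
  then have "m \<le> 0" by (simp add: algebra_simps)
  moreover have "\<bar>s u\<bar> \<le> m" unfolding m_def using u by (intro member_le_sum) auto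
  ultimately have "s u = 0" by simp
  then have "\<bar>r u\<bar> \<le> l" by (auto simp: s_def split: if_splits)
  then have "\<bar>real_of_int (r u)\<bar> \<le> real_of_int l" by linarith
  also have "\<dots> \<le> 33 * M * \<kappa> + n + 1" using l l0 by linarith
  finally show ?thesis by (simp add: r_def)
qed

section \<open>From near-regularity and expansion to a resistance sparsifier\<close>

lemma cut_weight_expansion:
  assumes exp: "edge_expansion G \<ge> c" and S: "S \<subseteq> {..<num_verts G}" "2 * card S \<le> num_verts G"
  shows "c * card S \<le> cut_weight G S"
proof (cases "S = {}")
  case True
  then show ?thesis by (simp add: cut_weight_def)
next
  case False
  let ?T = "{S. S \<subseteq> {0..<num_verts G} \<and> 0 < card S \<and> real (card S) \<le> real (num_verts G) / 2}"
  have "finite S" using S finite_subset by blast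
  then have pos: "card S > 0" using False by (simp add: card_gt_0_iff)
  have "finite ?T" by (rule finite_subset[of _ "Pow {0..<num_verts G}"]) auto
  moreover have "S \<in> ?T" using S pos by auto
  ultimately have "edge_expansion G \<le> cut_weight G S / card S"
    unfolding edge_expansion_def by (intro Min_le) auto
  then have "c \<le> cut_weight G S / card S" using exp by simp
  then show ?thesis using pos by (simp add: field_simps)
qed

lemma unweighted_cut_mass:
  assumes "finite (edges G)" "unweighted G"
  shows "cut_weight G S = cut_mass S (edges G)"
proof -
  have "cut_mass S (edges G) = (\<Sum>e\<in>{e\<in>edges G. card (e \<inter> S) = 1}. 1)"
    unfolding cut_mass_def of_bool_def by (rule sum.inter_filter[symmetric, OF assms(1)])
  then show ?thesis using assms(2) by (simp add: cut_weight_def unweighted_def)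
qed

text \<open>Both resistances are compared with a common value \<Theta>. The two tolerances are small
  enough to leave room for the products of errors, where
  \<open>\<epsilon> * \<epsilon> \<le> \<epsilon>\<close> helps.\<close>

lemma ratio_transfer:
  fixes \<epsilon> \<Theta> R S :: real
  assumes "0 < \<epsilon>" "\<epsilon> < 1" "\<Theta> > 0"
    and "(1 - \<epsilon> / 100) * \<Theta> \<le> R" "R \<le> (1 + \<epsilon> / 100) * \<Theta>"
    and "(1 - \<epsilon> / 25) * \<Theta> \<le> S" "S \<le> (1 + \<epsilon> / 25) * \<Theta>"
  shows "(1 - \<epsilon>) * S \<le> R" "R \<le> (1 + \<epsilon>) * S"
proof -
  have "(1 - \<epsilon>) * S \<le> (1 - \<epsilon>) * ((1 + \<epsilon> / 25) * \<Theta>)" using assms by (intro mult_left_mono) auto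
  also have "\<dots> \<le> (1 - \<epsilon> / 100) * \<Theta>"
    unfolding mult.assoc[symmetric] using assms by (intro mult_right_mono) (auto simp: algebra_simps)
  finally show "(1 - \<epsilon>) * S \<le> R" using assms by simp
  have "\<epsilon> * \<epsilon> \<le> \<epsilon>" using assms by (simp add: mult_left_le)
  then have "1 + \<epsilon> / 100 \<le> (1 + \<epsilon>) * (1 - \<epsilon> / 25)"
    using assms(1,2) \<open>\<epsilon> * \<epsilon> \<le> \<epsilon>\<close>
    by (simp only: distrib_left distrib_right left_diff_distrib right_diff_distrib)
  then have "(1 + \<epsilon> / 100) * \<Theta> \<le> (1 + \<epsilon>) * (1 - \<epsilon> / 25) * \<Theta>"
    using assms by (intro mult_right_mono) auto
  also have "\<dots> \<le> (1 + \<epsilon>) * S"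
    unfolding mult.assoc using assms by (intro mult_left_mono) auto
  finally show "R \<le> (1 + \<epsilon>) * S" using assms by simp
qed

text \<open>After division by \<open>8 * n\<close> the weights lie between
  \<open>1 / (8 * p)\<close> and \<open>4 / p\<close>, the target degree is \<open>D\<close>, and
  the cuts retain expansion \<open>\<gamma> * D / 64\<close>. Of the conditions, \<open>h1\<close>
  keeps the relative degree error below \<open>\<epsilon> / 100\<close>, \<open>h2\<close> lets the
  additive loss of a cut consume at most half of its main term, and \<open>h3\<close> controls the
  error that stems from the Cheeger gap.\<close>

lemma locally_optimal_sparsifier:
  fixes \<epsilon> \<gamma> \<kappa> p :: real
  assumes reg: "regular_graph D G" and n: "num_verts G = n" "n > 0"
    and expa: "edge_expansion G \<ge> \<gamma> * real D" and gamma: "\<gamma> > 0" and eps: "0 < \<epsilon>" "\<epsilon> < 1"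
    and p: "p = 1 / 2 ^ k"
    and good: "good_sample n (edges G) p \<kappa> F" and F: "F \<subseteq> edges G"
    and opt: "locally_optimal F (2 ^ k * n) (8 * n * D) w"
    and H: "num_verts H = n" "edges H = F" "\<And>e. e \<in> F \<Longrightarrow> weight H e = real (w e) / real (8 * n)"
    and kappa: "\<kappa> \<ge> 2" and h1: "425 * \<kappa> \<le> \<epsilon> * (p * D)" and h2: "8 * \<kappa> \<le> \<gamma> * (p * D)"
    and h3: "10 ^ 7 \<le> \<gamma>\<^sup>2 * (\<epsilon> * (p * D))"
  shows "resistance_sparsifier \<epsilon> G H"
proof -
  have wfG: "wf_weighted_graph G" and uw: "unweighted G"
    and deg: "\<And>u. u < n \<Longrightarrow> card {e\<in>edges G. u \<in> e} = D"
    using reg n by (auto simp: regular_graph_def)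
  define E where "E = edges G"
  have finE: "finite E" using finite_edges[OF wfG] by (simp add: E_def)
  have E2: "e \<subseteq> {..<n} \<and> card e = 2" if "e \<in> E" for e
    using wfG that n by (auto simp: wf_weighted_graph_def E_def atLeast0LessThan)
  have finF: "finite F" using F finE finite_subset by (auto simp: E_def)
  define M where "M = 2 ^ k * n"
  have M: "M > 0" using n by (simp add: M_def)
  have Mr: "real M = n / p" by (simp add: M_def p)
  have p01: "0 < p" "p \<le> 1" by (simp_all add: p)
  have wM: "M \<le> w e" "w e \<le> 32 * M" if "e \<in> F" for e
    using opt that by (auto simp: locally_optimal_def M_def)
  have wH: "1 / (8 * p) \<le> weight H e" "weight H e \<le> 4 / p" if "e \<in> F" for e
  proof -
    have b: "real M \<le> real (w e)" "real (w e) \<le> 32 * real M" using wM[OF that] by linarith+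
    have "1 / (8 * p) = real M / (8 * n)" "4 / p = 32 * real M / (8 * n)" using n by (auto simp: Mr)
    then show "1 / (8 * p) \<le> weight H e" "weight H e \<le> 4 / p"
      unfolding H(3)[OF that] using b by (auto simp only: of_nat_mult intro!: divide_right_mono)
  qed
  have wfH: "wf_weighted_graph H"
    unfolding wf_weighted_graph_def
  proof
    fix e assume "e \<in> edges H"
    then have "e \<in> F" "e \<in> E" using F H by (auto simp: E_def)
    then show "e \<subseteq> {0..<num_verts H} \<and> card e = 2 \<and> 0 \<le> weight H e"
      using E2[of e] H by (simp add: atLeast0LessThan)
  qed
  have Y: "850 \<le> \<epsilon> * (p * D)" using h1 kappa by linarith
  have pD: "850 \<le> p * D" 
  proof -
    have "\<epsilon> * (p * D) \<le> 1 * (p * D)" using eps p01 by (intro mult_right_mono) auto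
    then show ?thesis using Y by linarith
  qed
  have pDD: "p * D \<le> D" using p01 mult_right_mono[of p 1 "real D"] by simp
  have Dpos: "real D > 0" using pD pDD by linarith
  define \<eta> where "\<eta> = \<epsilon> / 100"
  have eta: "0 < \<eta>" "\<eta> < 1 / 100" using eps by (auto simp: \<eta>_def)
  have degH: "\<bar>weighted_degree H u - D\<bar> \<le> \<eta> * D" if u: "u < n" for u
  proof -
    have tt: "real (8 * n * D) = 8 * real M * p * real D" using p01 by (simp add: Mr)
    have near: "\<bar>real (weight_sum F w u) - real (8 * n * D)\<bar> \<le> 33 * M * \<kappa> + n + 1"
      using locally_optimal_near_regular[OF finE E2 _ _ _ _ tt M _ u, of F \<kappa> w] F deg good opt kappa
      by (auto simp: E_def M_def)
    have "weighted_degree H u = (\<Sum>e\<in>{e\<in>F. u \<in> e}. real (w e) / real (8 * n))"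
      unfolding weighted_degree_def H(2) by (intro sum.cong) (auto simp: H(3))
    then have "weighted_degree H u = real (weight_sum F w u) / (8 * n)"
      by (simp add: weight_sum_def sum_divide_distrib)
    then have "weighted_degree H u - D = (real (weight_sum F w u) - real (8 * n * D)) / (8 * n)"
      using n by (simp add: diff_divide_distrib)
    then have "\<bar>weighted_degree H u - D\<bar> = \<bar>real (weight_sum F w u) - real (8 * n * D)\<bar> / (8 * n)"
      by (simp add: abs_divide)
    also have "\<dots> \<le> (33 * M * \<kappa> + n + 1) / (8 * n)"
      using near by (intro divide_right_mono) auto
    \<comment> \<open>Here the factor \<open>n\<close> in \<open>M\<close> pays off: the search for
      a gap cost \<open>n + 1\<close>, which is at most \<open>2 * M\<close> and hence at most
      \<open>M * \<kappa>\<close>.\<close>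
    also have "\<dots> \<le> (34 * M * \<kappa>) / (8 * n)"
    proof (intro divide_right_mono)
      have "n \<le> M" by (simp add: M_def)
      then have "real n \<le> M" by linarith
      moreover have "real M * 2 \<le> M * \<kappa>" using kappa by (intro mult_left_mono) auto
      moreover have "real n \<ge> 1" using n by simp
      ultimately show "33 * M * \<kappa> + n + 1 \<le> 34 * M * \<kappa>" by linarith
    qed auto
    also have "\<dots> = 34 * \<kappa> / (8 * p)" using n by (simp add: Mr)
    also have "\<dots> \<le> \<eta> * D"
      using h1 p01 by (simp add: \<eta>_def field_simps)
    finally show ?thesis .
  qed
  have cutH: "\<gamma> * D / 64 * card S \<le> cut_weight H S" if S: "S \<subseteq> {..<n}" "2 * card S \<le> n" for S
  proof -
    \<comment> \<open>An indicator is a sign vector with support \<open>S\<close>, so the cut test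
      for it concerns \<open>S\<close> itself.\<close>
    define s :: "nat \<Rightarrow> real" where "s = (\<lambda>u. of_bool (u \<in> S))"
    have Z: "{u\<in>{..<n}. s u \<noteq> 0} = S" using S by (auto simp: s_def)
    have cS: "(\<Sum>u<n. \<bar>s u\<bar>) = card S"
    proof -
      have "(\<Sum>u<n. \<bar>s u\<bar>) = (\<Sum>u\<in>S. 1)"
        using S by (intro sum.mono_neutral_cong_right) (auto simp: s_def)
      then show ?thesis by simp
    qed
    have "cut_mass S F \<ge> p * cut_mass S E / 4 - \<kappa> * card S"
      using good[unfolded good_sample_def, rule_format, of s] unfolding Z cS E_def
      by (auto simp: s_def)
    moreover have "cut_mass S E \<ge> \<gamma> * D * card S"
      using cut_weight_expansion[OF expa, of S] S n unweighted_cut_mass[of G S] uw finE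
      by (simp add: E_def)
    then have "p * cut_mass S E \<ge> p * (\<gamma> * D * card S)" using p01 by (intro mult_left_mono) auto
    ultimately have "cut_mass S F \<ge> (\<gamma> * (p * D) / 4 - \<kappa>) * card S" by (simp add: algebra_simps)
    moreover have "(\<gamma> * (p * D) / 4 - \<kappa>) * card S \<ge> (\<gamma> * (p * D) / 8) * card S"
      using h2 by (intro mult_right_mono) auto
    ultimately have low: "cut_mass S F \<ge> (\<gamma> * (p * D) / 8) * card S" by linarith
    have "cut_mass S F = (\<Sum>e\<in>{e\<in>F. card (e \<inter> S) = 1}. 1)"
      unfolding cut_mass_def of_bool_def by (rule sum.inter_filter[symmetric, OF finF])
    then have "1 / (8 * p) * cut_mass S F = (\<Sum>e\<in>{e\<in>F. card (e \<inter> S) = 1}. 1 / (8 * p))" by simp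
    also have "\<dots> \<le> cut_weight H S"
      unfolding cut_weight_def H(2) using wH by (intro sum_mono) auto
    finally have "1 / (8 * p) * cut_mass S F \<le> cut_weight H S" .
    moreover have "1 / (8 * p) * ((\<gamma> * (p * D) / 8) * card S) \<le> 1 / (8 * p) * cut_mass S F"
      using low p01 by (intro mult_left_mono) auto
    moreover have "1 / (8 * p) * ((\<gamma> * (p * D) / 8) * card S) = \<gamma> * D / 64 * card S"
      using p01 by simp
    ultimately show ?thesis by linarith
  qed
  define \<Theta> where "\<Theta> = 2 / real D"
  have Theta: "\<Theta> > 0" using Dpos by (simp add: \<Theta>_def)
  have h3': "10 ^ 7 \<le> \<gamma>\<^sup>2 * (\<epsilon> * D)"
  proof -
    have "\<gamma>\<^sup>2 * (\<epsilon> * (p * D)) \<le> \<gamma>\<^sup>2 * (\<epsilon> * D)" using pDD eps by (intro mult_left_mono) auto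
    then show ?thesis using h3 by linarith
  qed
  have eD: "850 \<le> \<epsilon> * D"
    using Y pDD eps mult_left_mono[of "p * D" D \<epsilon>] by linarith
  have RG: "(1 - \<epsilon> / 100) * \<Theta> \<le> effective_resistance G u v"
    "effective_resistance G u v \<le> (1 + \<epsilon> / 100) * \<Theta>" if uv: "u < n" "v < n" "u \<noteq> v" for u v
  proof -
    have dG: "weighted_degree G i = D" if "i < n" for i
      using deg[OF that] uw by (simp add: weighted_degree_def unweighted_def)
    note b = effective_resistance_expander[OF wfG n(1) uv, of "real D" "real D" "\<gamma> * D" 1]
    have b1: "effective_resistance G u v \<ge> 2 / D - 2 * 1 / (real D)\<^sup>2"
      and b2: "effective_resistance G u v \<le> 2 / D * (1 + 4 * D * 1 / (\<gamma> * D)\<^sup>2)"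
      using b dG Dpos gamma cut_weight_expansion[OF expa] uw n by (auto simp: unweighted_def)
    have "2 / D - 2 * 1 / (real D)\<^sup>2 = (1 - 1 / D) * \<Theta>"
      using Dpos by (simp add: \<Theta>_def field_simps power2_eq_square)
    moreover have "1 / D \<le> \<epsilon> / 100" using eD Dpos by (simp add: field_simps)
    ultimately show "(1 - \<epsilon> / 100) * \<Theta> \<le> effective_resistance G u v"
      using b1 Theta mult_right_mono[of "1 - \<epsilon> / 100" "1 - 1 / D" \<Theta>] by linarith
    have "4 * D * 1 / (\<gamma> * D)\<^sup>2 = 4 / (\<gamma>\<^sup>2 * D)"
      using Dpos gamma by (simp add: field_simps power2_eq_square)
    also have "\<dots> \<le> \<epsilon> / 100" using h3' Dpos gamma by (simp add: field_simps)
    finally have "2 / D * (1 + 4 * D * 1 / (\<gamma> * D)\<^sup>2) \<le> (1 + \<epsilon> / 100) * \<Theta>"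
      using Theta by (simp add: \<Theta>_def mult_left_mono divide_right_mono)
    then show "effective_resistance G u v \<le> (1 + \<epsilon> / 100) * \<Theta>" using b2 by linarith
  qed
  have RH: "(1 - \<epsilon> / 25) * \<Theta> \<le> effective_resistance H u v"
    "effective_resistance H u v \<le> (1 + \<epsilon> / 25) * \<Theta>" if uv: "u < n" "v < n" "u \<noteq> v" for u v
  proof -
    define a where "a = (1 - \<eta>) * D"
    define c where "c = (1 + \<eta>) * D"
    have a: "a > 0" using eta Dpos by (simp add: a_def)
    have ac: "a \<le> weighted_degree H i" "weighted_degree H i \<le> c" if "i < n" for i
      using degH[OF that] by (auto simp: a_def c_def algebra_simps abs_le_iff)
    have phi: "\<gamma> * D / 64 > 0" using gamma Dpos by simp
    have wm: "weight H e \<le> 4 / p" if "e \<in> edges H" for e using wH that H by simp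
    have wm0: "4 / p \<ge> 0" using p01 by simp
    note b = effective_resistance_expander[OF wfH H(1) uv ac(1) a ac(2) phi cutH wm wm0]
    have pD0: "p * D > 0" using pD by linarith
    have q1: "1 / (1 + \<eta>) \<ge> 1 - \<eta>" using eta by (simp add: field_simps)
    have q2: "1 / (1 - \<eta>) \<le> 1 + 3 / 2 * \<eta>"
    proof -
      have "3 * (\<eta> * \<eta>) \<le> \<eta>" using eta mult_right_mono[of "3 * \<eta>" 1 \<eta>] by simp
      then show ?thesis using eta by (simp add: field_simps)
    qed
    have q3: "1 / (1 - \<eta>)\<^sup>2 \<le> 2"
    proof -
      have "1 / (1 - \<eta>) \<le> 102 / 100" using q2 eta by linarith
      then have "(1 / (1 - \<eta>))\<^sup>2 \<le> (102 / 100)\<^sup>2" using eta by (intro power_mono) auto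
      then show ?thesis by (simp add: power_divide power2_eq_square)
    qed
    have "2 * (4 / p) / a\<^sup>2 = (4 / (p * D)) * (1 / (1 - \<eta>)\<^sup>2) * \<Theta>"
      using p01 Dpos by (simp add: a_def \<Theta>_def power_mult_distrib power2_eq_square)
    also have "\<dots> \<le> (4 / (p * D)) * 2 * \<Theta>"
      using q3 pD0 Theta by (intro mult_right_mono mult_left_mono) auto
    also have "\<dots> \<le> \<eta> * \<Theta>"
      using Y pD0 Theta by (intro mult_right_mono) (auto simp: \<eta>_def field_simps)
    finally have s1: "2 * (4 / p) / a\<^sup>2 \<le> \<eta> * \<Theta>" .
    have "2 / c = 1 / (1 + \<eta>) * \<Theta>" by (simp add: c_def \<Theta>_def)
    also have "\<dots> \<ge> (1 - \<eta>) * \<Theta>" using q1 Theta by (intro mult_right_mono) auto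
    finally have "2 / c \<ge> (1 - \<eta>) * \<Theta>" .
    then have "(1 - 2 * \<eta>) * \<Theta> \<le> effective_resistance H u v"
      using b(1) s1 by (simp add: algebra_simps)
    moreover have "(1 - \<epsilon> / 25) * \<Theta> \<le> (1 - 2 * \<eta>) * \<Theta>"
      using Theta eps by (intro mult_right_mono) (auto simp: \<eta>_def)
    ultimately show "(1 - \<epsilon> / 25) * \<Theta> \<le> effective_resistance H u v" by linarith
    \<comment> \<open>65536 = 4 * 4 * 64^2, from the maximal weight \<open>4 / p\<close> and the
      square of the expansion constant 1 / 64.\<close>
    have "4 * c * (4 / p) / (\<gamma> * D / 64)\<^sup>2 = (1 + \<eta>) * (65536 / (\<gamma>\<^sup>2 * (p * D)))"
      using p01 Dpos gamma by (simp add: c_def power_mult_distrib power_divide power2_eq_square field_simps)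
    also have "\<dots> \<le> 2 * (65536 / (\<gamma>\<^sup>2 * (p * D)))"
      using eta gamma pD0 by (intro mult_right_mono) auto
    also have "\<dots> \<le> 3 / 2 * \<eta>"
      using h3 gamma pD0 p01 Dpos by (simp add: \<eta>_def field_simps)
    finally have s2: "1 + 4 * c * (4 / p) / (\<gamma> * D / 64)\<^sup>2 \<le> 1 + 3 / 2 * \<eta>" by simp
    have e1: "2 / a = 1 / (1 - \<eta>) * \<Theta>" by (simp add: a_def \<Theta>_def)
    have "2 / a * (1 + 4 * c * (4 / p) / (\<gamma> * D / 64)\<^sup>2) \<le> 2 / a * (1 + 3 / 2 * \<eta>)"
      using s2 a by (intro mult_left_mono) auto
    also have "\<dots> \<le> (1 + 3 / 2 * \<eta>) * \<Theta> * (1 + 3 / 2 * \<eta>)"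
      unfolding e1 using q2 Theta eta by (intro mult_right_mono) auto
    also have "\<dots> = ((1 + 3 / 2 * \<eta>) * (1 + 3 / 2 * \<eta>)) * \<Theta>" by simp
    also have "\<dots> \<le> (1 + \<epsilon> / 25) * \<Theta>"
    proof (intro mult_right_mono)
      have "9 / 4 * (\<eta> * \<eta>) \<le> \<eta>" using eta mult_right_mono[of "9 / 4 * \<eta>" 1 \<eta>] by simp
      moreover have "(1 + 3 / 2 * \<eta>) * (1 + 3 / 2 * \<eta>) = 1 + 3 * \<eta> + 9 / 4 * (\<eta> * \<eta>)"
        by (simp add: algebra_simps)
      moreover have "\<epsilon> / 25 = 4 * \<eta>" by (simp add: \<eta>_def)
      ultimately show "(1 + 3 / 2 * \<eta>) * (1 + 3 / 2 * \<eta>) \<le> 1 + \<epsilon> / 25" by linarith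
    qed (use Theta in simp)
    finally show "effective_resistance H u v \<le> (1 + \<epsilon> / 25) * \<Theta>" using b(2) by linarith
  qed
  show ?thesis unfolding resistance_sparsifier_def n(1)
  proof (intro conjI allI impI)
    show "reweighted_subgraph H G" using wfH H n F by (simp add: reweighted_subgraph_def)
  next
    fix u v assume uv: "u < n" "v < n"
    show "(1 - \<epsilon>) * effective_resistance H u v \<le> effective_resistance G u v"
      using ratio_transfer(1)[OF eps Theta RG RH] uv effective_resistance_self[of u] n H
      by (cases "u = v") auto
    show "effective_resistance G u v \<le> (1 + \<epsilon>) * effective_resistance H u v"
      using ratio_transfer(2)[OF eps Theta RG RH] uv effective_resistance_self[of u] n H
      by (cases "u = v") auto
  qed
qed

text \<open>An edge has mass 2 for the all-ones vector, so the upper tail of \<open>pos_mass\<close>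
  also limits the number of sampled edges.\<close>

lemma good_sample_card_le:
  assumes reg: "regular_graph D G" and n: "num_verts G = n"
    and good: "good_sample n (edges G) p \<kappa> F" and F: "F \<subseteq> edges G"
  shows "2 * real (card F) \<le> n * (8 * p * D + \<kappa>)"
proof -
  have wf: "wf_weighted_graph G" and deg: "\<And>u. u < n \<Longrightarrow> card {e\<in>edges G. u \<in> e} = D"
    using reg n by (auto simp: regular_graph_def)
  have two: "(\<Sum>u\<in>e. 1::real) = 2" if "e \<in> edges G" for e
    using wf that by (auto simp: wf_weighted_graph_def)
  have pm: "pos_mass (\<lambda>_. 1) X = 2 * card X" if "X \<subseteq> edges G" for X
  proof -
    have "pos_mass (\<lambda>_. 1) X = (\<Sum>e\<in>X. 2)"
      unfolding pos_mass_def using that two by (intro sum.cong refl) (metis subsetD max_def zero_le_numeral)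
    then show ?thesis by simp
  qed
  have "(\<Sum>e\<in>edges G. 1 * (\<Sum>u\<in>e. 1::real)) = (\<Sum>u<n. 1 * (\<Sum>e\<in>{e\<in>edges G. u \<in> e}. 1))"
    using wf n by (intro sum_edges_vertices finite_edges) (auto simp: wf_weighted_graph_def atLeast0LessThan)
  also have "\<dots> = n * real D" using deg by simp
  finally have "2 * real (card (edges G)) = n * D" using two by simp
  then have "pos_mass (\<lambda>_. 1) (edges G) = n * D" using pm[of "edges G"] by simp
  moreover have "pos_mass (\<lambda>_. 1) F \<le> 8 * (p * pos_mass (\<lambda>_. 1) (edges G)) + \<kappa> * n"
    using good[unfolded good_sample_def, rule_format, of "\<lambda>_. 1"] by simp
  ultimately show ?thesis using pm[OF F] by (simp add: algebra_simps)
qed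

section \<open>A cost calculus for programs\<close>

fun expr_nodes :: "expr \<Rightarrow> nat" where
  "expr_nodes (Const c) = 1"
| "expr_nodes (Read a i) = 1 + expr_nodes i"
| "expr_nodes (Add x y) = 1 + expr_nodes x + expr_nodes y"
| "expr_nodes (Sub x y) = 1 + expr_nodes x + expr_nodes y"
| "expr_nodes (Mul x y) = 1 + expr_nodes x + expr_nodes y"
| "expr_nodes (Div x y) = 1 + expr_nodes x + expr_nodes y"

fun consts_le :: "nat \<Rightarrow> expr \<Rightarrow> bool" where
  "consts_le B (Const c) = (c \<le> B)"
| "consts_le B (Read a i) = consts_le B i"
| "consts_le B (Add x y) = (consts_le B x \<and> consts_le B y)"
| "consts_le B (Sub x y) = (consts_le B x \<and> consts_le B y)"
| "consts_le B (Mul x y) = (consts_le B x \<and> consts_le B y)"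
| "consts_le B (Div x y) = (consts_le B x \<and> consts_le B y)"

definition store_le :: "nat \<Rightarrow> store \<Rightarrow> bool" where
  "store_le B s \<longleftrightarrow> (\<forall>a i. s a i \<le> B)"

lemma expr_nodes_pos: "expr_nodes e \<ge> 1"
  by (cases e) auto

text \<open>Each operation at most multiplies the bounds of its arguments. For addition the extra
  node supplies a factor \<open>B \<ge> 2\<close>, and \<open>X + Y \<le> 2 * (X * Y)\<close>. Bit
  lengths therefore grow only linearly with the size of the expression.\<close>

lemma expr_val_le:
  assumes "store_le B s" "B \<ge> 2" "consts_le B e"
  shows "expr_val e s \<le> B ^ expr_nodes e"
  using assms(3)
proof (induction e)
  case (Const c)
  then show ?case by simp
next
  case (Read a i)
  have "s a (expr_val i s) \<le> B ^ 1" using assms(1) by (simp add: store_le_def)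
  also have "\<dots> \<le> B ^ expr_nodes (Read a i)" using assms(2) by (intro power_increasing) auto
  finally show ?case by simp
next
  case (Add x y)
  have p: "B ^ 1 \<le> B ^ expr_nodes z" for z
    using assms(2) expr_nodes_pos[of z] by (intro power_increasing) auto
  define X where "X = B ^ expr_nodes x"
  define Y where "Y = B ^ expr_nodes y"
  have XY: "X \<ge> 2" "Y \<ge> 2" using p[of x] p[of y] assms(2) by (auto simp: X_def Y_def)
  have "expr_val x s + expr_val y s \<le> X + Y" using Add by (simp add: X_def Y_def)
  also have "\<dots> \<le> X * Y + Y * X" using XY by (intro add_mono) auto
  also have "\<dots> = 2 * (X * Y)" by simp
  also have "\<dots> \<le> B * (X * Y)" by (rule mult_le_mono1[OF assms(2)])
  finally show ?case by (simp add: X_def Y_def power_add)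
next
  case (Sub x y)
  have "expr_val x s - expr_val y s \<le> B ^ expr_nodes x" using Sub by fastforce
  also have "\<dots> \<le> B ^ expr_nodes (Sub x y)" using assms(2) by (intro power_increasing) auto
  finally show ?case by simp
next
  case (Mul x y)
  have "expr_val x s * expr_val y s \<le> B ^ expr_nodes x * B ^ expr_nodes y"
    using Mul by (intro mult_mono) auto
  also have "\<dots> = B ^ (expr_nodes x + expr_nodes y)" by (simp add: power_add)
  also have "\<dots> \<le> B ^ expr_nodes (Mul x y)" using assms(2) by (intro power_increasing) auto
  finally show ?case by simp
next
  case (Div x y)
  have "expr_val x s div expr_val y s \<le> expr_val x s" by (rule div_le_dividend)
  also have "\<dots> \<le> B ^ expr_nodes x" using Div by simp
  also have "\<dots> \<le> B ^ expr_nodes (Div x y)" using assms(2) by (intro power_increasing) auto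
  finally show ?case by simp
qed

lemma expr_cost_le:
  assumes s: "store_le (2 ^ b) s" and b: "b \<ge> 1" and e: "consts_le (2 ^ b) e" "expr_nodes e \<le> m"
  shows "expr_cost e s \<le> expr_nodes e * (b * m + 2)"
proof -
  have B: "(2::nat) \<le> 2 ^ b" using b power_increasing[of 1 b "2::nat"] by simp
  have fl: "floorlog 2 (expr_val e s) \<le> b * m + 1" if "consts_le (2 ^ b) e" "expr_nodes e \<le> m" for e
  proof -
    have "expr_val e s \<le> (2 ^ b) ^ expr_nodes e" by (rule expr_val_le[OF s B that(1)])
    also have "\<dots> \<le> (2 ^ b) ^ m" using that(2) B by (intro power_increasing) auto
    also have "\<dots> < 2 ^ (b * m + 1)" by (simp add: power_mult)
    finally show ?thesis by (intro floorlog_leI) auto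
  qed
  show ?thesis using e
  proof (induction e)
    case (Const c)
    show ?case using fl[OF Const] by simp
  next
    case (Read a i)
    show ?case using fl[OF Read.prems] Read by simp
  next
    case (Add x y)
    show ?case using fl[OF Add.prems] Add by (simp add: algebra_simps)
  next
    case (Sub x y)
    show ?case using fl[OF Sub.prems] Sub by (simp add: algebra_simps)
  next
    case (Mul x y)
    show ?case using fl[OF Mul.prems] Mul by (simp add: algebra_simps)
  next
    case (Div x y)
    show ?case using fl[OF Div.prems] Div by (simp add: algebra_simps)
  qed
qed

text \<open>Uniform limits obeyed by all expressions of the program, so that a single
  \<open>step_cost\<close> serves every command. The constant 32 comes from the weight limit
  \<open>32 * M\<close>.\<close>

definition simple_expr :: "expr \<Rightarrow> bool" where
  "simple_expr e \<longleftrightarrow> consts_le 32 e \<and> expr_nodes e \<le> 40"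

fun simple_prog :: "prog \<Rightarrow> bool" where
  "simple_prog Skip = True"
| "simple_prog (Assign a i x) = (simple_expr i \<and> simple_expr x)"
| "simple_prog (Flip a i) = simple_expr i"
| "simple_prog (Seq c d) = (simple_prog c \<and> simple_prog d)"
| "simple_prog (If x c d) = (simple_expr x \<and> simple_prog c \<and> simple_prog d)"
| "simple_prog (While x c) = (simple_expr x \<and> simple_prog c)"

text \<open>Simple expressions have at most 40 nodes and a value of at most \<open>2 ^ (40 * b)\<close>; a command
  evaluates at most two of them.\<close>

definition step_cost :: "nat \<Rightarrow> nat" where
  "step_cost b = 81 * (40 * b + 2)"

lemma consts_le_mono: "consts_le B e \<Longrightarrow> B \<le> B' \<Longrightarrow> consts_le B' e"
  by (induction e) auto

lemma simple_expr_cost: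
  assumes "simple_expr e" "store_le (2 ^ b) s" "b \<ge> 5"
  shows "expr_cost e s \<le> 40 * (40 * b + 2)"
proof -
  have "(2::nat) ^ 5 \<le> 2 ^ b" using assms(3) by (intro power_increasing) auto
  then have "consts_le (2 ^ b) e" using assms(1) consts_le_mono[of 32 e "2 ^ b"] by (simp add: simple_expr_def)
  then have "expr_cost e s \<le> expr_nodes e * (b * 40 + 2)"
    using assms by (intro expr_cost_le) (auto simp: simple_expr_def)
  also have "\<dots> \<le> 40 * (40 * b + 2)"
    using assms(1) by (intro mult_mono) (auto simp: simple_expr_def)
  finally show ?thesis .
qed

text \<open>Total correctness with a budget of \<open>N\<close> units of \<open>step_cost\<close>.
  The bound on the store is part of the judgement: it limits the cost of each expression and has to
  survive each command.\<close>

definition wp :: "nat \<Rightarrow> nat \<Rightarrow> prog \<Rightarrow> (store \<Rightarrow> bool list \<Rightarrow> bool) \<Rightarrow> store \<Rightarrow> bool list \<Rightarrow> bool" where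
  "wp b N c Q s r \<longleftrightarrow> (store_le (2 ^ b) s \<longrightarrow>
     (\<exists>t s' r'. exec c s r t s' r' \<and> store_le (2 ^ b) s' \<and> t \<le> N * step_cost b \<and> Q s' r'))"

lemma wp_mono:
  assumes "wp b N c Q s r" "\<And>s r. Q s r \<Longrightarrow> Q' s r" "N \<le> N'"
  shows "wp b N' c Q' s r"
proof -
  have "N * step_cost b \<le> N' * step_cost b" using assms(3) by (rule mult_right_mono) simp
  then show ?thesis using assms(1,2) unfolding wp_def by (meson order_trans)
qed

lemma wp_Seq:
  assumes "wp b N c (wp b N' d Q) s r"
  shows "wp b (1 + N + N') (Seq c d) Q s r"
  unfolding wp_def
proof
  assume "store_le (2 ^ b) s"
  then obtain t s1 r1 where 1: "exec c s r t s1 r1" "store_le (2 ^ b) s1" "t \<le> N * step_cost b" "wp b N' d Q s1 r1"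
    using assms unfolding wp_def by blast
  then obtain t' s2 r2 where 2: "exec d s1 r1 t' s2 r2" "store_le (2 ^ b) s2" "t' \<le> N' * step_cost b" "Q s2 r2"
    unfolding wp_def by blast
  have "1 + t + t' \<le> (1 + N + N') * step_cost b"
    using 1 2 by (simp add: algebra_simps step_cost_def)
  then show "\<exists>t s' r'. exec (Seq c d) s r t s' r' \<and> store_le (2 ^ b) s' \<and> t \<le> (1 + N + N') * step_cost b \<and> Q s' r'"
    using exec_Seq[OF 1(1) 2(1)] 2 by blast
qed

text \<open>The index \<open>m\<close> of the invariant bounds the number of remaining rounds, since
  each round must return with a smaller index. A round pays \<open>N\<close> for the body and one
  unit for the guard; the \<open>+ 1\<close> in \<open>m + 1\<close> covers the last, failing
  guard.\<close>

lemma wp_While: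
  assumes step: "\<And>m s r. I m s r \<Longrightarrow> expr_val x s \<noteq> 0 \<Longrightarrow> wp b N c (\<lambda>s r. \<exists>m'<m. I m' s r) s r"
    and exit: "\<And>m s r. I m s r \<Longrightarrow> expr_val x s = 0 \<Longrightarrow> Q s r"
    and init: "I m s r" and x: "simple_expr x" and b: "b \<ge> 5"
  shows "wp b ((m + 1) * (N + 1)) (While x c) Q s r"
  using init
proof (induction m arbitrary: s r rule: less_induct)
  case (less m)
  show ?case unfolding wp_def
  proof
    assume st: "store_le (2 ^ b) s"
    have c: "1 + expr_cost x s \<le> step_cost b"
      using simple_expr_cost[OF x st b] by (simp add: step_cost_def)
    show "\<exists>t s' r'. exec (While x c) s r t s' r' \<and> store_le (2 ^ b) s' \<and> t \<le> (m + 1) * (N + 1) * step_cost b \<and> Q s' r'"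
    proof (cases "expr_val x s = 0")
      case True
      have "1 * step_cost b \<le> (m + 1) * (N + 1) * step_cost b" by (intro mult_right_mono) auto
      then show ?thesis
        using exec_WhileFalse[OF True] st exit[OF less.prems True] c by (metis mult_1 order_trans)
    next
      case False
      from step[OF less.prems False] st obtain t1 s1 r1 m' where
        1: "exec c s r t1 s1 r1" "store_le (2 ^ b) s1" "t1 \<le> N * step_cost b" "m' < m" "I m' s1 r1"
        unfolding wp_def by blast
      from less.IH[OF 1(4,5)] 1(2) obtain t2 s2 r2 where
        2: "exec (While x c) s1 r1 t2 s2 r2" "store_le (2 ^ b) s2"
          "t2 \<le> (m' + 1) * (N + 1) * step_cost b" "Q s2 r2"
        unfolding wp_def by blast
      have "(m' + 1) * ((N + 1) * step_cost b) \<le> m * ((N + 1) * step_cost b)"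
        using 1(4) by (intro mult_right_mono) auto
      then have "1 + expr_cost x s + t1 + t2 \<le> (m + 1) * (N + 1) * step_cost b"
        using c 1(3) 2(3) by (simp add: algebra_simps)
      then show ?thesis using exec_WhileTrue[OF False 1(1) 2(1)] 2 by blast
    qed
  qed
qed

fun prog_steps :: "prog \<Rightarrow> nat" where
  "prog_steps Skip = 1"
| "prog_steps (Assign a i x) = 1"
| "prog_steps (Flip a i) = 1"
| "prog_steps (Seq c d) = 1 + prog_steps c + prog_steps d"
| "prog_steps (If x c d) = 1 + prog_steps c + prog_steps d"
| "prog_steps (While x c) = 1 + prog_steps c"

text \<open>Verification conditions that the simplifier unfolds on loop-free code.
  \<open>While\<close> yields \<open>False\<close>, so loops have to go through
  \<open>wp_While\<close>; the bound in the \<open>Assign\<close> clause keeps the store below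
  \<open>2 ^ b\<close>.\<close>

fun vc :: "nat \<Rightarrow> prog \<Rightarrow> (store \<Rightarrow> bool list \<Rightarrow> bool) \<Rightarrow> store \<Rightarrow> bool list \<Rightarrow> bool" where
  "vc b Skip Q s r = Q s r"
| "vc b (Assign a i x) Q s r =
     (expr_val x s \<le> 2 ^ b \<and> Q (store_upd s a (expr_val i s) (expr_val x s)) r)"
| "vc b (Flip a i) Q s r =
     (r \<noteq> [] \<and> Q (store_upd s a (expr_val i s) (of_bool (hd r))) (tl r))"
| "vc b (Seq c d) Q s r = vc b c (vc b d Q) s r"
| "vc b (If x c d) Q s r = (if expr_val x s \<noteq> 0 then vc b c Q s r else vc b d Q s r)"
| "vc b (While x c) Q s r = False"

lemma vc_mono: "vc b c Q s r \<Longrightarrow> (\<And>s r. Q s r \<Longrightarrow> Q' s r) \<Longrightarrow> vc b c Q' s r"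
proof (induction c arbitrary: Q Q' s r)
  case (Seq c d)
  then show ?case by (metis vc.simps(4))
qed (auto split: if_splits)

lemma wp_vc:
  assumes "vc b c Q s r" "simple_prog c" "b \<ge> 5"
  shows "wp b (prog_steps c) c Q s r"
  using assms(1,2)
proof (induction c arbitrary: Q s r)
  case Skip
  then have "exec Skip s r 1 s r \<and> 1 \<le> prog_steps Skip * step_cost b \<and> Q s r"
    using exec_Skip by (simp add: step_cost_def)
  then show ?case unfolding wp_def by blast
next
  case (Assign a i x)
  show ?case unfolding wp_def
  proof
    assume st: "store_le (2 ^ b) s"
    have "1 + expr_cost i s + expr_cost x s \<le> prog_steps (Assign a i x) * step_cost b"
      using simple_expr_cost[OF _ st assms(3), of i] simple_expr_cost[OF _ st assms(3), of x] Assign.prems(2)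
      by (simp add: step_cost_def)
    moreover have "store_le (2 ^ b) (store_upd s a (expr_val i s) (expr_val x s))"
      using st Assign.prems(1) by (auto simp: store_le_def store_upd_def)
    ultimately show "\<exists>t s' r'. exec (Assign a i x) s r t s' r' \<and> store_le (2 ^ b) s' \<and>
        t \<le> prog_steps (Assign a i x) * step_cost b \<and> Q s' r'"
      using exec_Assign[of a i x s r] Assign.prems(1) unfolding vc.simps by blast
  qed
next
  case (Flip a i)
  show ?case unfolding wp_def
  proof
    assume st: "store_le (2 ^ b) s"
    have "1 + expr_cost i s \<le> prog_steps (Flip a i) * step_cost b"
      using simple_expr_cost[OF _ st assms(3), of i] Flip.prems(2)
      by (simp add: step_cost_def)
    moreover have "store_le (2 ^ b) (store_upd s a (expr_val i s) (of_bool (hd r)))"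
      using st by (auto simp: store_le_def store_upd_def)
    moreover have "r = hd r # tl r" using Flip.prems(1) by simp
    then have "exec (Flip a i) s r (1 + expr_cost i s) (store_upd s a (expr_val i s) (of_bool (hd r))) (tl r)"
      by (metis exec_Flip)
    ultimately show "\<exists>t s' r'. exec (Flip a i) s r t s' r' \<and> store_le (2 ^ b) s' \<and>
        t \<le> prog_steps (Flip a i) * step_cost b \<and> Q s' r'"
      using Flip.prems(1) unfolding vc.simps by blast
  qed
next
  case (Seq c d)
  have "wp b (prog_steps c) c (vc b d Q) s r" using Seq by simp
  then have "wp b (prog_steps c) c (wp b (prog_steps d) d Q) s r"
    by (rule wp_mono) (use Seq in auto)
  then show ?case using wp_Seq by simp
next
  case (If x c d)
  have *: "wp b (prog_steps c) c Q s r" if "expr_val x s \<noteq> 0"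
    using If that by simp
  have **: "wp b (prog_steps d) d Q s r" if "expr_val x s = 0"
    using If that by simp
  show ?case unfolding wp_def
  proof
    assume st: "store_le (2 ^ b) s"
    have g: "1 + expr_cost x s \<le> step_cost b"
      using simple_expr_cost[OF _ st assms(3), of x] If.prems(2) by (simp add: step_cost_def)
    show "\<exists>t s' r'. exec (If x c d) s r t s' r' \<and> store_le (2 ^ b) s' \<and>
        t \<le> prog_steps (If x c d) * step_cost b \<and> Q s' r'"
    proof (cases "expr_val x s = 0")
      case True
      with ** st obtain t s' r' where e: "exec d s r t s' r'" "store_le (2 ^ b) s'"
        "t \<le> prog_steps d * step_cost b" "Q s' r'" unfolding wp_def by blast
      have "1 + expr_cost x s + t \<le> prog_steps (If x c d) * step_cost b"
        using g e(3) by (simp add: algebra_simps)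
      then show ?thesis using exec_IfFalse[OF True e(1)] e by blast
    next
      case False
      with * st obtain t s' r' where e: "exec c s r t s' r'" "store_le (2 ^ b) s'"
        "t \<le> prog_steps c * step_cost b" "Q s' r'" unfolding wp_def by blast
      have "1 + expr_cost x s + t \<le> prog_steps (If x c d) * step_cost b"
        using g e(3) by (simp add: algebra_simps)
      then show ?thesis using exec_IfTrue[OF False e(1)] e by blast
    qed
  qed
next
  case (While x c)
  then show ?case by simp
qed

section \<open>The sparsification program\<close>

fun block :: "prog list \<Rightarrow> prog" where
  "block [] = Skip"
| "block (c # cs) = Seq c (block cs)"

abbreviation var :: "string \<Rightarrow> expr" where "var a \<equiv> Read a (Const 0)"
abbreviation assign :: "string \<Rightarrow> expr \<Rightarrow> prog" where "assign a \<equiv> Assign a (Const 0)"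

definition log_body :: prog where
  "log_body = block [assign ''z'' (Mul (Const 2) (var ''z'')), assign ''L'' (Add (var ''L'') (Const 1))]"

text \<open>Subtraction is truncated, so a difference is a nonzero guard exactly if it is positive;
  this one reads \<open>z \<le> n\<close>. Comparisons are encoded in this way throughout the
  program.\<close>

definition log_guard :: expr where
  "log_guard = Sub (Add (var ''n'') (Const 1)) (var ''z'')"

definition rate_body :: prog where
  "rate_body = block [assign ''y'' (Mul (Const 2) (var ''y'')), assign ''k'' (Add (var ''k'') (Const 1))]"

text \<open>With the denominator \<open>q\<close> cleared, the exponent grows while
  \<open>2 * 2 ^ k * L\<^sup>2 \<le> (p / q) * n\<close>. The loop ends with \<open>2 ^ k\<close>
  within a factor 2 of \<open>(p / q) * n / L\<^sup>2\<close>.\<close>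

definition rate_guard :: expr where
  "rate_guard = Sub (Add (Mul (var ''p'') (var ''n'')) (Const 1))
     (Mul (Mul (Const 2) (var ''y'')) (Mul (Mul (var ''L'') (var ''L'')) (var ''q'')))"

definition params_prog :: prog where
  "params_prog =
     Seq (assign ''z'' (Const 1)) (Seq (While log_guard log_body)
    (Seq (assign ''y'' (Const 1)) (Seq (While rate_guard rate_body)
         (assign ''M'' (Mul (var ''y'') (var ''n''))))))"

text \<open>All \<open>k\<close> bits are drawn even if \<open>b\<close> is already 0 or the pair is
  no edge, so pair \<open>i\<close> always reads its own block of the tape.\<close>

definition flip_body :: prog where
  "flip_body = block [Flip ''f'' (Const 0), assign ''b'' (Mul (var ''b'') (var ''f'')),
     assign ''l'' (Add (var ''l'') (Const 1))]"

definition flip_guard :: expr where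
  "flip_guard = Sub (var ''k'') (var ''l'')"

definition pair_setup :: prog where
  "pair_setup = block [assign ''u'' (Div (var ''i'') (var ''n'')),
     assign ''v'' (Sub (var ''i'') (Mul (var ''u'') (var ''n'')))]"

text \<open>The nested subtraction is the indicator of \<open>u < v\<close>, so an edge is sampled
  once although the matrix lists it twice. \<open>T\<close> sums all matrix entries,
  \<open>n * D\<close> in total; this yields the target although \<open>D\<close> is not part of the
  input.\<close>

definition sample_pre :: prog where
  "sample_pre = Seq pair_setup (block [
     assign ''b'' (Mul (Read ''adj'' (var ''i'')) (Sub (Const 1) (Sub (Const 1) (Sub (var ''v'') (var ''u''))))),
     assign ''T'' (Add (var ''T'') (Read ''adj'' (var ''i''))),
     assign ''l'' (Const 0)])"

definition sample_post :: prog where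
  "sample_post = block [
     Assign ''edge'' (var ''i'') (var ''b''),
     Assign ''num'' (var ''i'') (Mul (var ''b'') (var ''M'')),
     Assign ''den'' (var ''i'') (Mul (Const 8) (var ''n'')),
     Assign ''x'' (var ''u'') (Add (Read ''x'' (var ''u'')) (Mul (var ''b'') (var ''M''))),
     Assign ''x'' (var ''v'') (Add (Read ''x'' (var ''v'')) (Mul (var ''b'') (var ''M''))),
     assign ''i'' (Add (var ''i'') (Const 1))]"

definition pair_guard :: expr where
  "pair_guard = Sub (Mul (var ''n'') (var ''n'')) (var ''i'')"

definition sample_body :: prog where
  "sample_body = Seq sample_pre (Seq (While flip_guard flip_body) sample_post)"

definition sample_prog :: prog where
  "sample_prog = Seq (assign ''i'' (Const 0)) (While pair_guard sample_body)"

text \<open>A product serves as conjunction: the pair is sampled, its degrees exceed the target by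
  at least 2 in total, and its weight may still shrink.\<close>

definition dec_guard :: expr where
  "dec_guard = Mul (Mul (Read ''edge'' (var ''i''))
     (Sub (Add (Read ''x'' (var ''u'')) (Read ''x'' (var ''v''))) (Add (Mul (Const 2) (var ''t'')) (Const 1))))
     (Sub (Read ''num'' (var ''i'')) (var ''M''))"

definition inc_guard :: expr where
  "inc_guard = Mul (Mul (Read ''edge'' (var ''i''))
     (Sub (Mul (Const 2) (var ''t'')) (Add (Add (Read ''x'' (var ''u'')) (Read ''x'' (var ''v''))) (Const 1))))
     (Sub (Mul (Const 32) (var ''M'')) (Read ''num'' (var ''i'')))"

definition dec_prog :: prog where
  "dec_prog = block [
     Assign ''num'' (var ''i'') (Sub (Read ''num'' (var ''i'')) (Const 1)),
     Assign ''x'' (var ''u'') (Sub (Read ''x'' (var ''u'')) (Const 1)),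
     Assign ''x'' (var ''v'') (Sub (Read ''x'' (var ''v'')) (Const 1)),
     assign ''g'' (Const 1)]"

definition inc_prog :: prog where
  "inc_prog = block [
     Assign ''num'' (var ''i'') (Add (Read ''num'' (var ''i'')) (Const 1)),
     Assign ''x'' (var ''u'') (Add (Read ''x'' (var ''u'')) (Const 1)),
     Assign ''x'' (var ''v'') (Add (Read ''x'' (var ''v'')) (Const 1)),
     assign ''g'' (Const 1)]"

definition adjust_body :: prog where
  "adjust_body = Seq pair_setup (Seq (If dec_guard dec_prog (If inc_guard inc_prog Skip))
     (assign ''i'' (Add (var ''i'') (Const 1))))"

text \<open>\<open>g\<close> records whether the sweep has changed a weight. A sweep that ends with
  \<open>g\<close> equal to 0 has examined all pairs under the same weights, which certifies local
  optimality.\<close>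

definition sweep_prog :: prog where
  "sweep_prog = Seq (block [assign ''g'' (Const 0), assign ''i'' (Const 0)]) (While pair_guard adjust_body)"

definition search_prog :: prog where
  "search_prog = Seq (block [assign ''t'' (Mul (Const 8) (var ''T'')), assign ''g'' (Const 1)])
     (While (var ''g'') sweep_prog)"

definition sparsify_prog :: prog where
  "sparsify_prog = Seq params_prog (Seq sample_prog search_prog)"

lemma wp_vcI:
  assumes "vc b c Q s r" "b \<ge> 5" "simple_prog c" "prog_steps c \<le> N"
  shows "wp b N c Q s r"
  using wp_mono[OF wp_vc[OF assms(1,3,2)] _ assms(4)] .

section \<open>Choice of the sampling rate by the program\<close>

text \<open>\<open>b\<close> is fitted to the largest values computed: a degree is a sum of at most
  \<open>n * n\<close> weights, each at most \<open>32 * (n * n)\<close>. The assumption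
  \<open>start\<close> says that the rate loop may begin at \<open>k = 0\<close>.\<close>

locale sparsify_run =
  fixes n p q b :: nat and adj :: "nat \<Rightarrow> nat"
  assumes n: "n > 0" and pq: "p < q"
    and b: "b \<ge> 5" "32 * n ^ 4 \<le> 2 ^ b"
    and adj: "\<And>j. adj j \<le> 1"
    and start: "\<And>L. n < 2 ^ L \<Longrightarrow> 2 ^ L \<le> 2 * n \<Longrightarrow> L * L * q \<le> p * n"
begin

text \<open>\<open>x\<close> and \<open>T\<close> are accumulated without being cleared, so they
  rely on the default 0 of the input store.\<close>

definition base :: "store \<Rightarrow> bool" where
  "base s \<longleftrightarrow> s ''n'' 0 = n \<and> s ''p'' 0 = p \<and> s ''q'' 0 = q \<and> s ''adj'' = adj \<and>
     s ''x'' = (\<lambda>_. 0) \<and> s ''T'' 0 = 0"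

definition params :: "store \<Rightarrow> nat \<Rightarrow> bool" where
  "params s k \<longleftrightarrow> s ''k'' 0 = k \<and> s ''M'' 0 = 2 ^ k * n \<and> 2 ^ k \<le> n \<and>
     (\<exists>L. n < 2 ^ L \<and> 2 ^ L \<le> 2 * n \<and> 2 ^ k * (L * L) * q \<le> p * n \<and> p * n < 2 * 2 ^ k * (L * L) * q)"

lemma n_bounds: "32 * n \<le> 2 ^ b" "32 * n ^ 2 \<le> 2 ^ b" "32 * (n * n) \<le> 2 ^ b" "32 \<le> (2::nat) ^ b"
proof -
  have "n ^ 1 \<le> n ^ 4" "n ^ 2 \<le> n ^ 4" "n ^ 0 \<le> n ^ 4" using n by (intro power_increasing; simp)+
  then show "32 * n \<le> 2 ^ b" "32 * n ^ 2 \<le> 2 ^ b" "32 * (n * n) \<le> 2 ^ b" "32 \<le> (2::nat) ^ b"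
    using b(2) by (auto simp: power2_eq_square)
qed

lemma params_prog_wp:
  assumes s: "base s" "s ''L'' 0 = 0" "s ''k'' 0 = 0"
  shows "wp b (50 * (n + 2)) params_prog (\<lambda>s r'. base s \<and> (\<exists>k. params s k) \<and> r' = r) s r"
proof -
  define I where "I = (\<lambda>m (s::store) r'. base s \<and> s ''k'' 0 = 0 \<and> s ''z'' 0 = 2 ^ s ''L'' 0 \<and>
    2 ^ s ''L'' 0 \<le> 2 * n \<and> m = n + 1 - 2 ^ s ''L'' 0 \<and> r' = r)"
  define J where "J = (\<lambda>m (s::store) r'. base s \<and> (\<exists>k L. s ''L'' 0 = L \<and> n < 2 ^ L \<and> 2 ^ L \<le> 2 * n \<and>
    s ''k'' 0 = k \<and> s ''y'' 0 = 2 ^ k \<and> 2 ^ k \<le> n \<and> 2 ^ k * (L * L) * q \<le> p * n \<and> m = n - 2 ^ k) \<and> r' = r)"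
  define Q1 where "Q1 = (\<lambda>(s::store) r'. base s \<and> s ''k'' 0 = 0 \<and> n < 2 ^ s ''L'' 0 \<and> 2 ^ s ''L'' 0 \<le> 2 * n \<and> r' = r)"
  define Q2 where "Q2 = (\<lambda>(s::store) r'. base s \<and> (\<exists>k L. n < 2 ^ L \<and> 2 ^ L \<le> 2 * n \<and>
    s ''k'' 0 = k \<and> s ''y'' 0 = 2 ^ k \<and> 2 ^ k \<le> n \<and> 2 ^ k * (L * L) * q \<le> p * n \<and>
    p * n < 2 * 2 ^ k * (L * L) * q) \<and> r' = r)"
  define Q where "Q = (\<lambda>s r'. base s \<and> (\<exists>k. params s k) \<and> r' = r)"
  have self_less: "m < (2::nat) ^ m" for m by (rule less_exp)
  have w1: "wp b ((n + 1) * (5 + 1)) (While log_guard log_body) Q1 s r" if "I m s r" for s m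
  proof -
    have "wp b ((m + 1) * (5 + 1)) (While log_guard log_body) Q1 s r"
    proof (rule wp_While[where I = I])
      fix m s r' assume I: "I m s r'" and g: "expr_val log_guard s \<noteq> 0"
      have "2 ^ s ''L'' 0 \<le> n" "s ''L'' 0 < 2 ^ s ''L'' 0"
        using g I self_less by (auto simp: I_def log_guard_def base_def)
      moreover have "(0::nat) < 2 ^ s ''L'' 0" by simp
      ultimately have "Suc (s ''L'' 0) \<le> 2 ^ b" "Suc n - 2 * 2 ^ s ''L'' 0 < Suc n - 2 ^ s ''L'' 0"
        "2 * 2 ^ s ''L'' 0 \<le> 2 * n" "2 * n \<le> 2 ^ b"
        using n_bounds(1) by linarith+
      then have "vc b log_body (\<lambda>s r. \<exists>m'<m. I m' s r) s r'"
        using I by (auto simp: log_body_def I_def base_def store_upd_def)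
      then show "wp b 5 log_body (\<lambda>s r. \<exists>m'<m. I m' s r) s r'"
        by (rule wp_vcI) (use b in \<open>auto simp: log_body_def simple_expr_def\<close>)
    next
      fix m s r' assume "I m s r'" "expr_val log_guard s = 0"
      then show "Q1 s r'" by (auto simp: I_def Q1_def log_guard_def base_def)
    qed (use that b in \<open>auto simp: log_guard_def simple_expr_def\<close>)
    moreover have "(m + 1) * (5 + 1) \<le> (n + 1) * (5 + 1)"
    proof (intro mult_right_mono add_right_mono)
      have "(2::nat) ^ s ''L'' 0 \<ge> 1" by simp
      then show "m \<le> n" using that unfolding I_def by linarith
    qed simp
    ultimately show ?thesis using wp_mono by blast
  qed
  have w2: "wp b ((n + 1) * (5 + 1)) (While rate_guard rate_body) Q2 s r" if "J m s r" for s m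
  proof -
    have "wp b ((m + 1) * (5 + 1)) (While rate_guard rate_body) Q2 s r"
    proof (rule wp_While[where I = J])
      fix m s r' assume J: "J m s r'" and g: "expr_val rate_guard s \<noteq> 0"
      then obtain k L where kL: "s ''L'' 0 = L" "n < 2 ^ L" "2 ^ L \<le> 2 * n" "s ''k'' 0 = k" "s ''y'' 0 = 2 ^ k"
        "2 ^ k \<le> n" "m = n - 2 ^ k" and bs: "base s" and r': "r' = r" by (auto simp: J_def)
      have le: "2 * 2 ^ k * (L * L) * q \<le> p * n"
        using g kL bs by (simp add: rate_guard_def base_def mult.assoc)
      \<comment> \<open>The loop cannot push \<open>2 ^ k\<close> past \<open>n\<close>: as
        \<open>L \<ge> 1\<close> and \<open>p < q\<close>, the guard implies
        \<open>2 * 2 ^ k * q \<le> p * n < q * n\<close>.\<close>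
      have "L > 0" using kL n by (cases L) auto
      have "2 * 2 ^ k * q \<le> 2 * 2 ^ k * (L * L) * q" using \<open>L > 0\<close> by simp
      also note le
      also have "p * n < q * n" using pq n by simp
      finally have "2 * 2 ^ k * q < n * q" by (simp add: mult.commute)
      then have lt: "2 * 2 ^ k < n" by (rule mult_less_cancel2[THEN iffD1, THEN conjunct2])
      have k: "k < 2 ^ k" by (rule self_less)
      have pos: "(0::nat) < 2 ^ k" by simp
      have ib: "n \<le> 2 ^ b" "Suc k \<le> 2 ^ b" "n - 2 * 2 ^ k < n - 2 ^ k"
        using n_bounds(1) lt k pos by linarith+
      have "vc b rate_body (\<lambda>s r. \<exists>m'<m. J m' s r) s r'"
        using kL bs r' le lt ib
        by (auto simp: rate_body_def J_def base_def store_upd_def intro!: exI[of _ "n - 2 * 2 ^ k"])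
      then show "wp b 5 rate_body (\<lambda>s r. \<exists>m'<m. J m' s r) s r'"
        by (rule wp_vcI) (use b in \<open>auto simp: rate_body_def simple_expr_def\<close>)
    next
      fix m s r' assume J: "J m s r'" and g: "expr_val rate_guard s = 0"
      then obtain k L where kL: "s ''L'' 0 = L" "n < 2 ^ L" "2 ^ L \<le> 2 * n" "s ''k'' 0 = k" "s ''y'' 0 = 2 ^ k"
        "2 ^ k \<le> n" "2 ^ k * (L * L) * q \<le> p * n" and bs: "base s" and r': "r' = r" by (auto simp: J_def)
      have "p * n < 2 * 2 ^ k * (L * L) * q"
        using g kL bs by (simp add: rate_guard_def base_def mult.assoc)
      then show "Q2 s r'" using kL bs r' by (auto simp: Q2_def)
    qed (use that b in \<open>auto simp: rate_guard_def simple_expr_def\<close>)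
    moreover have "(m + 1) * (5 + 1) \<le> (n + 1) * (5 + 1)"
      using that by (intro mult_right_mono) (auto simp: J_def)
    ultimately show ?thesis using wp_mono by blast
  qed
  have w3: "wp b 1 (assign ''M'' (Mul (var ''y'') (var ''n''))) Q s r" if Q2: "Q2 s r" for s
  proof -
    have "vc b (assign ''M'' (Mul (var ''y'') (var ''n''))) Q s r"
    proof -
      obtain k L where kL: "n < 2 ^ L" "2 ^ L \<le> 2 * n" "s ''k'' 0 = k" "s ''y'' 0 = 2 ^ k"
        "2 ^ k \<le> n" "2 ^ k * (L * L) * q \<le> p * n" "p * n < 2 * 2 ^ k * (L * L) * q" and bs: "base s"
        using Q2 unfolding Q2_def by blast
      have "2 ^ k * n \<le> n * n" using kL(5) by (rule mult_right_mono) simp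
      then have "2 ^ k * n \<le> 2 ^ b" using n_bounds(3) by linarith
      then show ?thesis using kL bs by (auto simp: Q_def params_def base_def store_upd_def)
    qed
    then show ?thesis
        by (rule wp_vcI) (use b in \<open>auto simp: simple_expr_def\<close>)
  qed
  have one: "1 \<le> (2::nat) ^ b" by simp
  have v1: "wp b 1 (assign ''z'' (Const 1)) (\<lambda>s r'. I n s r' \<and> r' = r) s r"
  proof -
    have "vc b (assign ''z'' (Const 1)) (\<lambda>s r'. I n s r' \<and> r' = r) s r"
      using s n by (auto simp: I_def base_def store_upd_def)
    then show ?thesis
        by (rule wp_vcI) (use b in \<open>auto simp: simple_expr_def\<close>)
  qed
  have v2: "wp b 1 (assign ''y'' (Const 1)) (\<lambda>s r'. J (n - 1) s r' \<and> r' = r) s r" if "Q1 s r" for s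
  proof -
    have "s ''L'' 0 * s ''L'' 0 * q \<le> p * n" using that by (intro start) (auto simp: Q1_def)
    then have "vc b (assign ''y'' (Const 1)) (\<lambda>s r'. J (n - 1) s r' \<and> r' = r) s r"
      using that n by (auto simp: Q1_def J_def base_def store_upd_def)
    then show ?thesis
        by (rule wp_vcI) (use b in \<open>auto simp: simple_expr_def\<close>)
  qed
  let ?N = "(n + 1) * (5 + 1)"
  have "wp b (1 + 1 + (1 + ?N + (1 + 1 + (1 + ?N + 1)))) params_prog Q s r"
    unfolding params_prog_def
  proof (rule wp_Seq, rule wp_mono[OF v1 _ order_refl], elim conjE, hypsubst, rule wp_Seq)
    fix s assume "I n s r"
    from w1[OF this] show "wp b ?N (While log_guard log_body) (wp b (1 + 1 + (1 + ?N + 1))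
      (Seq (assign ''y'' (Const 1)) (Seq (While rate_guard rate_body) (assign ''M'' (Mul (var ''y'') (var ''n'')))))
      Q) s r"
    proof (rule wp_mono)
      fix s r' assume Q1: "Q1 s r'"
      then have r: "r' = r" by (simp add: Q1_def)
      show "wp b (1 + 1 + (1 + ?N + 1))
        (Seq (assign ''y'' (Const 1)) (Seq (While rate_guard rate_body) (assign ''M'' (Mul (var ''y'') (var ''n'')))))
        Q s r'"
        unfolding r
      proof (rule wp_Seq, rule wp_mono[OF v2 _ order_refl])
        show "Q1 s r" using Q1 r by simp
      next
        fix s r' assume "J (n - 1) s r' \<and> r' = r"
        then have J: "J (n - 1) s r" and r: "r' = r" by auto
        show "wp b (1 + ?N + 1) (Seq (While rate_guard rate_body) (assign ''M'' (Mul (var ''y'') (var ''n'')))) Q s r'"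
          unfolding r
        proof (rule wp_Seq, rule wp_mono[OF w2[OF J] _ order_refl])
          fix s r' assume "Q2 s r'"
          then show "wp b 1 (assign ''M'' (Mul (var ''y'') (var ''n''))) Q s r'"
            using w3[of s] by (auto simp: Q2_def)
        qed
      qed
    qed simp
  qed
  then show ?thesis
    unfolding Q_def by (rule wp_mono) auto
qed

end

lemma store_upd_apply: "store_upd s a i x c j = (if c = a \<and> j = i then x else s c j)"
  by (simp add: store_upd_def)

section \<open>The sampling loop\<close>

context sparsify_run
begin

text \<open>The index \<open>j = u * n + v\<close> stands for the pair \<open>(u, v)\<close>; only pairs with \<open>u < v\<close> are sampled.\<close>

definition sampled :: "nat \<Rightarrow> bool list \<Rightarrow> nat \<Rightarrow> nat" where
  "sampled k r j = of_bool (adj j = 1 \<and> j div n < j mod n \<and> block_true k r j)"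

definition index_degree :: "nat \<Rightarrow> (nat \<Rightarrow> nat) \<Rightarrow> nat \<Rightarrow> nat" where
  "index_degree i w u = (\<Sum>j<i. if j div n = u \<or> j mod n = u then w j else 0)"

definition sample_frame :: "nat \<Rightarrow> bool list \<Rightarrow> nat \<Rightarrow> store \<Rightarrow> bool" where
  "sample_frame k r0 i s \<longleftrightarrow> s ''n'' 0 = n \<and> s ''adj'' = adj \<and> s ''k'' 0 = k \<and> s ''M'' 0 = 2 ^ k * n \<and>
     s ''i'' 0 = i \<and> (\<forall>j<i. s ''edge'' j = sampled k r0 j) \<and>
     (\<forall>j<i. s ''num'' j = sampled k r0 j * (2 ^ k * n)) \<and> (\<forall>j<i. s ''den'' j = 8 * n) \<and>
     (\<forall>u<n. s ''x'' u = index_degree i (\<lambda>j. sampled k r0 j * (2 ^ k * n)) u)"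

text \<open>The last equation ties the unread part of the tape to the blocks: exactly
  \<open>k\<close> bits have been consumed per pair.\<close>

definition sample_inv :: "nat \<Rightarrow> bool list \<Rightarrow> nat \<Rightarrow> store \<Rightarrow> bool list \<Rightarrow> bool" where
  "sample_inv k r0 m s r \<longleftrightarrow> (\<exists>i. sample_frame k r0 i s \<and> i \<le> n * n \<and> m = n * n - i \<and>
     s ''T'' 0 = (\<Sum>j<i. adj j) \<and> r = drop (i * k) r0)"

lemma sum_adj_le: "(\<Sum>j<i. adj j) \<le> i"
  using sum_mono[of "{..<i}" adj "\<lambda>_. 1"] adj by simp

lemma index_degree_le:
  assumes "\<And>j. j < i \<Longrightarrow> w j \<le> c"
  shows "index_degree i w u \<le> i * c"
proof -
  have "index_degree i w u \<le> (\<Sum>j<i. c)"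
    unfolding index_degree_def using assms by (intro sum_mono) auto
  then show ?thesis by simp
qed

lemma flip_loop_wp:
  assumes fr: "sample_frame k r0 i s" and i: "i < n * n" and len: "n * n * k \<le> length r0"
    and s: "s ''T'' 0 = T" "s ''u'' 0 = i div n" "s ''v'' 0 = i mod n" "s ''l'' 0 = 0"
    "s ''b'' 0 = of_bool (adj i = 1 \<and> i div n < i mod n)" and k: "k \<le> n"
  shows "wp b ((k + 1) * 8) (While flip_guard flip_body) (\<lambda>s r. sample_frame k r0 i s \<and>
    s ''T'' 0 = T \<and> s ''u'' 0 = i div n \<and> s ''v'' 0 = i mod n \<and> s ''b'' 0 = sampled k r0 i \<and>
    r = drop (Suc i * k) r0) s (drop (i * k) r0)"
proof -
  define I where "I = (\<lambda>m (s::store) r. sample_frame k r0 i s \<and>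
    s ''T'' 0 = T \<and> s ''u'' 0 = i div n \<and> s ''v'' 0 = i mod n \<and> s ''l'' 0 \<le> k \<and> m = k - s ''l'' 0 \<and>
    s ''b'' 0 = of_bool (adj i = 1 \<and> i div n < i mod n \<and> (\<forall>l<s ''l'' 0. r0 ! (i * k + l))) \<and>
    r = drop (i * k + s ''l'' 0) r0)"
  have "wp b ((k + 1) * (7 + 1)) (While flip_guard flip_body) (\<lambda>s r. sample_frame k r0 i s \<and>
    s ''T'' 0 = T \<and> s ''u'' 0 = i div n \<and> s ''v'' 0 = i mod n \<and> s ''b'' 0 = sampled k r0 i \<and>
    r = drop (Suc i * k) r0) s (drop (i * k) r0)"
  proof (rule wp_While[where I = I])
    fix m s r assume I: "I m s r" and g: "expr_val flip_guard s \<noteq> 0"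
    define l where "l = s ''l'' 0"
    have l: "l < k" using I g by (simp add: I_def flip_guard_def sample_frame_def l_def)
    have "i * k + l < Suc i * k" using l by simp
    also have "\<dots> \<le> n * n * k" using i by (intro mult_right_mono) auto
    also note len
    finally have lt: "i * k + l < length r0" .
    have r: "r \<noteq> []" "hd r = r0 ! (i * k + l)" "tl r = drop (i * k + Suc l) r0"
      using lt I by (auto simp: I_def hd_drop_conv_nth l_def tl_drop drop_Suc[symmetric] simp flip: drop_Suc)
    have sb: "Suc l \<le> 2 ^ b" using l k n_bounds(1) by linarith
    have all: "(\<forall>l'<Suc l. r0 ! (i * k + l')) = ((\<forall>l'<l. r0 ! (i * k + l')) \<and> r0 ! (i * k + l))"
      by (auto simp: less_Suc_eq)
    have "vc b flip_body (\<lambda>s r. I (k - Suc l) s r) s r"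
      using I r sb l all
      by (auto simp: flip_body_def I_def store_upd_def sample_frame_def l_def)
    then have "vc b flip_body (\<lambda>s r. \<exists>m'<m. I m' s r) s r"
    proof (rule vc_mono)
      fix s' r' assume "I (k - Suc l) s' r'"
      moreover have "k - Suc l < m" using I l by (simp add: I_def l_def)
      ultimately show "\<exists>m'<m. I m' s' r'" by blast
    qed
    then show "wp b 7 flip_body (\<lambda>s r. \<exists>m'<m. I m' s r) s r"
      by (rule wp_vcI) (use b in \<open>auto simp: flip_body_def simple_expr_def\<close>)
  next
    fix m s r assume I: "I m s r" and g: "expr_val flip_guard s = 0"
    have l: "s ''l'' 0 = k" using I g by (simp add: I_def flip_guard_def sample_frame_def)
    show "sample_frame k r0 i s \<and> s ''T'' 0 = T \<and> s ''u'' 0 = i div n \<and> s ''v'' 0 = i mod n \<and>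
        s ''b'' 0 = sampled k r0 i \<and> r = drop (Suc i * k) r0"
      using I by (simp add: I_def l sampled_def block_true_def add.commute)
  qed (use fr s b in \<open>auto simp: I_def flip_guard_def simple_expr_def\<close>)
  then show ?thesis by simp
qed

lemma div_mod_lt: "i < n * n \<Longrightarrow> i div n < n" "i mod n < n"
  using n by (auto simp: less_mult_imp_div_less)

lemma sample_prog_wp:
  assumes s: "base s" "params s k" and len: "n * n * k \<le> length r0"
  shows "wp b (100 * (n + 2) ^ 3) sample_prog
    (\<lambda>s r. sample_frame k r0 (n * n) s \<and> s ''T'' 0 = (\<Sum>j<n * n. adj j)) s r0"
proof -
  let ?Q = "\<lambda>s (r::bool list). sample_frame k r0 (n * n) s \<and> s ''T'' 0 = (\<Sum>j<n * n. adj j)"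
  have k: "k \<le> n" "2 ^ k \<le> n" using s(2) less_exp[of k] unfolding params_def by linarith+
  define N where "N = 1 + 13 + (1 + (k + 1) * 8 + 13)"
  have step: "wp b N sample_body (\<lambda>s r. \<exists>m'<m. sample_inv k r0 m' s r) s r"
    if inv: "sample_inv k r0 m s r" and g: "expr_val pair_guard s \<noteq> 0" for m s r
  proof -
    obtain i where i: "sample_frame k r0 i s" "m = n * n - i" "s ''T'' 0 = (\<Sum>j<i. adj j)" "r = drop (i * k) r0"
      using inv by (auto simp: sample_inv_def)
    have ilt: "i < n * n" using g i(1) by (simp add: pair_guard_def sample_frame_def)
    note uv = div_mod_lt(1)[OF ilt] div_mod_lt(2)[of i]
    define T where "T = (\<Sum>j<Suc i. adj j)"
    define P where "P = (\<lambda>(s::store) r'. sample_frame k r0 i s \<and> s ''T'' 0 = T \<and> s ''u'' 0 = i div n \<and>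
      s ''v'' 0 = i mod n \<and> s ''l'' 0 = 0 \<and> s ''b'' 0 = of_bool (adj i = 1 \<and> i div n < i mod n) \<and> r' = r)"
    have pre: "vc b sample_pre P s r"
    proof -
      have a: "adj i = 0 \<or> adj i = 1" using adj[of i] by linarith
      have "T \<le> Suc i" unfolding T_def by (rule sum_adj_le)
      also have "\<dots> \<le> n * n" using ilt by simp
      finally have Tb: "T \<le> 2 ^ b" using n_bounds(3) by linarith
      have ub: "i div n \<le> 2 ^ b" "i mod n \<le> 2 ^ b" using uv n_bounds(1) by linarith+
      have T: "T = (\<Sum>j<i. adj j) + adj i" by (simp add: T_def)
      have md: "i - i div n * n = i mod n" by (simp add: minus_div_mult_eq_mod)
      have one: "(1::nat) - (1 - (i mod n - i div n)) = of_bool (i div n < i mod n)" by auto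
      have mb: "adj i * (1 - (1 - (i mod n - i div n))) = of_bool (adj i = 1 \<and> i div n < i mod n)"
        unfolding one using a by auto
      have mb2: "adj i * (1 - (1 - (i mod n - i div n))) \<le> 2 ^ b" unfolding mb by simp
      show ?thesis
        using i Tb ub T a mb mb2
        by (simp add: sample_pre_def pair_setup_def P_def store_upd_def sample_frame_def md
            del: diff_diff_left One_nat_def)
    qed
    have pre': "wp b 13 sample_pre P s r"
      by (rule wp_vcI[OF pre b(1)]) (auto simp: sample_pre_def pair_setup_def simple_expr_def)
    define R where "R = (\<lambda>(s::store) r. sample_frame k r0 i s \<and>
      s ''T'' 0 = T \<and> s ''u'' 0 = i div n \<and> s ''v'' 0 = i mod n \<and> s ''b'' 0 = sampled k r0 i \<and>
      r = drop (Suc i * k) r0)"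
    have mid: "wp b ((k + 1) * 8) (While flip_guard flip_body) R s' r'" if "P s' r'" for s' r'
      unfolding R_def using flip_loop_wp[of k r0 i s' T] that ilt len k i(4) by (auto simp: P_def)
    have post: "wp b 13 sample_post (\<lambda>s r. \<exists>m'<m. sample_inv k r0 m' s r) s' r'" if R: "R s' r'" for s' r'
    proof -
      let ?M = "2 ^ k * n"
      define c where "c = sampled k r0 i"
      have c: "c \<le> 1" by (simp add: c_def sampled_def)
      have fr: "sample_frame k r0 i s'" using R by (simp add: R_def)
      have c0: "c = 0" if "i div n = i mod n" using that by (simp add: c_def sampled_def)
      have Mn: "?M \<le> n * n" using k(2) by (intro mult_right_mono) auto
      have cM: "c * ?M \<le> n * n" using mult_le_mono[OF c Mn] by simp
      have deg: "index_degree i' (\<lambda>j. sampled k r0 j * ?M) u \<le> n ^ 4" if "i' \<le> n * n" for i' u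
      proof -
        have "sampled k r0 j * ?M \<le> 1 * ?M" for j by (rule mult_right_mono) (auto simp: sampled_def)
        then have "index_degree i' (\<lambda>j. sampled k r0 j * ?M) u \<le> i' * ?M"
          by (intro index_degree_le) simp
        also have "\<dots> \<le> (n * n) * (n * n)" using that Mn by (rule mult_mono) auto
        finally show ?thesis by (simp add: power4_eq_xxxx)
      qed
      have Suc_deg: "index_degree (Suc i) w u = index_degree i w u + (if i div n = u \<or> i mod n = u then w i else 0)" for w u
        by (simp add: index_degree_def)
      have x: "s' ''x'' u = index_degree i (\<lambda>j. sampled k r0 j * ?M) u" if "u < n" for u
        using fr that by (simp add: sample_frame_def)
      have n4: "32 * n ^ 4 \<le> 2 ^ b" by (rule b(2))
      have "vc b sample_post (\<lambda>s r. sample_inv k r0 (n * n - Suc i) s r) s' r'"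
      proof -
        have b1: "c \<le> 2 ^ b" "c * ?M \<le> 2 ^ b" "8 * n \<le> 2 ^ b" "Suc i \<le> 2 ^ b"
          using c cM ilt n_bounds by linarith+
        have du: "s' ''x'' (i div n) + c * ?M \<le> 2 ^ b" "s' ''x'' (i mod n) + c * ?M \<le> 2 ^ b"
        proof -
          have "n * n \<le> n ^ 4" using power_increasing[of 2 4 n] n by (simp add: power2_eq_square)
          then show "s' ''x'' (i div n) + c * ?M \<le> 2 ^ b" "s' ''x'' (i mod n) + c * ?M \<le> 2 ^ b"
            using deg[of i "i div n"] deg[of i "i mod n"] x[OF uv(1)] x[OF uv(2)] ilt cM n4 by linarith+
        qed
        have vals: "s' ''b'' 0 = c" "s' ''M'' 0 = ?M" "s' ''i'' 0 = i" "s' ''n'' 0 = n"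
          "s' ''u'' 0 = i div n" "s' ''v'' 0 = i mod n" "s' ''T'' 0 = T"
          using R by (auto simp: R_def c_def sample_frame_def)
        \<comment> \<open>The second update of \<open>x\<close> reads its cell after the first one.
          If the two cells coincide, the pair is diagonal, hence never sampled, and
          \<open>c = 0\<close>.\<close>
        define X where "X = (if i mod n = i div n then s' ''x'' (i div n) + c * ?M else s' ''x'' (i mod n)) + c * ?M"
        have Xb: "X \<le> 2 ^ b" using c0 du by (auto simp: X_def)
        \<comment> \<open>Symbolic execution only has to arrive at this store; the invariant is then
          checked on it once instead of through nested updates.\<close>
        define s2 where "s2 = store_upd (store_upd (store_upd (store_upd (store_upd (store_upd s'
          ''edge'' i c) ''num'' i (c * ?M)) ''den'' i (8 * n))
          ''x'' (i div n) (s' ''x'' (i div n) + c * ?M)) ''x'' (i mod n) X) ''i'' 0 (Suc i)"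
        have "s2 ''adj'' j = s' ''adj'' j" for j by (simp add: s2_def store_upd_apply)
        then have adj2: "s2 ''adj'' = adj" using fr by (auto simp: sample_frame_def)
        have look: "s2 ''n'' 0 = n" "s2 ''k'' 0 = s' ''k'' 0" "s2 ''M'' 0 = ?M" "s2 ''i'' 0 = Suc i" "s2 ''T'' 0 = T"
          by (simp_all add: s2_def store_upd_apply vals)
        have arr: "s2 ''edge'' j = (if j = i then c else s' ''edge'' j)"
          "s2 ''num'' j = (if j = i then c * ?M else s' ''num'' j)"
          "s2 ''den'' j = (if j = i then 8 * n else s' ''den'' j)" for j
          by (simp_all add: s2_def store_upd_apply)
        have x2: "s2 ''x'' u = s' ''x'' u + (if i div n = u \<or> i mod n = u then c * ?M else 0)" for u
          using c0 by (auto simp: s2_def store_upd_apply X_def)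
        have fr2: "sample_frame k r0 (Suc i) s2"
          using fr unfolding sample_frame_def look arr adj2 x2
          by (auto simp: less_Suc_eq Suc_deg c_def)
        have "sample_inv k r0 (n * n - Suc i) s2 r'"
          unfolding sample_inv_def using fr2 R ilt look by (intro exI[of _ "Suc i"]) (auto simp: R_def T_def)
        moreover have "vc b sample_post (\<lambda>s r. s = s2 \<and> r = r') s' r'"
          using b1 du Xb
          by (simp add: sample_post_def store_upd_apply vals s2_def X_def split: if_splits)
        ultimately show ?thesis
          using vc_mono[of b sample_post "\<lambda>s r. s = s2 \<and> r = r'" s' r' "sample_inv k r0 (n * n - Suc i)"] by blast
      qed
      then have "vc b sample_post (\<lambda>s r. \<exists>m'<m. sample_inv k r0 m' s r) s' r'"
      proof (rule vc_mono)
        fix s r assume "sample_inv k r0 (n * n - Suc i) s r"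
        then show "\<exists>m'<m. sample_inv k r0 m' s r" using ilt i(2) by (intro exI[of _ "n * n - Suc i"]) auto
      qed
      then show ?thesis
        by (rule wp_vcI) (use b in \<open>auto simp: sample_post_def simple_expr_def\<close>)
    qed
    have "wp b (1 + 13 + (1 + (k + 1) * 8 + 13)) sample_body (\<lambda>s r. \<exists>m'<m. sample_inv k r0 m' s r) s r"
      unfolding sample_body_def
      by (rule wp_Seq, rule wp_mono[OF pre' _ order_refl], rule wp_Seq, rule wp_mono[OF mid _ order_refl])
        (use post in blast)+
    then show ?thesis by (simp add: N_def)
  qed
  have init: "vc b (assign ''i'' (Const 0)) (\<lambda>s r. sample_inv k r0 (n * n) s r) s r0"
    using s by (auto simp: store_upd_def sample_inv_def sample_frame_def base_def params_def index_degree_def intro!: exI[of _ 0])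
  have init': "wp b 1 (assign ''i'' (Const 0)) (\<lambda>s r. sample_inv k r0 (n * n) s r) s r0"
    by (rule wp_vcI[OF init b(1)]) (auto simp: simple_expr_def)
  have loop: "wp b ((n * n + 1) * (N + 1)) (While pair_guard sample_body) ?Q s' r'"
    if "sample_inv k r0 (n * n) s' r'" for s' r'
  proof (rule wp_While[where I = "sample_inv k r0", OF step])
    fix m s r assume "sample_inv k r0 m s r" "expr_val pair_guard s = 0"
    then show "?Q s r" by (auto simp: sample_inv_def pair_guard_def sample_frame_def)
  qed (use that b in \<open>auto simp: pair_guard_def simple_expr_def\<close>)
  have total: "wp b (1 + 1 + (n * n + 1) * (N + 1)) sample_prog ?Q s r0"
    unfolding sample_prog_def by (rule wp_Seq, rule wp_mono[OF init' loop order_refl])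
  have le: "1 + 1 + (n * n + 1) * (N + 1) \<le> 100 * (n + 2) ^ 3"
  proof -
    have "N + 1 \<le> 8 * n + 37" using k by (simp add: N_def)
    then have "(n * n + 1) * (N + 1) \<le> (n * n + 1) * (8 * n + 37)" by (rule mult_left_mono) simp
    then show ?thesis by (simp add: power3_eq_cube algebra_simps)
  qed
  show ?thesis by (rule wp_mono[OF total _ le])
qed

end

section \<open>Local search for the weights\<close>

context sparsify_run
begin

definition search_inv :: "nat \<Rightarrow> bool list \<Rightarrow> nat \<Rightarrow> store \<Rightarrow> bool" where
  "search_inv k r0 t s \<longleftrightarrow> s ''n'' 0 = n \<and> s ''M'' 0 = 2 ^ k * n \<and> s ''t'' 0 = t \<and>
     (\<forall>j<n * n. s ''edge'' j = sampled k r0 j) \<and> (\<forall>j<n * n. s ''den'' j = 8 * n) \<and>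
     (\<forall>j<n * n. (sampled k r0 j = 0 \<longrightarrow> s ''num'' j = 0) \<and>
       (sampled k r0 j \<noteq> 0 \<longrightarrow> 2 ^ k * n \<le> s ''num'' j \<and> s ''num'' j \<le> 32 * (2 ^ k * n))) \<and>
     (\<forall>u<n. s ''x'' u = index_degree (n * n) (s ''num'') u)"

definition optimal_at :: "nat \<Rightarrow> bool list \<Rightarrow> nat \<Rightarrow> store \<Rightarrow> nat \<Rightarrow> bool" where
  "optimal_at k r0 t s j \<longleftrightarrow> (sampled k r0 j \<noteq> 0 \<longrightarrow>
     (2 * t + 2 \<le> s ''x'' (j div n) + s ''x'' (j mod n) \<longrightarrow> s ''num'' j = 2 ^ k * n) \<and>
     (s ''x'' (j div n) + s ''x'' (j mod n) + 2 \<le> 2 * t \<longrightarrow> s ''num'' j = 32 * (2 ^ k * n)))"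

definition potential :: "nat \<Rightarrow> (nat \<Rightarrow> nat) \<Rightarrow> nat" where
  "potential t x = nat (\<Sum>u<n. (int (x u) - int t)\<^sup>2)"

text \<open>Changing a weight by \<open>d\<close> moves the deviations r of both ends by
  \<open>d\<close> and the sum of squares by \<open>2 * d * (r u + r v) + 2 * d\<^sup>2\<close>. For
  \<open>d\<close> equal to 1 or -1 this is negative exactly if
  \<open>d * (r u + r v) \<le> - 2\<close>, whence the margin 2 in the guards and in local
  optimality.\<close>

lemma potential_less:
  assumes uv: "u < n" "v < n" "u \<noteq> v"
    and d: "\<And>w. w < n \<Longrightarrow> int (y w) = int (x w) + (if w = u \<or> w = v then d else 0)"
    and less: "2 * d * (int (x u) - t + (int (x v) - t)) + 2 * d\<^sup>2 < 0"
  shows "potential t y < potential t x"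
proof -
  let ?f = "\<lambda>x w. (int (x w) - int t)\<^sup>2"
  have "(\<Sum>w<n. ?f y w - ?f x w) = (\<Sum>w\<in>{u, v}. ?f y w - ?f x w)"
    using uv d by (intro sum.mono_neutral_right) auto
  also have "\<dots> = 2 * d * (int (x u) - t + (int (x v) - t)) + 2 * d\<^sup>2"
    using uv d by (simp add: power2_eq_square algebra_simps)
  finally have lt: "(\<Sum>w<n. ?f y w) < (\<Sum>w<n. ?f x w)" using less by (simp add: sum_subtractf)
  have "(\<Sum>w<n. ?f y w) \<ge> 0" by (intro sum_nonneg) simp
  then show ?thesis using lt unfolding potential_def by simp
qed

text \<open>The old and the new value are added on opposite sides, so that no truncated subtraction
  occurs.\<close>

lemma index_degree_update:
  assumes "i < N"
  shows "index_degree N (\<lambda>j. if j = i then c else w j) u +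
      (if i div n = u \<or> i mod n = u then w i else 0) =
    index_degree N w u + (if i div n = u \<or> i mod n = u then c else 0)"
proof -
  have "index_degree N f u = (if i div n = u \<or> i mod n = u then f i else 0) +
      (\<Sum>j\<in>{..<N} - {i}. if j div n = u \<or> j mod n = u then f j else 0)" for f
    unfolding index_degree_def using assms by (intro sum.remove) auto
  moreover have "(\<Sum>j\<in>{..<N} - {i}. if j div n = u \<or> j mod n = u then if j = i then c else w j else 0) =
      (\<Sum>j\<in>{..<N} - {i}. if j div n = u \<or> j mod n = u then w j else 0)"
    by (intro sum.cong) auto
  ultimately show ?thesis by simp
qed

text \<open>For the decrements in \<open>dec_prog\<close>: a degree is at least the positive weight
  being lowered, so truncated subtraction is exact there.\<close>

lemma index_degree_ge:
  assumes "i < N" "i div n = u \<or> i mod n = u"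
  shows "w i \<le> index_degree N w u"
  using index_degree_update[OF assms(1), of 0 w u] assms(2) by auto

lemma search_bounds:
  assumes inv: "search_inv k r0 t s" and k: "2 ^ k \<le> n" and u: "u < n"
  shows "s ''x'' u \<le> 2 ^ b"
proof -
  have "s ''x'' u = index_degree (n * n) (s ''num'') u" using inv u by (simp add: search_inv_def)
  also have "\<dots> \<le> (n * n) * (32 * (2 ^ k * n))"
    using inv by (intro index_degree_le) (auto simp: search_inv_def)
  also have "\<dots> \<le> (n * n) * (32 * (n * n))" using k by simp
  also have "\<dots> = 32 * n ^ 4" by (simp add: power4_eq_xxxx)
  finally show ?thesis using b(2) by linarith
qed

text \<open>After a change the optimality of the pairs already visited may be lost, so it is tracked
  only as long as nothing has changed; otherwise the drop of the potential below \<open>P0\<close>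
  is what makes the outer loop terminate.\<close>

definition sweep_state :: "nat \<Rightarrow> bool list \<Rightarrow> nat \<Rightarrow> nat \<Rightarrow> nat \<Rightarrow> store \<Rightarrow> bool" where
  "sweep_state k r0 t P0 i s \<longleftrightarrow> search_inv k r0 t s \<and> s ''i'' 0 = i \<and>
     (s ''g'' 0 = 0 \<and> potential t (s ''x'') = P0 \<and> (\<forall>j<i. optimal_at k r0 t s j) \<or>
      s ''g'' 0 = 1 \<and> potential t (s ''x'') < P0)"

lemma move_sweep_state:
  assumes st: "sweep_state k r0 t P0 i s" and i: "i < n * n" and sel: "sampled k r0 i \<noteq> 0"
    and same: "s2 ''n'' 0 = n" "s2 ''M'' 0 = s ''M'' 0" "s2 ''t'' 0 = s ''t'' 0" "s2 ''i'' 0 = Suc i" "s2 ''g'' 0 = 1"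
      "\<And>j. s2 ''edge'' j = s ''edge'' j" "\<And>j. s2 ''den'' j = s ''den'' j"
    and num: "\<And>j. s2 ''num'' j = (if j = i then c else s ''num'' j)"
    and c: "int c = int (s ''num'' i) + d" "2 ^ k * n \<le> c" "c \<le> 32 * (2 ^ k * n)"
    and x: "\<And>u. u < n \<Longrightarrow> int (s2 ''x'' u) = int (s ''x'' u) + (if u = i div n \<or> u = i mod n then d else 0)"
    and less: "2 * d * (int (s ''x'' (i div n)) - t + (int (s ''x'' (i mod n)) - t)) + 2 * d\<^sup>2 < 0"
  shows "sweep_state k r0 t P0 (Suc i) s2"
proof -
  have inv: "search_inv k r0 t s" using st by (simp add: sweep_state_def)
  note uv = div_mod_lt(1)[OF i] div_mod_lt(2)[of i]
  have ne: "i div n \<noteq> i mod n" using sel by (auto simp: sampled_def)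
  have numeq: "s2 ''num'' = (\<lambda>j. if j = i then c else s ''num'' j)" using num by auto
  have deg: "s2 ''x'' u = index_degree (n * n) (s2 ''num'') u" if u: "u < n" for u
  proof -
    have "s ''x'' u = index_degree (n * n) (s ''num'') u" using inv u by (simp add: search_inv_def)
    then show ?thesis
      using index_degree_update[OF i, of c "s ''num''" u] x[OF u] c(1) unfolding numeq
      by (auto split: if_splits)
  qed
  have "search_inv k r0 t s2"
    using inv same num c sel deg by (simp add: search_inv_def)
  moreover have "potential t (s2 ''x'') < potential t (s ''x'')"
    by (rule potential_less[OF uv ne x less])
  moreover have "potential t (s ''x'') \<le> P0" using st by (auto simp: sweep_state_def)
  ultimately show ?thesis using same by (simp add: sweep_state_def)
qed

lemma adjust_body_vc:
  assumes st: "sweep_state k r0 t P0 i s" and i: "i < n * n" and k: "2 ^ k \<le> n" and t: "t \<le> 8 * (n * n)"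
  shows "vc b adjust_body (\<lambda>s r. sweep_state k r0 t P0 (Suc i) s) s r"
proof -
  let ?M = "2 ^ k * n"
  have inv: "search_inv k r0 t s" using st by (simp add: sweep_state_def)
  note uv = div_mod_lt(1)[OF i] div_mod_lt(2)[of i]
  have vals: "s ''n'' 0 = n" "s ''M'' 0 = ?M" "s ''t'' 0 = t" "s ''i'' 0 = i" "s ''edge'' i = sampled k r0 i"
    using st i by (auto simp: sweep_state_def search_inv_def)
  have md: "i - i div n * n = i mod n" by (simp add: minus_div_mult_eq_mod)
  define s1 where "s1 = store_upd (store_upd s ''u'' 0 (i div n)) ''v'' 0 (i mod n)"
  define xu where "xu = s ''x'' (i div n)"
  define xv where "xv = s ''x'' (i mod n)"
  have Mb: "32 * ?M \<le> 32 * (n * n)" using k by simp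
  have ub: "i div n \<le> 2 ^ b" "i mod n \<le> 2 ^ b" "Suc i \<le> 2 ^ b" "Suc 0 \<le> 2 ^ b" "32 * ?M \<le> 2 ^ b"
    using uv n_bounds(1,3) i Mb n by linarith+
  have xb: "xu \<le> 2 ^ b" "xv \<le> 2 ^ b"
    using search_bounds[OF inv k] uv by (auto simp: xu_def xv_def)
  have nb: "s ''num'' i \<le> 32 * ?M"
    using inv i by (cases "sampled k r0 i = 0") (auto simp: search_inv_def)
  have dg: "expr_val dec_guard s1 = sampled k r0 i * (xu + xv - (2 * t + 1)) * (s ''num'' i - ?M)"
    by (simp add: dec_guard_def s1_def store_upd_apply vals xu_def xv_def)
  have ig: "expr_val inc_guard s1 = sampled k r0 i * (2 * t - (xu + xv + 1)) * (32 * ?M - s ''num'' i)"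
    by (simp add: inc_guard_def s1_def store_upd_apply vals xu_def xv_def)
  have ge: "s ''num'' i \<le> xu" "s ''num'' i \<le> xv"
    using inv uv index_degree_ge[OF i, of _ "s ''num''"] by (auto simp: search_inv_def xu_def xv_def)
  let ?tail = "assign ''i'' (Add (var ''i'') (Const 1))"
  have fin: "vc b (Seq (If dec_guard dec_prog (If inc_guard inc_prog Skip)) ?tail)
      (\<lambda>s r. sweep_state k r0 t P0 (Suc i) s) s1 r"
  proof (cases "expr_val dec_guard s1 \<noteq> 0")
    case True
    then have sel: "sampled k r0 i \<noteq> 0" and big: "2 * t + 2 \<le> xu + xv" "?M < s ''num'' i"
      unfolding dg by auto
    have ne: "i mod n \<noteq> i div n" using sel by (auto simp: sampled_def)
    have sb: "s ''num'' i - Suc 0 \<le> 2 ^ b" "s ''x'' (i div n) - Suc 0 \<le> 2 ^ b" "s ''x'' (i mod n) - Suc 0 \<le> 2 ^ b"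
      using nb ub xb unfolding xu_def xv_def by linarith+
    define s2 where "s2 = store_upd (store_upd (store_upd (store_upd (store_upd s1
      ''num'' i (s ''num'' i - 1)) ''x'' (i div n) (xu - 1)) ''x'' (i mod n) (xv - 1)) ''g'' 0 1) ''i'' 0 (Suc i)"
    have "sweep_state k r0 t P0 (Suc i) s2"
    proof (rule move_sweep_state[OF st i sel, where c = "s ''num'' i - 1" and d = "-1"])
      show "int (s2 ''x'' u) = int (s ''x'' u) + (if u = i div n \<or> u = i mod n then - 1 else 0)" for u
        using ge big by (auto simp: s2_def s1_def store_upd_apply xu_def xv_def)
      show "2 * - 1 * (int (s ''x'' (i div n)) - int t + (int (s ''x'' (i mod n)) - int t)) + 2 * (- 1)\<^sup>2 < 0"
        using big by (simp add: xu_def xv_def)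
    qed (use big nb in \<open>auto simp: s2_def s1_def store_upd_apply vals\<close>)
    note ss = this
      have vs: "vc b (Seq dec_prog ?tail) (\<lambda>s r. s = s2) s1 r"
      using ub sb ne
      by (simp add: dec_prog_def store_upd_apply vals s2_def s1_def xu_def xv_def)
    have "vc b (Seq dec_prog ?tail) (\<lambda>s r. sweep_state k r0 t P0 (Suc i) s) s1 r"
      by (rule vc_mono[OF vs]) (simp add: ss)
    then show ?thesis using True by simp
  next
    case nodec: False
    show ?thesis
    proof (cases "expr_val inc_guard s1 \<noteq> 0")
      case True
      then have sel: "sampled k r0 i \<noteq> 0" and big: "xu + xv + 2 \<le> 2 * t" "s ''num'' i < 32 * ?M"
        unfolding ig by auto
      have ne: "i mod n \<noteq> i div n" using sel by (auto simp: sampled_def)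
      have Mnum: "?M \<le> s ''num'' i" using inv i sel by (simp add: search_inv_def)
      \<comment> \<open>Increments happen only while the two degrees sum to less than
        \<open>2 * t\<close>, at most \<open>16 * (n * n)\<close>, and the weight is below
        \<open>32 * ?M\<close>; the new values still fit.\<close>
      have xb2: "Suc xu \<le> 2 ^ b" "Suc xv \<le> 2 ^ b" "Suc (s ''num'' i) \<le> 2 ^ b"
        using big t n_bounds(3) ub by linarith+
      define s2 where "s2 = store_upd (store_upd (store_upd (store_upd (store_upd s1
        ''num'' i (Suc (s ''num'' i))) ''x'' (i div n) (Suc xu)) ''x'' (i mod n) (Suc xv)) ''g'' 0 1) ''i'' 0 (Suc i)"
      have "sweep_state k r0 t P0 (Suc i) s2"
      proof (rule move_sweep_state[OF st i sel, where c = "Suc (s ''num'' i)" and d = 1])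
        show "int (s2 ''x'' u) = int (s ''x'' u) + (if u = i div n \<or> u = i mod n then 1 else 0)" for u
          by (auto simp: s2_def s1_def store_upd_apply xu_def xv_def)
        show "2 * 1 * (int (s ''x'' (i div n)) - int t + (int (s ''x'' (i mod n)) - int t)) + 2 * 1\<^sup>2 < 0"
          using big by (simp add: xu_def xv_def)
      qed (use big Mnum in \<open>auto simp: s2_def s1_def store_upd_apply vals\<close>)
      note ss = this
      have vs: "vc b (Seq inc_prog ?tail) (\<lambda>s r. s = s2) s1 r"
        using ub xb2 ne
        by (simp add: inc_prog_def store_upd_apply vals s2_def s1_def xu_def xv_def)
      have "vc b (Seq inc_prog ?tail) (\<lambda>s r. sweep_state k r0 t P0 (Suc i) s) s1 r"
        by (rule vc_mono[OF vs]) (simp add: ss)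
      then show ?thesis using True nodec by simp
    next
      case False
      define s2 where "s2 = store_upd s1 ''i'' 0 (Suc i)"
      have eqs: "s2 a j = s a j" if "a \<notin> {''u'', ''v'', ''i''}" for a j
        using that by (simp add: s2_def s1_def store_upd_apply)
      have eqf: "s2 a = s a" if "a \<notin> {''u'', ''v'', ''i''}" for a
        using eqs[OF that] by auto
      have "search_inv k r0 t s2" using inv by (simp add: search_inv_def eqf)
      moreover have "optimal_at k r0 t s2 j = optimal_at k r0 t s j" for j by (simp add: optimal_at_def eqf)
      moreover have "optimal_at k r0 t s i"
      proof -
        have "s ''num'' i = 32 * ?M" if "xu + xv + 2 \<le> 2 * t" "sampled k r0 i \<noteq> 0"
          using that False nb unfolding ig by auto
        moreover have "s ''num'' i = ?M" if "2 * t + 2 \<le> xu + xv" "sampled k r0 i \<noteq> 0"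
        proof -
          have "?M \<le> s ''num'' i" using inv i that by (simp add: search_inv_def)
          then show ?thesis using that nodec unfolding dg by auto
        qed
        ultimately show ?thesis by (simp add: optimal_at_def xu_def xv_def)
      qed
      moreover have "s2 ''i'' 0 = Suc i" by (simp add: s2_def store_upd_apply)
      ultimately have "sweep_state k r0 t P0 (Suc i) s2"
        using st by (auto simp: sweep_state_def eqf less_Suc_eq)
      then show ?thesis using False nodec ub by (simp add: s2_def s1_def store_upd_apply vals)
    qed
  qed
  have "vc b pair_setup (\<lambda>s' r'. s' = s1 \<and> r' = r) s r"
    using ub by (simp add: pair_setup_def store_upd_apply vals md s1_def)
  then have "vc b pair_setup (vc b (Seq (If dec_guard dec_prog (If inc_guard inc_prog Skip)) ?tail)
      (\<lambda>s r. sweep_state k r0 t P0 (Suc i) s)) s r"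
    by (rule vc_mono) (use fin in auto)
  then show ?thesis by (simp add: adjust_body_def)
qed

lemma sweep_prog_wp:
  assumes inv: "search_inv k r0 t s" and k: "2 ^ k \<le> n" and t: "t \<le> 8 * (n * n)"
  shows "wp b (30 * (n * n + 2)) sweep_prog
    (\<lambda>s' r. sweep_state k r0 t (potential t (s ''x'')) (n * n) s') s r"
proof -
  let ?P = "potential t (s ''x'')"
  let ?Q = "\<lambda>s' (r::bool list). sweep_state k r0 t ?P (n * n) s'"
  define I where "I = (\<lambda>m s (r::bool list). \<exists>i. sweep_state k r0 t ?P i s \<and> i \<le> n * n \<and> m = n * n - i)"
  have "vc b (block [assign ''g'' (Const 0), assign ''i'' (Const 0)]) (\<lambda>s r. I (n * n) s r) s r"
  proof -
    define s2 where "s2 = store_upd (store_upd s ''g'' 0 0) ''i'' 0 0"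
    have eqs: "s2 a j = s a j" if "a \<notin> {''g'', ''i''}" for a j
      using that by (simp add: s2_def store_upd_apply)
    have eqf: "s2 a = s a" if "a \<notin> {''g'', ''i''}" for a using eqs[OF that] by auto
    have "search_inv k r0 t s2" using inv by (simp add: search_inv_def eqf)
    then have "sweep_state k r0 t ?P 0 s2"
      by (simp add: sweep_state_def eqf) (simp add: s2_def store_upd_apply)
    then have "I (n * n) s2 r" by (auto simp: I_def)
    then show ?thesis by (simp add: s2_def)
  qed
  then have init: "wp b 5 (block [assign ''g'' (Const 0), assign ''i'' (Const 0)]) (\<lambda>s r. I (n * n) s r) s r"
    by (rule wp_vcI) (use b in \<open>auto simp: simple_expr_def\<close>)
  have loop: "wp b ((n * n + 1) * (29 + 1)) (While pair_guard adjust_body) ?Q s' r'" if "I (n * n) s' r'" for s' r'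
  proof (rule wp_While[where I = I])
    fix m s' r' assume I: "I m s' r'" and g: "expr_val pair_guard s' \<noteq> 0"
    then obtain i where i: "sweep_state k r0 t ?P i s'" "m = n * n - i" by (auto simp: I_def)
    have ilt: "i < n * n" using g i by (simp add: pair_guard_def sweep_state_def search_inv_def)
    have "vc b adjust_body (\<lambda>s r. \<exists>m'<m. I m' s r) s' r'"
    proof (rule vc_mono[OF adjust_body_vc[OF i(1) ilt k t]])
      fix s r assume "sweep_state k r0 t ?P (Suc i) s"
      then have "I (n * n - Suc i) s r" using ilt by (auto simp: I_def)
      then show "\<exists>m'<m. I m' s r" using ilt i(2) by (intro exI[of _ "n * n - Suc i"]) auto
    qed
    then show "wp b 29 adjust_body (\<lambda>s r. \<exists>m'<m. I m' s r) s' r'"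
      by (rule wp_vcI) (use b in \<open>auto simp: adjust_body_def pair_setup_def dec_guard_def dec_prog_def
        inc_guard_def inc_prog_def simple_expr_def\<close>)
  next
    fix m s' r' assume I: "I m s' r'" and g: "expr_val pair_guard s' = 0"
    then obtain i where i: "sweep_state k r0 t ?P i s'" "i \<le> n * n" by (auto simp: I_def)
    then have "i = n * n" using g by (simp add: pair_guard_def sweep_state_def search_inv_def)
    then show "?Q s' r'" using i by simp
  qed (use that b in \<open>auto simp: pair_guard_def simple_expr_def\<close>)
  have total: "wp b (1 + 5 + (n * n + 1) * (29 + 1)) sweep_prog ?Q s r"
    unfolding sweep_prog_def by (rule wp_Seq, rule wp_mono[OF init loop order_refl])
  show ?thesis by (rule wp_mono[OF total]) simp_all
qed

text \<open>Every sweep but the last lowers an integer potential. Initially each of the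
  \<open>n\<close> deviations is at most \<open>8 * n ^ 4\<close>, so the potential starts at no
  more than \<open>64 * n ^ 9\<close>.\<close>

lemma search_prog_wp:
  assumes fr: "sample_frame k r0 (n * n) s" and T: "s ''T'' 0 = (\<Sum>j<n * n. adj j)" and k: "2 ^ k \<le> n"
  defines "t \<equiv> 8 * (\<Sum>j<n * n. adj j)"
  shows "wp b ((64 * n ^ 9 + 3) * (31 * (n * n + 2))) search_prog
    (\<lambda>s r. search_inv k r0 t s \<and> (\<forall>j<n * n. optimal_at k r0 t s j)) s r"
proof -
  let ?Q = "\<lambda>s (r::bool list). search_inv k r0 t s \<and> (\<forall>j<n * n. optimal_at k r0 t s j)"
  let ?M = "2 ^ k * n"
  have t: "t \<le> 8 * (n * n)" using sum_adj_le[of "n * n"] by (simp add: t_def)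
  define I where "I = (\<lambda>m s (r::bool list). search_inv k r0 t s \<and>
    (s ''g'' 0 = 1 \<and> potential t (s ''x'') < m \<or> s ''g'' 0 = 0 \<and> (\<forall>j<n * n. optimal_at k r0 t s j)))"
  define m0 where "m0 = 64 * n ^ 9 + 1"
  have "vc b (block [assign ''t'' (Mul (Const 8) (var ''T'')), assign ''g'' (Const 1)]) (\<lambda>s r. I m0 s r) s r"
  proof -
    define s2 where "s2 = store_upd (store_upd s ''t'' 0 t) ''g'' 0 1"
    have eqs: "s2 a j = s a j" if "a \<notin> {''g'', ''t''}" for a j
      using that by (simp add: s2_def store_upd_apply)
    have eqf: "s2 a = s a" if "a \<notin> {''g'', ''t''}" for a using eqs[OF that] by auto
    have s2: "s2 ''t'' 0 = t" "s2 ''g'' 0 = 1" by (simp_all add: s2_def store_upd_apply)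
    have deg: "index_degree (n * n) (\<lambda>j. sampled k r0 j * ?M) u = index_degree (n * n) (s ''num'') u" for u
      unfolding index_degree_def using fr by (intro sum.cong) (auto simp: sample_frame_def)
    have inv: "search_inv k r0 t s2"
    proof -
      have "s ''num'' j = sampled k r0 j * ?M" if "j < n * n" for j
        using fr that by (simp add: sample_frame_def)
      then show ?thesis
        using fr deg k by (simp add: search_inv_def sample_frame_def s2 eqf) (simp add: sampled_def)
    qed
    have x4: "s ''x'' u \<le> 8 * n ^ 4" if "u < n" for u
    proof -
      have "sampled k r0 j * ?M \<le> 1 * (n * n)" for j
        by (rule mult_le_mono) (use k in \<open>auto simp: sampled_def\<close>)
      then have "index_degree (n * n) (\<lambda>j. sampled k r0 j * ?M) u \<le> (n * n) * (n * n)"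
        by (intro index_degree_le) simp
      then have "s ''x'' u \<le> (n * n) * (n * n)" using fr that by (simp add: sample_frame_def)
      then show ?thesis by (simp add: power4_eq_xxxx)
    qed
    have t4: "t \<le> 8 * n ^ 4"
      using t power_increasing[of 2 4 n] n by (simp add: power2_eq_square)
    have "potential t (s ''x'') \<le> 64 * n ^ 9"
    proof -
      have "(\<Sum>u<n. (int (s ''x'' u) - int t)\<^sup>2) \<le> (\<Sum>u<n. (8 * int (n ^ 4))\<^sup>2)"
      proof (intro sum_mono)
        fix u assume "u \<in> {..<n}"
        then have "s ''x'' u \<le> 8 * n ^ 4" by (simp add: x4)
        then have "\<bar>int (s ''x'' u) - int t\<bar> \<le> \<bar>8 * int (n ^ 4)\<bar>" using t4 by linarith
        then show "(int (s ''x'' u) - int t)\<^sup>2 \<le> (8 * int (n ^ 4))\<^sup>2" by (simp only: abs_le_square_iff)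
      qed
      also have "\<dots> = int (64 * n ^ 9)"
        by (simp add: power_mult_distrib power2_eq_square flip: power_add power_Suc)
      finally show ?thesis unfolding potential_def by linarith
    qed
    then have "I m0 s2 r" using inv s2 by (simp add: I_def m0_def eqf)
    moreover have "t \<le> 2 ^ b" using t n_bounds(3) by linarith
    ultimately show ?thesis using T by (simp add: s2_def t_def store_upd_apply)
  qed
  then have init: "wp b 5 (block [assign ''t'' (Mul (Const 8) (var ''T'')), assign ''g'' (Const 1)]) (\<lambda>s r. I m0 s r) s r"
    by (rule wp_vcI) (use b in \<open>auto simp: simple_expr_def\<close>)
  have loop: "wp b ((m0 + 1) * (30 * (n * n + 2) + 1)) (While (var ''g'') sweep_prog) ?Q s' r'" if "I m0 s' r'" for s' r'
  proof (rule wp_While[where I = I])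
    fix m s' r' assume I: "I m s' r'" and g: "expr_val (var ''g'') s' \<noteq> 0"
    then have inv: "search_inv k r0 t s'" and lt: "potential t (s' ''x'') < m" by (auto simp: I_def)
    show "wp b (30 * (n * n + 2)) sweep_prog (\<lambda>s r. \<exists>m'<m. I m' s r) s' r'"
    proof (rule wp_mono[OF sweep_prog_wp[OF inv k t] _ order_refl])
      fix s r assume "sweep_state k r0 t (potential t (s' ''x'')) (n * n) s"
      then have "I (potential t (s' ''x'')) s r" by (auto simp: sweep_state_def I_def)
      then show "\<exists>m'<m. I m' s r" using lt by blast
    qed
  next
    fix m s' r' assume I: "I m s' r'" and g: "expr_val (var ''g'') s' = 0"
    then show "?Q s' r'" by (auto simp: I_def)
  qed (use that b in \<open>auto simp: simple_expr_def\<close>)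
  have total: "wp b (1 + 5 + (m0 + 1) * (30 * (n * n + 2) + 1)) search_prog ?Q s r"
    unfolding search_prog_def by (rule wp_Seq, rule wp_mono[OF init loop order_refl])
  have le: "1 + 5 + (m0 + 1) * (30 * (n * n + 2) + 1) \<le> (64 * n ^ 9 + 3) * (31 * (n * n + 2))"
  proof -
    have "(m0 + 1) * (30 * (n * n + 2) + 1) \<le> (m0 + 1) * (31 * (n * n + 2))"
      by (rule mult_left_mono) simp_all
    moreover have "1 + 5 \<le> 1 * (31 * (n * n + 2))" by simp
    moreover have "(64 * n ^ 9 + 3) * (31 * (n * n + 2)) = 1 * (31 * (n * n + 2)) + (m0 + 1) * (31 * (n * n + 2))"
      by (simp add: m0_def algebra_simps)
    ultimately show ?thesis by linarith
  qed
  show ?thesis by (rule wp_mono[OF total _ le])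
qed

end

section \<open>Reading off the sparsifier\<close>

lemma sum_square_index:
  fixes f :: "nat \<Rightarrow> 'a::comm_monoid_add"
  shows "(\<Sum>j<n * m. f j) = (\<Sum>u<n. \<Sum>v<m. f (u * m + v))"
proof -
  have "(\<Sum>j<n * m. f j) = (\<Sum>u<n. sum f {u * m..<u * m + m})" by (simp add: sum.nat_group)
  also have "\<dots> = (\<Sum>u<n. \<Sum>v<m. f (u * m + v))"
  proof (rule sum.cong[OF refl])
    fix u
    show "sum f {u * m..<u * m + m} = (\<Sum>v<m. f (u * m + v))"
      by (rule sum.reindex_bij_witness[of _ "\<lambda>v. u * m + v" "\<lambda>j. j - u * m"]) auto
  qed
  finally show ?thesis .
qed

locale sparsify_graph = sparsify_run +
  fixes G :: weighted_graph and D :: nat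
  assumes reg: "regular_graph D G" and nv: "num_verts G = n"
    and adj_def: "\<And>j. adj j = of_bool (\<exists>u<n. \<exists>v<n. j = u * n + v \<and> {u, v} \<in> edges G)"
begin

definition edge_index :: "nat set \<Rightarrow> nat" where
  "edge_index e = Min e * n + Max e"

definition sample_edges :: "nat \<Rightarrow> bool list \<Rightarrow> nat set set" where
  "sample_edges k r = {e\<in>edges G. block_true k r (edge_index e)}"

lemma wf: "wf_weighted_graph G"
  using reg by (simp add: regular_graph_def)

lemma edge_index_pair: "u < v \<Longrightarrow> edge_index {u, v} = u * n + v"
  by (simp add: edge_index_def)

lemma pair_div_mod: "v < n \<Longrightarrow> (u * n + v) div n = u" "v < n \<Longrightarrow> (u * n + v) mod n = v"
  using n by auto

lemma pair_lt: "u < n \<Longrightarrow> v < n \<Longrightarrow> u * n + v < n * n"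
proof -
  assume "u < n" "v < n"
  then have "u * n + v < Suc u * n" by simp
  also have "\<dots> \<le> n * n" using \<open>u < n\<close> by (intro mult_right_mono) auto
  finally show ?thesis .
qed

lemma adj_pair: "u < n \<Longrightarrow> v < n \<Longrightarrow> adj (u * n + v) = of_bool ({u, v} \<in> edges G)"
proof -
  assume uv: "u < n" "v < n"
  have "(\<exists>u'<n. \<exists>v'<n. u * n + v = u' * n + v' \<and> {u', v'} \<in> edges G) \<longleftrightarrow> {u, v} \<in> edges G"
    using uv by (metis pair_div_mod)
  then show ?thesis by (simp add: adj_def)
qed

lemma edge_index_inj: "inj_on edge_index (edges G)"
proof (rule inj_onI)
  fix e e' assume e: "e \<in> edges G" "e' \<in> edges G" "edge_index e = edge_index e'"
  obtain u v where uv: "e = {u, v}" "u < v" "v < num_verts G" using edge_cases[OF wf e(1)] .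
  obtain u' v' where uv': "e' = {u', v'}" "u' < v'" "v' < num_verts G" using edge_cases[OF wf e(2)] .
  have "u * n + v = u' * n + v'" using e(3) uv uv' by (simp add: edge_index_pair)
  then have "u = u'" "v = v'" using pair_div_mod uv uv' nv by metis+
  then show "e = e'" using uv uv' by simp
qed

lemma edge_index_lt: "edge_index ` edges G \<subseteq> {..<n * n}"
proof
  fix j assume "j \<in> edge_index ` edges G"
  then obtain e where e: "e \<in> edges G" "j = edge_index e" by auto
  obtain u v where uv: "e = {u, v}" "u < v" "v < num_verts G" using edge_cases[OF wf e(1)] .
  then show "j \<in> {..<n * n}" using e pair_lt[of u v] nv by (simp add: edge_index_pair)
qed

lemma sampled_nonzero_iff:
  assumes "j < n * n"
  shows "sampled k r j \<noteq> 0 \<longleftrightarrow> j \<in> edge_index ` sample_edges k r"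
proof
  define u where "u = j div n"
  define v where "v = j mod n"
  have uv: "u < n" "v < n" "j = u * n + v" using div_mod_lt[of j] assms by (simp_all add: u_def v_def)
  assume "sampled k r j \<noteq> 0"
  then have s: "adj j = 1" "u < v" "block_true k r j" by (auto simp: sampled_def u_def v_def)
  then have "{u, v} \<in> edges G" using adj_pair[OF uv(1,2)] uv(3) by (cases "{u, v} \<in> edges G") simp_all
  moreover have "edge_index {u, v} = j" using s uv by (simp add: edge_index_pair)
  ultimately show "j \<in> edge_index ` sample_edges k r"
    using s by (intro image_eqI[of _ _ "{u, v}"]) (auto simp: sample_edges_def)
next
  assume "j \<in> edge_index ` sample_edges k r"
  then obtain e where e: "e \<in> edges G" "j = edge_index e" "block_true k r j" by (auto simp: sample_edges_def)
  obtain u v where uv: "e = {u, v}" "u < v" "v < num_verts G" using edge_cases[OF wf e(1)] .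
  have j: "j = u * n + v" using e uv by (simp add: edge_index_pair)
  show "sampled k r j \<noteq> 0"
    using e uv nv adj_pair[of u v] pair_div_mod[of v u] by (simp add: sampled_def j)
qed

lemma sum_adj: "(\<Sum>j<n * n. adj j) = n * D"
proof -
  have row: "real (\<Sum>v<n. adj (u * n + v)) = D" if u: "u < n" for u
  proof -
    have uw: "weight G e = 1" if "e \<in> edges G" for e
      using reg that by (auto simp: regular_graph_def unweighted_def)
    have "real (\<Sum>v<n. adj (u * n + v)) = (\<Sum>v<n. edge_weight G u v)"
      unfolding of_nat_sum by (intro sum.cong refl) (use u uw in \<open>auto simp: adj_pair edge_weight_def\<close>)
    also have "\<dots> = weighted_degree G u" using weighted_degree_eq[OF wf] nv by simp
    also have "\<dots> = D" using reg u nv uw by (simp add: weighted_degree_def regular_graph_def)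
    finally show ?thesis .
  qed
  have "real (\<Sum>j<n * n. adj j) = (\<Sum>u<n. real (\<Sum>v<n. adj (u * n + v)))"
    by (simp add: sum_square_index)
  also have "\<dots> = n * D" using row by simp
  finally show ?thesis using of_nat_eq_iff by blast
qed

lemma decode_edges:
  assumes inv: "search_inv k r t s"
  shows "edges (decode_graph n s) = sample_edges k r"
proof
  show "edges (decode_graph n s) \<subseteq> sample_edges k r"
  proof
    fix e assume "e \<in> edges (decode_graph n s)"
    then obtain u v where uv: "e = {u, v}" "u < v" "v < n" "s ''edge'' (u * n + v) \<noteq> 0"
      by (auto simp: decode_graph_def)
    have lt: "u * n + v < n * n" using uv pair_lt by simp
    then have "sampled k r (u * n + v) \<noteq> 0" using uv inv by (simp add: search_inv_def)
    then have "u * n + v \<in> edge_index ` sample_edges k r" using sampled_nonzero_iff[OF lt] by simp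
    then obtain e' where e': "e' \<in> sample_edges k r" "edge_index e' = u * n + v" by auto
    then have "e' \<in> edges G" by (simp add: sample_edges_def)
    then obtain a c where ac: "e' = {a, c}" "a < c" "c < num_verts G" by (rule edge_cases[OF wf])
    then have "a * n + c = u * n + v" using e' by (simp add: edge_index_pair)
    then have "a = u" "c = v" using pair_div_mod ac uv nv by metis+
    then show "e \<in> sample_edges k r" using e' ac uv by simp
  qed
  show "sample_edges k r \<subseteq> edges (decode_graph n s)"
  proof
    fix e assume e: "e \<in> sample_edges k r"
    then have "e \<in> edges G" by (simp add: sample_edges_def)
    then obtain u v where uv: "e = {u, v}" "u < v" "v < num_verts G" by (rule edge_cases[OF wf])
    have lt: "u * n + v < n * n" using uv nv pair_lt by simp
    have "u * n + v \<in> edge_index ` sample_edges k r"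
      using e uv by (intro image_eqI[of _ _ e]) (auto simp: edge_index_pair)
    then have "s ''edge'' (u * n + v) \<noteq> 0"
      using sampled_nonzero_iff[OF lt] inv lt by (simp add: search_inv_def)
    then show "e \<in> edges (decode_graph n s)" using uv nv by (auto simp: decode_graph_def)
  qed
qed

lemma weight_sum_eq:
  assumes inv: "search_inv k r t s" and u: "u < n"
  shows "weight_sum (sample_edges k r) (\<lambda>e. s ''num'' (edge_index e)) u = s ''x'' u"
proof -
  let ?F = "sample_edges k r"
  let ?h = "\<lambda>j. if j div n = u \<or> j mod n = u then s ''num'' j else 0"
  have sub: "?F \<subseteq> edges G" by (auto simp: sample_edges_def)
  have inj: "inj_on edge_index ?F" using edge_index_inj sub by (rule inj_on_subset)
  have "s ''x'' u = (\<Sum>j<n * n. ?h j)" using inv u by (simp add: search_inv_def index_degree_def)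
  also have "\<dots> = (\<Sum>j\<in>edge_index ` ?F. ?h j)"
  proof (rule sum.mono_neutral_right)
    show "edge_index ` ?F \<subseteq> {..<n * n}" using edge_index_lt sub by blast
    show "\<forall>j\<in>{..<n * n} - edge_index ` ?F. ?h j = 0"
      using sampled_nonzero_iff[of _ k r] inv by (auto simp: search_inv_def)
  qed simp
  also have "\<dots> = (\<Sum>e\<in>?F. ?h (edge_index e))" using inj by (simp add: sum.reindex)
  also have "\<dots> = (\<Sum>e\<in>?F. if u \<in> e then s ''num'' (edge_index e) else 0)"
  proof (intro sum.cong refl)
    fix e assume "e \<in> ?F"
    then have "e \<in> edges G" using sub by blast
    then obtain a c where ac: "e = {a, c}" "a < c" "c < num_verts G" by (rule edge_cases[OF wf])
    have "(edge_index e div n = u \<or> edge_index e mod n = u) \<longleftrightarrow> u \<in> e"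
      using ac nv pair_div_mod[of c a] by (auto simp: edge_index_pair)
    then show "?h (edge_index e) = (if u \<in> e then s ''num'' (edge_index e) else 0)" by simp
  qed
  also have "\<dots> = weight_sum ?F (\<lambda>e. s ''num'' (edge_index e)) u"
    unfolding weight_sum_def using finite_subset[OF sub finite_edges[OF wf]] by (simp add: sum.inter_filter)
  finally show ?thesis ..
qed

lemma search_locally_optimal:
  assumes inv: "search_inv k r t s" and opt: "\<And>j. j < n * n \<Longrightarrow> optimal_at k r t s j"
  shows "locally_optimal (sample_edges k r) (2 ^ k * n) t (\<lambda>e. s ''num'' (edge_index e))"
  unfolding locally_optimal_def
proof (intro conjI ballI allI impI)
  fix e assume e: "e \<in> sample_edges k r"
  then have lt: "edge_index e < n * n" using edge_index_lt by (auto simp: sample_edges_def)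
  then have "sampled k r (edge_index e) \<noteq> 0" using sampled_nonzero_iff e by blast
  then show "2 ^ k * n \<le> s ''num'' (edge_index e)" "s ''num'' (edge_index e) \<le> 32 * (2 ^ k * n)"
    using inv lt by (auto simp: search_inv_def)
next
  fix u v :: nat
  assume uv: "u \<noteq> v \<and> {u, v} \<in> sample_edges k r"
  let ?W = "weight_sum (sample_edges k r) (\<lambda>e. s ''num'' (edge_index e))"
  have main: "(2 * t + 2 \<le> ?W a + ?W c \<longrightarrow> s ''num'' (edge_index {a, c}) = 2 ^ k * n) \<and>
      (?W a + ?W c + 2 \<le> 2 * t \<longrightarrow> s ''num'' (edge_index {a, c}) = 32 * (2 ^ k * n))"
    if ac: "a < c" "{a, c} \<in> sample_edges k r" for a c
  proof -
    have "{a, c} \<in> edges G" using ac by (simp add: sample_edges_def)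
    then have cn: "c < n" using wf nv by (auto simp: wf_weighted_graph_def)
    have j: "edge_index {a, c} = a * n + c" using ac by (simp add: edge_index_pair)
    have lt: "a * n + c < n * n" using ac cn pair_lt by simp
    have "a * n + c \<in> edge_index ` sample_edges k r" using ac j by (metis imageI)
    then have "sampled k r (a * n + c) \<noteq> 0" using sampled_nonzero_iff[OF lt] by simp
    then show ?thesis
      using opt[OF lt] weight_sum_eq[OF inv, of a] weight_sum_eq[OF inv, of c] ac cn
      by (simp add: optimal_at_def j pair_div_mod)
  qed
  have "(2 * t + 2 \<le> ?W u + ?W v \<longrightarrow> s ''num'' (edge_index {u, v}) = 2 ^ k * n) \<and>
      (?W u + ?W v + 2 \<le> 2 * t \<longrightarrow> s ''num'' (edge_index {u, v}) = 32 * (2 ^ k * n))"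
    using main[of u v] main[of v u] uv by (cases "u < v") (auto simp: insert_commute add.commute)
  then show "2 * t + 2 \<le> ?W u + ?W v \<Longrightarrow> s ''num'' (edge_index {u, v}) = 2 ^ k * n"
    "?W u + ?W v + 2 \<le> 2 * t \<Longrightarrow> s ''num'' (edge_index {u, v}) = 32 * (2 ^ k * n)" by blast+
qed

lemma decode_weight:
  assumes inv: "search_inv k r t s" and e: "e \<in> sample_edges k r"
  shows "weight (decode_graph n s) e = real (s ''num'' (edge_index e)) / real (8 * n)"
proof -
  have "edge_index e < n * n" using e edge_index_lt by (auto simp: sample_edges_def)
  then have "s ''den'' (edge_index e) = 8 * n" using inv by (simp add: search_inv_def)
  then show ?thesis by (simp add: decode_graph_def edge_index_def Let_def)
qed

text \<open>The sampling rate \<open>1 / 2 ^ k\<close> is about \<open>L\<^sup>2 / (\<epsilon> * n)\<close>, where \<open>\<epsilon> = p / q\<close> and \<open>L\<close> is about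
  \<open>log 2 n\<close>.\<close>

definition rate_ok :: "nat \<Rightarrow> bool" where
  "rate_ok k \<longleftrightarrow> 2 ^ k \<le> n \<and> (\<exists>L. n < 2 ^ L \<and> 2 ^ L \<le> 2 * n \<and> 2 ^ k * (L * L) * q \<le> p * n \<and>
     p * n < 2 * 2 ^ k * (L * L) * q)"

text \<open>The program promises some \<open>k\<close> on each tape. Uniqueness makes it the same
  for all tapes, so that one good event can be fixed beforehand. \<open>L\<close> is pinned down by
  \<open>n < 2 ^ L\<close> and \<open>2 ^ L \<le> 2 * n\<close>; then
  \<open>2 ^ k * (L * L) * q\<close> lies above \<open>p * n / 2\<close> and not above
  \<open>p * n\<close>, which leaves one power of two.\<close>

lemma rate_ok_unique:
  assumes "rate_ok k" "rate_ok k'"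
  shows "k = k'"
proof -
  have L: "L \<le> L'" if "n < 2 ^ L" "2 ^ L \<le> 2 * n" "n < 2 ^ L'" "2 ^ L' \<le> 2 * n" for L L'
  proof -
    have "2 ^ L < (2::nat) * 2 ^ L'" using that by linarith
    then have "(2::nat) ^ L < 2 ^ Suc L'" by simp
    then have "L < Suc L'" by (rule power_less_imp_less_exp[rotated]) simp
    then show ?thesis by simp
  qed
  have le: "k \<le> k'" if ok: "rate_ok k" "rate_ok k'" for k k'
  proof -
    obtain L where 1: "n < 2 ^ L" "2 ^ L \<le> 2 * n" "2 ^ k * (L * L) * q \<le> p * n"
      using ok(1) unfolding rate_ok_def by blast
    obtain L' where 2: "n < 2 ^ L'" "2 ^ L' \<le> 2 * n" "p * n < 2 * 2 ^ k' * (L' * L') * q"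
      using ok(2) unfolding rate_ok_def by blast
    have "L = L'" using L[OF 1(1,2) 2(1,2)] L[OF 2(1,2) 1(1,2)] by simp
    then have "2 ^ k * ((L * L) * q) < 2 ^ Suc k' * ((L * L) * q)"
      using le_less_trans[OF 1(3) 2(3)] by (simp only: mult.assoc power_Suc)
    then have "(2::nat) ^ k < 2 ^ Suc k'" by (rule mult_less_cancel2[THEN iffD1, THEN conjunct2])
    then have "k < Suc k'" by (rule power_less_imp_less_exp[rotated]) simp
    then show ?thesis by simp
  qed
  show ?thesis using le[OF assms] le[OF assms(2,1)] by simp
qed

lemma sparsify_prog_wp:
  assumes s: "base s" "s ''L'' 0 = 0" "s ''k'' 0 = 0" and len: "n * n * n \<le> length r0"
  shows "wp b (2 + 50 * (n + 2) + 100 * (n + 2) ^ 3 + (64 * n ^ 9 + 3) * (31 * (n * n + 2))) sparsify_prog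
    (\<lambda>s r. \<exists>k. rate_ok k \<and> search_inv k r0 (8 * n * D) s \<and> (\<forall>j<n * n. optimal_at k r0 (8 * n * D) s j)) s r0"
proof -
  let ?Q = "\<lambda>s (r::bool list). \<exists>k. rate_ok k \<and> search_inv k r0 (8 * n * D) s \<and> (\<forall>j<n * n. optimal_at k r0 (8 * n * D) s j)"
  let ?N2 = "100 * (n + 2) ^ 3" and ?N3 = "(64 * n ^ 9 + 3) * (31 * (n * n + 2))"
  have w2: "wp b (1 + ?N2 + ?N3) (Seq sample_prog search_prog) ?Q s r"
    if h: "base s \<and> (\<exists>k. params s k) \<and> r = r0" for s r
  proof -
    obtain k where k: "params s k" using h by blast
    have ok: "rate_ok k" "2 ^ k \<le> n" using k by (auto simp: params_def rate_ok_def)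
    have "k \<le> n" using ok(2) less_exp[of k] by linarith
    then have "n * n * k \<le> n * n * n" by (rule mult_left_mono) simp
    then have len': "n * n * k \<le> length r0" using len by linarith
    have 1: "wp b ?N2 sample_prog (\<lambda>s r. sample_frame k r0 (n * n) s \<and> s ''T'' 0 = (\<Sum>j<n * n. adj j)) s r0"
      using sample_prog_wp[OF _ k len'] h by blast
    show ?thesis
    proof (rule wp_Seq)
      show "wp b ?N2 sample_prog (wp b ?N3 search_prog ?Q) s r"
        unfolding h[THEN conjunct2, THEN conjunct2]
      proof (rule wp_mono[OF 1 _ order_refl])
        fix s r assume sf: "sample_frame k r0 (n * n) s \<and> s ''T'' 0 = (\<Sum>j<n * n. adj j)"
        have t: "8 * (\<Sum>j<n * n. adj j) = 8 * n * D" by (simp add: sum_adj)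
        have S: "wp b ?N3 search_prog (\<lambda>s r. search_inv k r0 (8 * n * D) s \<and>
            (\<forall>j<n * n. optimal_at k r0 (8 * n * D) s j)) s r"
          using search_prog_wp[OF conjunct1[OF sf] conjunct2[OF sf] ok(2), of r] unfolding t .
        show "wp b ?N3 search_prog ?Q s r"
          by (rule wp_mono[OF S _ order_refl]) (use ok(1) in blast)
      qed
    qed
  qed
  have total: "wp b (1 + 50 * (n + 2) + (1 + ?N2 + ?N3)) sparsify_prog ?Q s r0"
    unfolding sparsify_prog_def
    by (rule wp_Seq, rule wp_mono[OF params_prog_wp[OF s] w2 order_refl])
  show ?thesis by (rule wp_mono[OF total]) simp_all
qed

end

section \<open>Parameters and the main theorem\<close>

text \<open>The condition on \<open>n powr 0.01\<close> lets the rate loop start, since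
  \<open>\<epsilon> * n\<close> exceeds that power. The last three become \<open>h1\<close> to
  \<open>h3\<close> of \<open>locally_optimal_sparsifier\<close> for
  \<open>\<kappa> = 2 * ln n\<close>, where the rate makes \<open>\<epsilon> * (p * D)\<close> at
  least \<open>\<beta> * (ln n)\<^sup>2\<close>. The number 150 absorbs the constants of the edge
  count, and 40 keeps the failure probability at most 1/3.\<close>

definition large_enough :: "real \<Rightarrow> real \<Rightarrow> nat \<Rightarrow> bool" where
  "large_enough \<beta> \<gamma> n \<longleftrightarrow> n \<ge> 40 \<and> 150 \<le> ln (real n) \<and> (1 + log 2 (real n))\<^sup>2 \<le> real n powr 0.01 \<and>
     850 \<le> \<beta> * ln (real n) \<and> 16 \<le> \<gamma> * (\<beta> * ln (real n)) \<and> 10 ^ 7 \<le> \<gamma>\<^sup>2 * (\<beta> * ln (real n))"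

lemma eventually_large_enough:
  assumes "\<beta> > 0" "\<gamma> > 0"
  obtains N where "\<And>n. n \<ge> N \<Longrightarrow> large_enough \<beta> \<gamma> n"
proof -
  have ln: "eventually (\<lambda>n. c \<le> ln (real n)) sequentially" for c :: real
  proof -
    have "filterlim (\<lambda>n. ln (real n)) at_top sequentially" by real_asymp
    then show ?thesis by (simp add: filterlim_at_top)
  qed
  have "eventually (\<lambda>n. n \<ge> 40 \<and> 150 \<le> ln (real n) \<and> (1 + log 2 (real n))\<^sup>2 \<le> real n powr 0.01 \<and>
      850 / \<beta> \<le> ln (real n) \<and> 16 / (\<gamma> * \<beta>) \<le> ln (real n) \<and> 10 ^ 7 / (\<gamma>\<^sup>2 * \<beta>) \<le> ln (real n)) sequentially"
    by (intro eventually_conj ln eventually_ge_at_top) real_asymp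
  then obtain N where N: "\<And>n. n \<ge> N \<Longrightarrow> n \<ge> 40 \<and> 150 \<le> ln (real n) \<and> (1 + log 2 (real n))\<^sup>2 \<le> real n powr 0.01 \<and>
      850 / \<beta> \<le> ln (real n) \<and> 16 / (\<gamma> * \<beta>) \<le> ln (real n) \<and> 10 ^ 7 / (\<gamma>\<^sup>2 * \<beta>) \<le> ln (real n)"
    unfolding eventually_sequentially by blast
  show ?thesis
  proof (rule that[of N])
    fix n assume "n \<ge> N"
    from N[OF this] show "large_enough \<beta> \<gamma> n"
      using assms by (simp add: large_enough_def field_simps)
  qed
qed

text \<open>A crude estimate: the budget is at most \<open>5056 * z ^ 11\<close> and a step at most
  \<open>21141 * z\<close>. The product of the two constants is below \<open>2 ^ 27\<close>, hence
  below \<open>z ^ 27\<close>.\<close>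

lemma running_time_le:
  fixes n z :: nat
  assumes "n \<le> z" "z \<ge> 2"
  shows "(2 + 50 * (n + 2) + 100 * (n + 2) ^ 3 + (64 * n ^ 9 + 3) * (31 * (n * n + 2))) *
    step_cost (5 + 4 * z) \<le> z ^ 39"
proof -
  have pw: "z ^ i \<le> z ^ 11" if "i \<le> 11" for i using that assms by (intro power_increasing) auto
  have a: "n + 2 \<le> 2 * z" using assms by simp
  have c1: "2 + 50 * (n + 2) \<le> 102 * z ^ 11"
    using a pw[of 0] pw[of 1] by simp
  have "(n + 2) ^ 3 \<le> (2 * z) ^ 3" by (rule power_mono[OF a]) simp
  then have c2: "100 * (n + 2) ^ 3 \<le> 800 * z ^ 11" using pw[of 3] by (simp add: power_mult_distrib)
  have "n ^ 9 \<le> z ^ 9" using assms by (intro power_mono) auto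
  moreover have "1 \<le> z ^ 9" using assms by simp
  ultimately have d1: "64 * n ^ 9 + 3 \<le> 67 * z ^ 9" by linarith
  have "n * n \<le> z * z" "2 * 2 \<le> z * z" using assms by (simp_all only: mult_le_mono)
  then have d2: "31 * (n * n + 2) \<le> 62 * z ^ 2" by (simp add: power2_eq_square)
  have "(64 * n ^ 9 + 3) * (31 * (n * n + 2)) \<le> 67 * z ^ 9 * (62 * z ^ 2)"
    by (rule mult_le_mono[OF d1 d2])
  then have c3: "(64 * n ^ 9 + 3) * (31 * (n * n + 2)) \<le> 4154 * z ^ 11"
    by (simp add: power_add[symmetric])
  have c: "2 + 50 * (n + 2) + 100 * (n + 2) ^ 3 + (64 * n ^ 9 + 3) * (31 * (n * n + 2)) \<le> 5056 * z ^ 11"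
    using c1 c2 c3 by linarith
  have s: "step_cost (5 + 4 * z) \<le> 21141 * z" using assms by (simp add: step_cost_def)
  have "(2::nat) ^ 27 \<le> z ^ 27" using assms by (intro power_mono) auto
  then have z27: "106888896 \<le> z ^ 27" by simp
  have "(2 + 50 * (n + 2) + 100 * (n + 2) ^ 3 + (64 * n ^ 9 + 3) * (31 * (n * n + 2))) *
    step_cost (5 + 4 * z) \<le> 5056 * z ^ 11 * (21141 * z)" by (rule mult_le_mono[OF c s])
  also have "\<dots> = 106888896 * z ^ 12" using power_add[of z 11 1] by simp
  also have "\<dots> \<le> z ^ 27 * z ^ 12" by (rule mult_right_mono[OF z27]) simp
  finally show ?thesis by (simp add: power_add[symmetric])
qed

text \<open>The cut around a single vertex weighs at most \<open>D\<close>, which limits \<gamma>.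
  In \<open>sparsifier_edge_bound\<close> these bounds make the exponent at least 3.\<close>

lemma regular_degree_bounds:
  assumes reg: "regular_graph D G" and nv: "num_verts G = n" and n: "n \<ge> 2"
    and expa: "edge_expansion G \<ge> \<gamma> * real D" and D: "D > 0"
  shows "D \<le> n" "\<gamma> \<le> 1"
proof -
  have wf: "wf_weighted_graph G" and uw: "unweighted G" and deg: "card {e\<in>edges G. 0 \<in> e} = D"
    using reg nv n by (auto simp: regular_graph_def)
  have wd: "weighted_degree G 0 = D" using deg uw by (simp add: weighted_degree_def unweighted_def)
  have le1: "edge_weight G 0 v \<le> 1" for v using uw by (simp add: edge_weight_def unweighted_def)
  have "real D = (\<Sum>v<n. edge_weight G 0 v)" using wd weighted_degree_eq[OF wf, of 0] nv by simp
  also have "\<dots> \<le> (\<Sum>v<n. 1)" by (intro sum_mono le1)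
  finally show "D \<le> n" by simp
  have "\<gamma> * real D * card {0::nat} \<le> cut_weight G {0}"
    using cut_weight_expansion[OF expa, of "{0}"] nv n by simp
  also have "\<dots> = (\<Sum>v\<in>{..<n} - {0}. edge_weight G 0 v)"
    using cut_weight_eq[OF wf, of "{0}"] nv n by simp
  also have "\<dots> \<le> (\<Sum>v<n. edge_weight G 0 v)"
    by (intro sum_mono2) (auto intro: edge_weight_nonneg[OF wf])
  also have "\<dots> = D" using wd weighted_degree_eq[OF wf, of 0] nv by simp
  finally show "\<gamma> \<le> 1" using D by simp
qed

text \<open>Tapes of the fixed length \<open>T\<close> are counted, and every failing one is charged
  to a bad sample. The edge bound keeps a factor 2 in reserve, to be spent on approximating a real
  accuracy by a rational one.\<close>

lemma sparsify_prog_correct: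
  fixes \<beta> \<gamma> :: real and p q :: nat
  assumes large: "large_enough \<beta> \<gamma> n" and beta: "\<beta> > 0" and gamma: "\<gamma> > 0"
    and reg: "regular_graph D G" and nv: "num_verts G = n" and D: "real D \<ge> \<beta> * real n"
    and expa: "edge_expansion G \<ge> \<gamma> * real D"
    and eps: "\<epsilon> = real p / real q" "1 / real n powr 0.99 < \<epsilon>" "\<epsilon> < 1"
    and T: "T = instance_size (G, p, q) ^ 41 + 41"
  shows "\<And>r. length r = T \<Longrightarrow> \<exists>t s' r'. exec sparsify_prog (encode_instance (G, p, q)) r t s' r' \<and> t \<le> T"
    and "2 / 3 * 2 ^ T \<le> real (card {r. length r = T \<and> (\<exists>t s' r'.
      exec sparsify_prog (encode_instance (G, p, q)) r t s' r' \<and>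
      resistance_sparsifier \<epsilon> G (decode_graph n s') \<and>
      2 * real (card (edges (decode_graph n s'))) \<le> 1 / \<epsilon> * real n * ln (real n) ^ 3)})"
proof -
  define x where "x = ln (real n)"
  have lg: "n \<ge> 40" "150 \<le> x" "(1 + log 2 (real n))\<^sup>2 \<le> real n powr 0.01"
     "850 \<le> \<beta> * x" "16 \<le> \<gamma> * (\<beta> * x)" "10 ^ 7 \<le> \<gamma>\<^sup>2 * (\<beta> * x)"
    using large by (auto simp: large_enough_def x_def)
  have n0: "n > 0" using lg by simp
  have eps0: "\<epsilon> > 0"
  proof -
    have "1 / real n powr 0.99 > 0" using n0 by simp
    then show ?thesis using eps(2) by linarith
  qed
  then have pq0: "p > 0" "q > 0" using eps(1) by (auto intro!: Nat.gr0I)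
  have pq: "p < q" using eps pq0 by simp
  define z where "z = instance_size (G, p, q)"
  \<comment> \<open>\<open>32 * n ^ 4 \<le> 2 ^ 5 * (2 ^ z) ^ 4\<close>, while \<open>p\<close> and
    \<open>q\<close> have at most \<open>z\<close> bits.\<close>
  define b where "b = 5 + 4 * z"
  have zn: "n * n \<le> z" "floorlog 2 p \<le> z" "floorlog 2 q \<le> z"
    using nv by (auto simp: z_def power2_eq_square)
  have "n * 1 \<le> n * n" using n0 by (intro mult_left_mono) auto
  then have nz: "n \<le> z" using zn by linarith
  have z2: "z \<ge> 2" using nz lg by linarith
  define adj where "adj = (\<lambda>i. of_bool (\<exists>u<n. \<exists>v<n. i = u * n + v \<and> {u, v} \<in> edges G) :: nat)"
  have n4: "32 * n ^ 4 \<le> 2 ^ b"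
  proof -
    have "n ^ 4 \<le> (2 ^ z) ^ 4" using nz less_exp[of z] by (intro power_mono) linarith+
    then have "32 * n ^ 4 \<le> 2 ^ 5 * (2 ^ z) ^ 4" by simp
    also have "\<dots> = 2 ^ b" by (simp add: b_def power_add power_mult mult.commute)
    finally show ?thesis .
  qed
  have two_log: "log 2 n < L \<and> real L \<le> 1 + log 2 n" if "n < 2 ^ L" "2 ^ L \<le> 2 * n" for L
  proof
    have "real n < 2 powr real L" using that(1) by (simp add: powr_realpow)
    then show "log 2 n < L" using n0 by (simp add: log_less_iff)
    have "2 powr real L \<le> 2 * real n" using of_nat_mono[OF that(2), where 'a = real] by (simp add: powr_realpow)
    then have "real L \<le> log 2 (2 * real n)" using n0 by (simp add: le_log_iff)
    then show "real L \<le> 1 + log 2 n" using n0 by (simp add: log_mult)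
  qed
  interpret sparsify_graph n p q b adj G D
  proof
    show "L * L * q \<le> p * n" if L: "n < 2 ^ L" "2 ^ L \<le> 2 * n" for L
    proof -
      have "real L ^ 2 \<le> (1 + log 2 n)\<^sup>2" using two_log[OF L] by (intro power_mono) auto
      also have "\<dots> \<le> real n powr 0.01" by (rule lg)
      also have "\<dots> = 1 / real n powr 0.99 * n"
      proof -
        have "real n powr 0.01 * real n powr 0.99 = n"
          unfolding powr_add[symmetric] using n0 by simp
        then show ?thesis using n0 by (simp add: field_simps)
      qed
      also have "\<dots> \<le> \<epsilon> * n" using eps(2) by (intro mult_right_mono) auto
      finally have "real (L * L) * q \<le> \<epsilon> * n * q" by (simp add: power2_eq_square mult_right_mono)
      also have "\<dots> = real (p * n)" using eps(1) pq0 by simp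
      finally show ?thesis by (simp only: of_nat_mult[symmetric] of_nat_le_iff)
    qed
  qed (use n0 pq n4 reg nv in \<open>auto simp: b_def adj_def\<close>)
  let ?s = "encode_instance (G, p, q)"
  have base: "base ?s" "?s ''L'' 0 = 0" "?s ''k'' 0 = 0"
    using nv by (auto simp: base_def adj_def)
  have le2b: "m \<le> 2 ^ b" if "floorlog 2 m \<le> z" for m
  proof -
    have "m < 2 ^ floorlog 2 m" by (rule floorlog_leD) auto
    also have "\<dots> \<le> 2 ^ b" using that by (intro power_increasing) (auto simp: b_def)
    finally show ?thesis by simp
  qed
  have "n \<le> 2 ^ b" using n_bounds(1) by linarith
  then have sle: "store_le (2 ^ b) ?s"
    using le2b[of p] le2b[of q] zn nv by (auto simp: store_le_def)
  have len: "n * n * n \<le> T"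
  proof -
    have "n * n * n \<le> z * z" using zn(1) nz by (rule mult_le_mono)
    also have "\<dots> = z ^ 2" by (simp add: power2_eq_square)
    also have "\<dots> \<le> z ^ 41" using z2 by (intro power_increasing) auto
    finally show ?thesis by (simp add: T z_def)
  qed
  have run: "\<exists>t s' r' k. exec sparsify_prog ?s r t s' r' \<and> t \<le> T \<and> rate_ok k \<and>
      search_inv k r (8 * n * D) s' \<and> (\<forall>j<n * n. optimal_at k r (8 * n * D) s' j)"
    if r: "length r = T" for r
  proof -
    have "n * n * n \<le> length r" using len r by simp
    from sparsify_prog_wp[OF base this] sle obtain t s' r' k where
      e: "exec sparsify_prog ?s r t s' r'" "rate_ok k"
      "search_inv k r (8 * n * D) s'" "\<forall>j<n * n. optimal_at k r (8 * n * D) s' j"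
      and t: "t \<le> (2 + 50 * (n + 2) + 100 * (n + 2) ^ 3 + (64 * n ^ 9 + 3) * (31 * (n * n + 2))) * step_cost b"
      unfolding wp_def by blast
    note t
    also have "\<dots> \<le> z ^ 39" unfolding b_def by (rule running_time_le[OF nz z2])
    also have "\<dots> \<le> z ^ 41" using z2 by (intro power_increasing) auto
    finally have "t \<le> T" by (simp add: T z_def)
    then show ?thesis using e by blast
  qed
  then show "\<And>r. length r = T \<Longrightarrow> \<exists>t s' r'. exec sparsify_prog ?s r t s' r' \<and> t \<le> T" by blast
  \<comment> \<open>Any tape of length \<open>T\<close> would do; it only serves to extract the
    rate, which all tapes share.\<close>
  obtain k where k: "rate_ok k" using run[of "replicate T True"] by auto
  obtain L where kn: "2 ^ k \<le> n" and L: "n < 2 ^ L" "2 ^ L \<le> 2 * n" and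
    k1: "2 ^ k * (L * L) * q \<le> p * n" and k2: "p * n < 2 * 2 ^ k * (L * L) * q"
    using k unfolding rate_ok_def by blast
  define pr :: real where "pr = 1 / 2 ^ k"
  have pr: "0 < pr" "pr \<le> 1" by (simp_all add: pr_def)
  have x0: "x > 0" using lg by simp
  have xL: "x \<le> L"
  proof -
    have "ln 2 \<le> (1::real)" using ln_le_minus_one[of "2::real"] by simp
    then have "x \<le> log 2 n" using x0 by (simp add: log_def x_def field_simps mult_left_le)
    then show ?thesis using two_log[OF L] by linarith
  qed
  have Lx: "L \<le> 3 * x"
  proof -
    have "exp (1 / 2) \<le> (2::real)"
    proof -
      have "exp (1 / 2 :: real) ^ 2 \<le> 2 ^ 2" using exp_le by (simp add: exp_double[symmetric])
      then show ?thesis by (rule power2_le_imp_le) simp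
    qed
    then have "1 / 2 \<le> ln (2::real)" using ln_ge_iff[of 2 "1 / 2"] by (simp only: zero_less_numeral)
    then have "log 2 n \<le> 2 * x" using x0 by (simp add: log_def x_def field_simps)
    then show ?thesis using two_log[OF L] lg(2) by linarith
  qed
  have low: "x ^ 2 \<le> \<epsilon> * (pr * n)"
  proof -
    have "real (2 ^ k * (L * L) * q) \<le> real (p * n)" using k1 by (simp only: of_nat_le_iff)
    then have "real L ^ 2 \<le> \<epsilon> * (pr * n)"
      using pq0 by (simp add: eps(1) pr_def field_simps power2_eq_square)
    moreover have "x ^ 2 \<le> real L ^ 2" using xL x0 by (intro power_mono) auto
    ultimately show ?thesis by linarith
  qed
  \<comment> \<open>18 = 2 * 3^2: a factor 2 from the rate loop, and
    \<open>L \<le> 3 * x\<close>.\<close>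
  have up: "\<epsilon> * (pr * n) \<le> 18 * x ^ 2"
  proof -
    have "real (p * n) \<le> real (2 * 2 ^ k * (L * L) * q)" using k2 by (simp only: of_nat_le_iff)
    then have "\<epsilon> * (pr * n) \<le> 2 * real L ^ 2"
      using pq0 by (simp add: eps(1) pr_def field_simps power2_eq_square)
    moreover have "real L ^ 2 \<le> (3 * x) ^ 2" using Lx by (intro power_mono) auto
    ultimately show ?thesis by (simp add: power_mult_distrib)
  qed
  have "\<beta> * n > 0" using beta n0 by simp
  then have D0: "D > 0" using D by (metis of_nat_0 not_less gr0I order.strict_iff_not order_trans)
  note Dn = regular_degree_bounds[OF reg nv _ expa D0]
  have prD: "\<beta> * x ^ 2 \<le> \<epsilon> * (pr * D)"
  proof -
    have "\<beta> * x ^ 2 \<le> \<beta> * (\<epsilon> * (pr * n))" using low beta by (intro mult_left_mono) auto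
    also have "\<dots> = \<epsilon> * (pr * (\<beta> * n))" by simp
    also have "\<dots> \<le> \<epsilon> * (pr * D)" using D eps0 pr by (intro mult_left_mono) auto
    finally show ?thesis .
  qed
  have prD': "\<beta> * x ^ 2 \<le> pr * D"
  proof -
    have "\<epsilon> * (pr * D) \<le> 1 * (pr * D)" using eps pr by (intro mult_right_mono) auto
    then show ?thesis using prD by linarith
  qed
  define \<kappa> where "\<kappa> = 2 * x"
  have h1: "425 * \<kappa> \<le> \<epsilon> * (pr * D)"
  proof -
    have "850 * x \<le> \<beta> * x * x" using lg(4) x0 by (intro mult_right_mono) auto
    then show ?thesis using prD by (simp add: \<kappa>_def power2_eq_square mult.assoc)
  qed
  have h2: "8 * \<kappa> \<le> \<gamma> * (pr * D)"
  proof -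
    have "16 * x \<le> \<gamma> * (\<beta> * x) * x" using lg(5) x0 by (intro mult_right_mono) auto
    also have "\<dots> = \<gamma> * (\<beta> * x ^ 2)" by (simp add: power2_eq_square)
    also have "\<dots> \<le> \<gamma> * (pr * D)" using prD' gamma by (intro mult_left_mono) auto
    finally show ?thesis by (simp add: \<kappa>_def)
  qed
  have h3: "10 ^ 7 \<le> \<gamma>\<^sup>2 * (\<epsilon> * (pr * D))"
  proof -
    have "10 ^ 7 * 1 \<le> \<gamma>\<^sup>2 * (\<beta> * x) * x" using lg(2,6) x0 by (intro mult_mono) auto
    also have "\<dots> = \<gamma>\<^sup>2 * (\<beta> * x ^ 2)" by (simp add: power2_eq_square)
    also have "\<dots> \<le> \<gamma>\<^sup>2 * (\<epsilon> * (pr * D))" using prD by (intro mult_left_mono) auto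
    finally show ?thesis by simp
  qed
  define Good where "Good = {r\<in>bitlists T. good_sample n (edges G) pr \<kappa> (sample_edges k r)}"
  define Corr where "Corr = {r. length r = T \<and> (\<exists>t s' r'. exec sparsify_prog ?s r t s' r' \<and>
      resistance_sparsifier \<epsilon> G (decode_graph n s') \<and>
      2 * real (card (edges (decode_graph n s'))) \<le> 1 / \<epsilon> * real n * ln (real n) ^ 3)}"
  have "Good \<subseteq> Corr"
  proof
    fix r assume r: "r \<in> Good"
    then have len_r: "length r = T" and good: "good_sample n (edges G) pr \<kappa> (sample_edges k r)"
      by (auto simp: Good_def bitlists_def)
    obtain t s' r' k' where e: "exec sparsify_prog ?s r t s' r'" "rate_ok k'"
      "search_inv k' r (8 * n * D) s'" "\<forall>j<n * n. optimal_at k' r (8 * n * D) s' j"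
      using run[OF len_r] by blast
    have kk: "k' = k" by (rule rate_ok_unique[OF e(2) k])
    note inv = e(3)[unfolded kk]
    have Hedges: "edges (decode_graph n s') = sample_edges k r" by (rule decode_edges[OF inv])
    have sub: "sample_edges k r \<subseteq> edges G" by (auto simp: sample_edges_def)
    have "resistance_sparsifier \<epsilon> G (decode_graph n s')"
    proof (rule locally_optimal_sparsifier[OF reg nv n0 expa gamma eps0 eps(3) pr_def good sub])
      show "locally_optimal (sample_edges k r) (2 ^ k * n) (8 * n * D) (\<lambda>e. s' ''num'' (edge_index e))"
        using e(4) kk by (intro search_locally_optimal[OF inv]) auto
      show "num_verts (decode_graph n s') = n" by (simp add: decode_graph_def)
      show "edges (decode_graph n s') = sample_edges k r" by (rule Hedges)
      show "weight (decode_graph n s') e = real (s' ''num'' (edge_index e)) / real (8 * n)"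
        if "e \<in> sample_edges k r" for e by (rule decode_weight[OF inv that])
      show "\<kappa> \<ge> 2" using lg(2) by (simp add: \<kappa>_def)
    qed (rule h1 h2 h3)+
    moreover have "2 * real (card (edges (decode_graph n s'))) \<le> 1 / \<epsilon> * real n * ln (real n) ^ 3"
    proof -
      have "2 * real (card (sample_edges k r)) \<le> n * (8 * pr * D + \<kappa>)"
        by (rule good_sample_card_le[OF reg nv good sub])
      also have "\<dots> \<le> n * (1 / \<epsilon> * x ^ 3)"
      proof (intro mult_left_mono)
        have "\<epsilon> * (pr * D) \<le> \<epsilon> * (pr * n)" using Dn(1) lg(1) eps0 pr by (intro mult_left_mono) auto
        then have "\<epsilon> * (pr * D) \<le> 18 * x ^ 2" using up by linarith
        then have a: "8 * pr * D \<le> 1 / \<epsilon> * (144 * x ^ 2)" using eps0 by (simp add: field_simps)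
        have c: "\<kappa> \<le> 1 / \<epsilon> * \<kappa>" using eps0 eps(3) x0 by (simp add: \<kappa>_def field_simps)
        \<comment> \<open>144 = 8 * 18, from the upper tail and the rate; the third logarithm
          absorbs this constant together with \<kappa>.\<close>
        have "144 * x ^ 2 + 2 * x \<le> x ^ 3"
        proof -
          have "150 * x ^ 2 \<le> x * x ^ 2" using lg(2) by (intro mult_right_mono) auto
          moreover have "1 * x \<le> x * x" using lg(2) by (intro mult_right_mono) auto
          moreover have "0 \<le> x * x" "x ^ 3 = x * x ^ 2" "x ^ 2 = x * x"
            by (simp_all add: power2_eq_square power3_eq_cube)
          ultimately show ?thesis by linarith
        qed
        then have "1 / \<epsilon> * (144 * x ^ 2 + \<kappa>) \<le> 1 / \<epsilon> * x ^ 3"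
          using eps0 by (intro mult_left_mono) (auto simp: \<kappa>_def)
        then show "8 * pr * D + \<kappa> \<le> 1 / \<epsilon> * x ^ 3" using a c by (simp only: distrib_left)
      qed simp
      finally show ?thesis by (simp add: Hedges x_def mult_ac)
    qed
    ultimately show "r \<in> Corr" using e(1) len_r by (auto simp: Corr_def)
  qed
  moreover have fin: "finite Corr"
    by (rule finite_subset[OF _ finite_bitlists[of T]]) (auto simp: Corr_def bitlists_def)
  ultimately have GC: "card Good \<le> card Corr" by (rule card_mono[rotated])
  define Bad where "Bad = {r\<in>bitlists T. \<not> good_sample n (edges G) pr \<kappa> (sample_edges k r)}"
  have "real (card Bad) \<le> 2 ^ T * (3 * ((1 + 2 * exp (- \<kappa>)) ^ n - 1))"
    unfolding Bad_def pr_def sample_edges_def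
  proof (rule card_not_good_sample)
    show "finite (edges G)" by (rule finite_edges[OF wf])
    show "e \<subseteq> {..<n} \<and> card e = 2" if "e \<in> edges G" for e
      using wf that nv by (auto simp: wf_weighted_graph_def atLeast0LessThan)
    have "k \<le> n" using kn less_exp[of k] by linarith
    then have "n * n * k \<le> n * n * n" by (rule mult_left_mono) simp
    then show "n * n * k \<le> T" using len by linarith
  qed (use edge_index_inj edge_index_lt in auto)
  also have "\<dots> \<le> 2 ^ T * (3 * (1 / 9))"
  proof (intro mult_left_mono)
    \<comment> \<open>The choice \<open>\<kappa> = 2 * ln n\<close> turns the union bound into
      \<open>(1 + 2 / n\<^sup>2) ^ n - 1\<close>, which is of order 1 / n; below 1/9 it leaves the
      three tests a total failure probability of at most 1/3.\<close>
    have ek: "exp (- \<kappa>) = 1 / real n ^ 2"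
      using n0 by (simp add: \<kappa>_def x_def exp_minus exp_double divide_inverse)
    have "(1 + 2 * exp (- \<kappa>)) ^ n \<le> exp (2 * exp (- \<kappa>)) ^ n"
      by (intro power_mono exp_ge_add_one_self) auto
    also have "\<dots> = exp (real n * (2 * exp (- \<kappa>)))" by (simp add: exp_of_nat_mult)
    also have "real n * (2 * exp (- \<kappa>)) = 2 / n" using n0 by (simp add: ek power2_eq_square)
    also have "exp (2 / real n) \<le> exp (1 / 20)" using lg(1) by (simp add: field_simps)
    also have "exp (1 / 20) \<le> 1 + 1 / 20 + (1 / 20 :: real)\<^sup>2" by (rule exp_bound) auto
    finally show "(1 + 2 * exp (- \<kappa>)) ^ n - 1 \<le> 1 / 9" by (simp add: power2_eq_square)
  qed auto
  finally have bad: "real (card Bad) \<le> 2 ^ T / 3" by simp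
  have "bitlists T = Good \<union> Bad" "Good \<inter> Bad = {}" by (auto simp: Good_def Bad_def)
  then have "card (bitlists T) = card Good + card Bad"
    by (metis card_Un_disjoint finite_Un finite_bitlists)
  then have "real (card Good) + real (card Bad) = 2 ^ T"
    by (metis card_bitlists of_nat_add of_nat_numeral of_nat_power)
  then show "2 / 3 * 2 ^ T \<le> real (card {r. length r = T \<and> (\<exists>t s' r'.
      exec sparsify_prog ?s r t s' r' \<and> resistance_sparsifier \<epsilon> G (decode_graph n s') \<and>
      2 * real (card (edges (decode_graph n s'))) \<le> 1 / \<epsilon> * real n * ln (real n) ^ 3)})"
    using bad GC unfolding Corr_def[symmetric] by linarith
qed


section \<open>The polylogarithmic exponent and the final statement\<close>

text \<open>The origin of the absolute constant 3: as \<beta> and \<gamma> are at most 1, dividing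
  by \<open>\<beta> * \<gamma>\<^sup>2\<close> only enlarges the exponent.\<close>

lemma polylog_exponent:
  fixes \<beta> \<gamma> x :: real
  assumes "0 < \<beta>" "\<beta> \<le> 1" "0 < \<gamma>" "\<gamma> \<le> 1" "x \<ge> 1"
  shows "x ^ 3 \<le> x powr (3 / (\<beta> * \<gamma>\<^sup>2))"
proof -
  have "\<beta> * \<gamma>\<^sup>2 \<le> 1 * 1" using assms by (intro mult_mono power_le_one) auto
  then have "3 \<le> 3 / (\<beta> * \<gamma>\<^sup>2)" using assms by (simp add: field_simps)
  then have "x powr 3 \<le> x powr (3 / (\<beta> * \<gamma>\<^sup>2))" using assms by (intro powr_mono) auto
  then show ?thesis using assms by simp
qed

lemma sparsifier_edge_bound:
  fixes \<beta> \<gamma> \<epsilon> :: real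
  assumes large: "large_enough \<beta> \<gamma> n" and beta: "\<beta> > 0" and gamma: "\<gamma> > 0"
    and reg: "regular_graph D G" and nv: "num_verts G = n" and D: "real D \<ge> \<beta> * real n"
    and expa: "edge_expansion G \<ge> \<gamma> * real D" and eps: "0 < \<epsilon>"
    and m: "2 * m \<le> 1 / \<epsilon> * real n * ln (real n) ^ 3"
  shows "2 * m \<le> 1 / \<epsilon> * real n * ln (real n) powr (3 / (\<beta> * \<gamma>\<^sup>2))"
proof -
  have n: "n \<ge> 40" "150 \<le> ln (real n)" using large by (auto simp: large_enough_def)
  have "\<beta> * n > 0" using beta n by simp
  then have D0: "D > 0" using D by (metis of_nat_0 not_less gr0I order.strict_iff_not order_trans)
  have b: "D \<le> n" "\<gamma> \<le> 1" using regular_degree_bounds[OF reg nv _ expa D0] n by auto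
  then have "\<beta> * real n \<le> 1 * real n" using D by simp
  then have "\<beta> \<le> 1" using n by (simp add: mult_le_cancel_right)
  then have "ln (real n) ^ 3 \<le> ln (real n) powr (3 / (\<beta> * \<gamma>\<^sup>2))"
    using beta gamma b n by (intro polylog_exponent) auto
  then have "1 / \<epsilon> * real n * ln (real n) ^ 3 \<le> 1 / \<epsilon> * real n * ln (real n) powr (3 / (\<beta> * \<gamma>\<^sup>2))"
    using eps by (intro mult_left_mono) auto
  then show ?thesis using m by linarith
qed

lemma prob_uniform_bitlists:
  "measure_pmf.prob (pmf_of_set {r :: bool list. length r = T}) A =
    real (card {r. length r = T \<and> r \<in> A}) / 2 ^ T"
proof -
  have "{r :: bool list. length r = T} = bitlists T" by (simp add: bitlists_def)
  moreover have "bitlists T \<noteq> {}" using card_bitlists[of T] by (metis card.empty power_not_zero zero_neq_numeral)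
  moreover have "bitlists T \<inter> A = {r. length r = T \<and> r \<in> A}" by (auto simp: bitlists_def)
  ultimately show ?thesis by (simp add: measure_pmf_of_set)
qed

theorem theorem1:
  "\<exists>C::real. C > 0 \<and> (\<forall>\<beta> \<gamma> :: real. \<beta> > 0 \<and> \<gamma> > 0 \<longrightarrow> (\<exists>N::nat.
     (\<forall>(n::nat) (\<epsilon>::real) (D::nat) (G::weighted_graph).
        n \<ge> N \<and> 1 / real n powr 0.99 < \<epsilon> \<and> \<epsilon> < 1 \<and>
        num_verts G = n \<and> regular_graph D G \<and>
        real D \<ge> \<beta> * real n \<and> edge_expansion G \<ge> \<gamma> * real D \<longrightarrow>
        (\<exists>H. resistance_sparsifier \<epsilon> G H \<and>
           real (card (edges H)) \<le> 1 / \<epsilon> * real n * ln (real n) powr (C / (\<beta> * \<gamma>\<^sup>2)))) \<and>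
     randomized_poly_time
       {(G, p, q). num_verts G \<ge> N \<and>
          1 / real (num_verts G) powr 0.99 < real p / real q \<and> real p / real q < 1 \<and>
          (\<exists>D. regular_graph D G \<and> real D \<ge> \<beta> * real (num_verts G) \<and>
             edge_expansion G \<ge> \<gamma> * real D)}
       instance_size encode_instance
       (\<lambda>(G, p, q) s. let n = num_verts G; \<epsilon> = real p / real q; H = decode_graph n s in
          resistance_sparsifier \<epsilon> G H \<and>
          real (card (edges H)) \<le> 1 / \<epsilon> * real n * ln (real n) powr (C / (\<beta> * \<gamma>\<^sup>2)))))"
proof (intro exI[of _ "3::real"] conjI allI impI)
  show "(0::real) < 3" by simp
next
  fix \<beta> \<gamma> :: real
  assume "\<beta> > 0 \<and> \<gamma> > 0"
  then have beta: "\<beta> > 0" and gamma: "\<gamma> > 0" by auto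
  obtain N where N: "\<And>n. n \<ge> N \<Longrightarrow> large_enough \<beta> \<gamma> n"
    using eventually_large_enough[OF beta gamma] by blast
  let ?B = "\<lambda>\<epsilon> n. 1 / \<epsilon> * real n * ln (real n) powr (3 / (\<beta> * \<gamma>\<^sup>2))"
  show "\<exists>N. (\<forall>(n::nat) (\<epsilon>::real) (D::nat) (G::weighted_graph).
        n \<ge> N \<and> 1 / real n powr 0.99 < \<epsilon> \<and> \<epsilon> < 1 \<and>
        num_verts G = n \<and> regular_graph D G \<and>
        real D \<ge> \<beta> * real n \<and> edge_expansion G \<ge> \<gamma> * real D \<longrightarrow>
        (\<exists>H. resistance_sparsifier \<epsilon> G H \<and>
           real (card (edges H)) \<le> 1 / \<epsilon> * real n * ln (real n) powr (3 / (\<beta> * \<gamma>\<^sup>2)))) \<and>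
     randomized_poly_time
       {(G, p, q). num_verts G \<ge> N \<and>
          1 / real (num_verts G) powr 0.99 < real p / real q \<and> real p / real q < 1 \<and>
          (\<exists>D. regular_graph D G \<and> real D \<ge> \<beta> * real (num_verts G) \<and>
             edge_expansion G \<ge> \<gamma> * real D)}
       instance_size encode_instance
       (\<lambda>(G, p, q) s. let n = num_verts G; \<epsilon> = real p / real q; H = decode_graph n s in
          resistance_sparsifier \<epsilon> G H \<and>
          real (card (edges H)) \<le> 1 / \<epsilon> * real n * ln (real n) powr (3 / (\<beta> * \<gamma>\<^sup>2)))"
  proof (intro exI[of _ N] conjI allI impI)
    fix n :: nat and \<epsilon> :: real and D :: nat and G :: weighted_graph
    assume h: "n \<ge> N \<and> 1 / real n powr 0.99 < \<epsilon> \<and> \<epsilon> < 1 \<and>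
        num_verts G = n \<and> regular_graph D G \<and>
        real D \<ge> \<beta> * real n \<and> edge_expansion G \<ge> \<gamma> * real D"
    note large = N[of n]
    have npos: "0 < 1 / real n powr 0.99" using large h by (simp add: large_enough_def)
    then have eps0: "0 < \<epsilon>" using h by linarith
    \<comment> \<open>The program takes a rational accuracy. A rational \<open>\<delta>\<close> in
      this interval still exceeds the lower limit for accuracies, and being more than
      \<open>\<epsilon> / 2\<close> it at most doubles the edge bound.\<close>
    have "max (\<epsilon> / 2) (1 / real n powr 0.99) < \<epsilon>" using h eps0 by simp
    then obtain \<delta> where \<delta>: "\<delta> \<in> \<rat>" "max (\<epsilon> / 2) (1 / real n powr 0.99) < \<delta>" "\<delta> < \<epsilon>"
      using Rats_dense_in_real by blast
    then have d: "\<epsilon> / 2 < \<delta>" "1 / real n powr 0.99 < \<delta>" "0 < \<delta>" "\<delta> < 1" using npos h eps0 by auto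
    obtain p q :: nat where pq: "q \<noteq> 0" "\<bar>\<delta>\<bar> = real p / real q"
      using Rats_abs_nat_div_natE[OF \<delta>(1)] by metis
    define T where "T = instance_size (G, p, q) ^ 41 + 41"
    have \<delta>pq: "\<delta> = real p / real q" using pq d by simp
    have "2 / 3 * 2 ^ T \<le> real (card {r. length r = T \<and> (\<exists>t s' r'.
      exec sparsify_prog (encode_instance (G, p, q)) r t s' r' \<and>
      resistance_sparsifier \<delta> G (decode_graph n s') \<and>
      2 * real (card (edges (decode_graph n s'))) \<le> 1 / \<delta> * real n * ln (real n) ^ 3)})"
      using sparsify_prog_correct(2)[OF large beta gamma _ _ _ _ \<delta>pq d(2) d(4) T_def] h by blast
    \<comment> \<open>Existence by the probabilistic method: some tape succeeds, and the graph it
      yields is the sparsifier.\<close>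
    moreover have "(0::real) < 2 / 3 * 2 ^ T" by simp
    ultimately have "{r. length r = T \<and> (\<exists>t s' r'.
      exec sparsify_prog (encode_instance (G, p, q)) r t s' r' \<and>
      resistance_sparsifier \<delta> G (decode_graph n s') \<and>
      2 * real (card (edges (decode_graph n s'))) \<le> 1 / \<delta> * real n * ln (real n) ^ 3)} \<noteq> {}"
      by (metis card.empty not_less of_nat_0)
    then obtain H where H: "resistance_sparsifier \<delta> G H"
      "2 * real (card (edges H)) \<le> 1 / \<delta> * real n * ln (real n) ^ 3" by blast
    have "2 * real (card (edges H)) \<le> ?B \<delta> n"
      using sparsifier_edge_bound[OF large beta gamma _ _ _ _ d(3) H(2), of D G] h by blast
    also have "?B \<delta> n \<le> ?B (\<epsilon> / 2) n"
      using d eps0 by (intro mult_right_mono) (auto simp: field_simps)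
    also have "\<dots> = 2 * ?B \<epsilon> n" by simp
    finally have "real (card (edges H)) \<le> ?B \<epsilon> n" by linarith
    moreover have "resistance_sparsifier \<epsilon> G H"
      unfolding resistance_sparsifier_def
    proof (intro conjI allI impI)
      show "reweighted_subgraph H G" using H(1) by (simp add: resistance_sparsifier_def)
      fix u v assume uv: "u < num_verts G" "v < num_verts G"
      let ?R = "effective_resistance H u v"
      have b: "(1 - \<delta>) * ?R \<le> effective_resistance G u v" "effective_resistance G u v \<le> (1 + \<delta>) * ?R"
        using H(1) uv by (auto simp: resistance_sparsifier_def)
      \<comment> \<open>The two bounds themselves force the resistances of \<open>H\<close> to be
        nonnegative, and this makes the sparsifier inequalities monotone in the accuracy.\<close>
      then have "(1 - \<delta>) * ?R \<le> (1 + \<delta>) * ?R" by linarith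
      then have "0 \<le> 2 * \<delta> * ?R" by (simp add: algebra_simps)
      then have R0: "0 \<le> ?R" using d by (simp add: zero_le_mult_iff)
      have "(1 - \<epsilon>) * ?R \<le> (1 - \<delta>) * ?R" using \<delta> R0 by (intro mult_right_mono) auto
      then show "(1 - \<epsilon>) * ?R \<le> effective_resistance G u v" using b by linarith
      have "(1 + \<delta>) * ?R \<le> (1 + \<epsilon>) * ?R" using \<delta> R0 by (intro mult_right_mono) auto
      then show "effective_resistance G u v \<le> (1 + \<epsilon>) * ?R" using b by linarith
    qed
    ultimately show "\<exists>H. resistance_sparsifier \<epsilon> G H \<and> real (card (edges H)) \<le> ?B \<epsilon> n" by blast
  next
    let ?inst = "{(G, p, q). num_verts G \<ge> N \<and>
          1 / real (num_verts G) powr 0.99 < real p / real q \<and> real p / real q < 1 \<and>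
          (\<exists>D. regular_graph D G \<and> real D \<ge> \<beta> * real (num_verts G) \<and>
             edge_expansion G \<ge> \<gamma> * real D)}"
    let ?correct = "\<lambda>(G, p, q) s. let n = num_verts G; \<epsilon> = real p / real q; H = decode_graph n s in
          resistance_sparsifier \<epsilon> G H \<and>
          real (card (edges H)) \<le> 1 / \<epsilon> * real n * ln (real n) powr (3 / (\<beta> * \<gamma>\<^sup>2))"
    show "randomized_poly_time ?inst instance_size encode_instance ?correct"
      unfolding randomized_poly_time_def
    proof (intro exI[of _ sparsify_prog] exI[of _ "41::nat"] ballI)
      fix x assume x: "x \<in> ?inst"
      obtain G p q where xe: "x = (G, p, q)" by (cases x)
      define n where "n = num_verts G"
      define \<epsilon> where "\<epsilon> = real p / real q"
      obtain D where h: "n \<ge> N" "1 / real n powr 0.99 < \<epsilon>" "\<epsilon> < 1" "regular_graph D G"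
        "real D \<ge> \<beta> * real n" "edge_expansion G \<ge> \<gamma> * real D"
        using x unfolding xe n_def \<epsilon>_def by auto
      define T where "T = instance_size (G, p, q) ^ 41 + 41"
      note large = N[OF h(1)]
      have "0 < 1 / real n powr 0.99" using large by (simp add: large_enough_def)
      then have eps0: "0 < \<epsilon>" using h by linarith
      note C = sparsify_prog_correct[OF large beta gamma h(4) n_def[symmetric] h(5,6) \<epsilon>_def h(2,3) T_def]
      let ?ok = "{r. \<exists>t s' r'. exec sparsify_prog (encode_instance x) r t s' r' \<and> ?correct x s'}"
      have "{r. length r = T \<and> (\<exists>t s' r'.
          exec sparsify_prog (encode_instance (G, p, q)) r t s' r' \<and>
          resistance_sparsifier \<epsilon> G (decode_graph n s') \<and>
          2 * real (card (edges (decode_graph n s'))) \<le> 1 / \<epsilon> * real n * ln (real n) ^ 3)}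
        \<subseteq> {r. length r = T \<and> r \<in> ?ok}" (is "?A \<subseteq> ?A'")
      proof
        fix r assume "r \<in> ?A"
        then obtain t s' r' where e: "length r = T" "exec sparsify_prog (encode_instance (G, p, q)) r t s' r'"
          "resistance_sparsifier \<epsilon> G (decode_graph n s')"
          "2 * real (card (edges (decode_graph n s'))) \<le> 1 / \<epsilon> * real n * ln (real n) ^ 3" by blast
        have "2 * real (card (edges (decode_graph n s'))) \<le> ?B \<epsilon> n"
          by (rule sparsifier_edge_bound[OF large beta gamma h(4) n_def[symmetric] h(5,6) eps0 e(4)])
        then have "real (card (edges (decode_graph n s'))) \<le> ?B \<epsilon> n" by linarith
        then have "?correct x s'" using e(3) by (simp only: xe Let_def n_def[symmetric] \<epsilon>_def[symmetric] prod.case)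
        then show "r \<in> ?A'" using e xe by blast
      qed
      then have "card ?A \<le> card ?A'"
        by (intro card_mono finite_subset[OF _ finite_bitlists[of T]]) (auto simp: bitlists_def)
      then have "2 / 3 * 2 ^ T \<le> real (card ?A')" using C(2) by linarith
      then have "2 / 3 \<le> measure_pmf.prob (pmf_of_set {r :: bool list. length r = T}) ?ok"
        unfolding prob_uniform_bitlists by (simp add: field_simps)
      moreover have "\<forall>r\<in>{r. length r = T}. \<exists>t s' r'. exec sparsify_prog (encode_instance x) r t s' r' \<and> t \<le> T"
        using C(1) xe by blast
      ultimately show "let T = instance_size x ^ 41 + 41; R = {r :: bool list. length r = T}
        in (\<forall>r\<in>R. \<exists>t s' r'. exec sparsify_prog (encode_instance x) r t s' r' \<and> t \<le> T) \<and>
          2 / 3 \<le> measure_pmf.prob (pmf_of_set R)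
            {r. \<exists>t s' r'. exec sparsify_prog (encode_instance x) r t s' r' \<and> ?correct x s'}"
        unfolding Let_def xe T_def by blast
    qed
  qed
qed

end
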